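(* For all positive integers $m$ and $n$, the number $$\frac{4}{\pi^{2m+1}}\sum_{\ell=1}^{m+1}(-1)^{\ell-1}\binom{2m}{2\ell-1}\int_0^\infty [\pi I_0(t)]^{2(m-\ell)+1}[K_0(t)]^{2(m+\ell)-1}(2t)^{2(n+m)-3}\,dt$$ is a positive integer.
   Context: $I_0$ and $K_0$ are the modified Bessel functions of order zero, given for $t>0$ by $I_0(t)=\frac1\pi\int_0^\pi e^{t\cos\theta}\,d\theta$ and $K_0(t)=\int_0^\infty e^{-t\cosh u}\,du$. Binomial coefficients are $\binom{N}{j}=\frac{N!}{j!(N-j)!}$ for $0\le j\le N$ and $\binom{N}{j}=0$ for $j>N$, so the summand with $\ell=m+1$ is zero. *)

theory Defs
  imports "HOL-Analysis.Analysis"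
begin

definition bessel_I0 :: "real \<Rightarrow> real" where
  "bessel_I0 t = 1 / pi * (LBINT \<theta>:{0..pi}. exp (t * cos \<theta>))"

(* Only meaningful for t > 0; for t \<le> 0 the integral diverges and the value is the default 0. *)
definition bessel_K0 :: "real \<Rightarrow> real" where
  "bessel_K0 t = (LBINT u:{0<..}. exp (- t * cosh u))"

end

(*
  The sum is the imaginary part of (K0 (pi I0 + i K0))^(2m), which up to sign is the boundary value on the
  positive axis of h^(2m), h(z) = K0(z) K0(z e^(-i pi)) / i, on the upper half plane. Cauchy's formula
  writes h(iy)^(2m) as a Stieltjes integral of this imaginary part, so that the integrals in question
  are the coefficients of the asymptotic expansion of h(iy)^(2m) as y tends to infinity. On the other
  hand h(iy) = pi w(Y) / (2iy) asymptotically, where w is the formal product of the asymptotic series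
  of K0 at z and at -z and Y = 1/(2iy). The series w satisfies the third order equation of a
  product of two Bessel functions; it gives a recursion with positive coefficients for w, and its first
  integral gives a recursion for w^2 from which w^2 has integer coefficients.
*)
theory Submission
  imports Defs "HOL-Complex_Analysis.Complex_Analysis" "HOL-Probability.Distributions"
begin

section \<open>The formal series\<close>

text \<open>Two features shape the argument, the exponentials and a singularity. Both factors of
  \<open>h\<close> are written as Gaussian integrals of exp(-s^2) / sqrt(2z + \<sigma> s^2) with
  \<sigma> = 1 or -1: the exponential factors of the two Bessel functions split off and cancel in
  the product, and the continuation to the upper half plane is explicit. On the real axis one of the
  two integrands is singular at s^2 = 2|x|, so the bounds are made to depend on Re z alone; they
  then hold up to the boundary, and Cauchy's formula can be pushed down to it. The even exponent 2m
  has three effects: h(-conj z) = -conj(h(z)) makes the real parts cancel in the Cauchy integral; h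
  itself is only of order 1/z at infinity, too large for an integrable majorant; and only powers of
  w^2 occur. The last point is essential: w = 1 + Y^2/2 + 27 Y^4/8 + ... is not integral, whereas
  w^2 = 1 + Y^2 + 7 Y^4 + ... is. Positivity is read off from w, integrality from w^2.\<close>

text \<open>$K_0(z) \sim \sqrt{\pi}\,(2z)^{-1/2} e^{-z} \sum_j a_j (2z)^{-j}$, where $a_j$ is the following coefficient.\<close>

definition bessel_asym_coeff :: "nat \<Rightarrow> real" where
  "bessel_asym_coeff j = (-1/2 gchoose j) * fact (2 * j) / (4 ^ j * fact j)"

lemma bessel_asym_coeff_0: "bessel_asym_coeff 0 = 1"
  by (simp add: bessel_asym_coeff_def)

lemma gbinomial_minus_half_Suc:
  "real (Suc j) * ((-1/2::real) gchoose (Suc j)) = (-1/2 - real j) * ((-1/2) gchoose j)"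
  using gbinomial_absorb_comp[of "-1/2::real" j] gbinomial_absorption'[of "Suc j" "-1/2::real"]
  by (simp add: gbinomial_mult_1 algebra_simps)

lemma bessel_asym_coeff_Suc:
  "4 * real (Suc j) * bessel_asym_coeff (Suc j) = - ((2 * real j + 1)\<^sup>2 * bessel_asym_coeff j)"
proof -
  have "bessel_asym_coeff (Suc j) * real (Suc j) = ((-1/2 - real j) * ((-1/2) gchoose j)) * fact (2 * Suc j) / (4 ^ Suc j * fact (Suc j))"
    unfolding bessel_asym_coeff_def gbinomial_minus_half_Suc[symmetric] by simp
  also have "fact (2 * Suc j) = (2 * real j + 2) * (2 * real j + 1) * fact (2 * j)"
    by (simp add: algebra_simps)
  also have "fact (Suc j) = (real j + 1) * fact j" by (simp add: algebra_simps)
  also have "((-1/2 - real j) * ((-1/2) gchoose j)) * ((2 * real j + 2) * (2 * real j + 1) * fact (2 * j)) / (4 ^ Suc j * ((real j + 1) * fact j))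
     = ((real j + 1) / (real j + 1)) * (- ((2 * real j + 1)\<^sup>2 * bessel_asym_coeff j) / 4)"
    unfolding bessel_asym_coeff_def by (simp add: divide_simps power2_eq_square) (simp add: algebra_simps)
  finally show ?thesis by (simp add: algebra_simps)
qed

definition bessel_fps :: "real fps" where
  "bessel_fps = Abs_fps bessel_asym_coeff"

definition bessel_fps_neg :: "real fps" where
  "bessel_fps_neg = Abs_fps (\<lambda>j. (-1) ^ j * bessel_asym_coeff j)"

text \<open>The series w of the overview, in the variable \<open>1/(2z)\<close>; the second factor
  belongs to \<open>-z\<close>.\<close>

definition bessel_prod_fps :: "real fps" where
  "bessel_prod_fps = bessel_fps * bessel_fps_neg"

lemma fps_X_power_deriv_nth:
  fixes F :: "real fps"
  shows "(fps_X * fps_deriv F) $ n = real n * F $ n"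
    and "(fps_X\<^sup>2 * fps_deriv (fps_deriv F)) $ n = real n * (real n - 1) * F $ n"
    and "(fps_X ^ 3 * fps_deriv (fps_deriv (fps_deriv F))) $ n
      = real n * (real n - 1) * (real n - 2) * F $ n"
proof -
  show "(fps_X * fps_deriv F) $ n = real n * F $ n"
    by (cases n) auto
  show "(fps_X\<^sup>2 * fps_deriv (fps_deriv F)) $ n = real n * (real n - 1) * F $ n"
  proof (cases "n < 2")
    case True
    then have "n = 0 \<or> n = 1" by auto
    then show ?thesis by (auto simp: fps_X_power_mult_nth)
  next
    case False
    then obtain k where "n = Suc (Suc k)" by (metis One_nat_def less_2_cases_iff not0_implies_Suc)
    then show ?thesis by (simp add: fps_X_power_mult_nth; simp add: algebra_simps)
  qed
  show "(fps_X ^ 3 * fps_deriv (fps_deriv (fps_deriv F))) $ n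
      = real n * (real n - 1) * (real n - 2) * F $ n"
  proof (cases "n < 3")
    case True
    then have "n = 0 \<or> n = 1 \<or> n = 2" by auto
    then show ?thesis by (auto simp: fps_X_power_mult_nth)
  next
    case False
    define k where "k = n - 3"
    have "n = k + 3" using False by (simp add: k_def)
    then show ?thesis by (simp add: fps_X_power_mult_nth numeral_3_eq_3; simp add: algebra_simps)
  qed
qed

text \<open>This is the modified Bessel equation of order 0 after the factor (2z)^(-1/2) e^(-z) is
  removed and \<open>1/(2z)\<close> is taken as variable. Coefficientwise it is the recursion
  \<open>bessel_asym_coeff_Suc\<close>.\<close>

lemma bessel_fps_ode:
  "4 * (fps_X\<^sup>2 * fps_deriv (fps_deriv bessel_fps))
    = - (4 * fps_deriv bessel_fps + 8 * (fps_X * fps_deriv bessel_fps) + bessel_fps)"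
proof (rule fps_ext)
  fix n
  show "(4 * (fps_X\<^sup>2 * fps_deriv (fps_deriv bessel_fps))) $ n
    = (- (4 * fps_deriv bessel_fps + 8 * (fps_X * fps_deriv bessel_fps) + bessel_fps)) $ n"
    using bessel_asym_coeff_Suc[of n]
    by (simp add: fps_X_power_deriv_nth fps_mult_numeral_left bessel_fps_def del: of_nat_Suc)
       (cases "n = 0"; simp add: algebra_simps power2_eq_square)
qed

lemma bessel_fps_neg_ode:
  "4 * (fps_X\<^sup>2 * fps_deriv (fps_deriv bessel_fps_neg))
    = 4 * fps_deriv bessel_fps_neg - 8 * (fps_X * fps_deriv bessel_fps_neg) - bessel_fps_neg"
proof (rule fps_ext)
  fix n
  have "4 * real (Suc n) * ((-1) ^ Suc n * bessel_asym_coeff (Suc n)) = (-1) ^ n * ((2 * real n + 1) ^ 2 * bessel_asym_coeff n)"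
    using arg_cong[OF bessel_asym_coeff_Suc[of n], of "\<lambda>x. (-1) ^ Suc n * x"] by (simp add: algebra_simps)
  then show "(4 * (fps_X\<^sup>2 * fps_deriv (fps_deriv bessel_fps_neg))) $ n
    = (4 * fps_deriv bessel_fps_neg - 8 * (fps_X * fps_deriv bessel_fps_neg) - bessel_fps_neg) $ n"
    by (simp add: fps_X_power_deriv_nth fps_mult_numeral_left bessel_fps_neg_def del: of_nat_Suc power_Suc)
       (cases "n = 0"; simp add: algebra_simps power2_eq_square)
qed


text \<open>With the Euler operator \<theta> = X d/dX the right side is X (\<theta> + 1)^3 W. The
  equation is therefore a two-term recursion, with the factor (k + 1)^3 / (k + 2) from index k to
  index k + 2.\<close>

lemma bessel_prod_fps_ode:
  defines "W \<equiv> bessel_prod_fps"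
  shows "fps_deriv W = fps_X * (W + 7 * (fps_X * fps_deriv W)
    + 6 * (fps_X\<^sup>2 * fps_deriv (fps_deriv W)) + fps_X ^ 3 * fps_deriv (fps_deriv (fps_deriv W)))"
proof -
  define a0 a1 a2 a3 where "a0 = bessel_fps" "a1 = fps_deriv a0" "a2 = fps_deriv a1" "a3 = fps_deriv a2"
  note a = this
  define b0 b1 b2 b3 where "b0 = bessel_fps_neg" "b1 = fps_deriv b0" "b2 = fps_deriv b1" "b3 = fps_deriv b2"
  note b = this
  define X :: "real fps" where "X = fps_X"
  have dX: "fps_deriv X = 1" by (simp add: X_def)
  have h1: "4 * (X\<^sup>2 * a2) = - (4 * a1 + 8 * (X * a1) + a0)"
    using bessel_fps_ode by (simp add: a X_def)
  have k1: "4 * (X\<^sup>2 * b2) = 4 * b1 - 8 * (X * b1) - b0"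
    using bessel_fps_neg_ode by (simp add: b X_def)
  have h3: "4 * (X\<^sup>2 * a3 + 2 * X * a2) = - (4 * a2 + 8 * (X * a2 + a1) + a1)"
    using arg_cong[OF h1, of fps_deriv] by (simp add: a dX power2_eq_square algebra_simps)
  have k3: "4 * (X\<^sup>2 * b3 + 2 * X * b2) = 4 * b2 - 8 * (X * b2 + b1) - b1"
    using arg_cong[OF k1, of fps_deriv] by (simp add: b dX power2_eq_square algebra_simps)
  have W0: "W = a0 * b0" by (simp add: W_def bessel_prod_fps_def a b)
  have W1: "fps_deriv W = a1 * b0 + a0 * b1" by (simp add: W0 a b)
  have W2: "fps_deriv (fps_deriv W) = a2 * b0 + 2 * a1 * b1 + a0 * b2"
    unfolding W1 by (simp add: a b algebra_simps)
  have W3: "fps_deriv (fps_deriv (fps_deriv W)) = a3 * b0 + 3 * a2 * b1 + 3 * a1 * b2 + a0 * b3"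
    unfolding W2 by (simp add: a b algebra_simps)
  \<comment> \<open>An explicit combination of the two second order equations and their derivatives.
    The multipliers \<open>X\<^sup>2 * b0\<close> and \<open>X\<^sup>2 * a0\<close> account for the
    third derivatives, the other two for the second derivatives that are then left.\<close>
  have "4 * (X * (W + 7 * (X * fps_deriv W)
    + 6 * (X\<^sup>2 * fps_deriv (fps_deriv W)) + X ^ 3 * fps_deriv (fps_deriv (fps_deriv W))) - fps_deriv W)
    = X\<^sup>2 * b0 * (4 * (X\<^sup>2 * a3 + 2 * X * a2) + (4 * a2 + 8 * (X * a2 + a1) + a1))
    + X\<^sup>2 * a0 * (4 * (X\<^sup>2 * b3 + 2 * X * b2) - (4 * b2 - 8 * (X * b2 + b1) - b1))
    + ((2 * X - 1) * b0 + 3 * X\<^sup>2 * b1) * (4 * (X\<^sup>2 * a2) + (4 * a1 + 8 * (X * a1) + a0))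
    + ((2 * X + 1) * a0 + 3 * X\<^sup>2 * a1) * (4 * (X\<^sup>2 * b2) - (4 * b1 - 8 * (X * b1) - b0))"
    unfolding W3 unfolding W2 unfolding W1 unfolding W0 by algebra
  also have "\<dots> = 0" unfolding h1 k1 h3 k3 by simp
  finally show ?thesis by (simp add: X_def)
qed

lemma bessel_prod_fps_Suc_0: "bessel_prod_fps $ Suc 0 = 0"
  using arg_cong[OF bessel_prod_fps_ode, of "\<lambda>F. fps_nth F 0"] by simp

lemma bessel_prod_fps_0: "bessel_prod_fps $ 0 = 1"
  by (simp add: bessel_prod_fps_def bessel_fps_def bessel_fps_neg_def bessel_asym_coeff_0)

lemma bessel_prod_fps_Suc_Suc:
  "bessel_prod_fps $ Suc (Suc k) = (real k + 1) ^ 3 / (real k + 2) * bessel_prod_fps $ k"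
proof -
  have "(real k + 2) * bessel_prod_fps $ Suc (Suc k) = (real k + 1) ^ 3 * bessel_prod_fps $ k"
  proof -
    define R where "R = bessel_prod_fps + 7 * (fps_X * fps_deriv bessel_prod_fps)
      + 6 * (fps_X\<^sup>2 * fps_deriv (fps_deriv bessel_prod_fps))
      + fps_X ^ 3 * fps_deriv (fps_deriv (fps_deriv bessel_prod_fps))"
    have "fps_deriv bessel_prod_fps $ Suc k = (fps_X * R) $ Suc k"
      using bessel_prod_fps_ode unfolding R_def by metis
    also have "\<dots> = R $ k" by simp
    also have "\<dots> = bessel_prod_fps $ k + 7 * (real k * bessel_prod_fps $ k)
      + 6 * (real k * (real k - 1) * bessel_prod_fps $ k)
      + real k * (real k - 1) * (real k - 2) * bessel_prod_fps $ k"
      unfolding R_def fps_add_nth fps_mult_numeral_left fps_X_power_deriv_nth ..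
    also have "\<dots> = (real k + 1) ^ 3 * bessel_prod_fps $ k"
      by (simp add: algebra_simps power3_eq_cube)
    finally show ?thesis by (simp add: algebra_simps)
  qed
  then show ?thesis by (simp add: field_simps)
qed

lemma bessel_prod_fps_odd: "odd k \<Longrightarrow> bessel_prod_fps $ k = 0"
proof (induction k rule: less_induct)
  case (less k)
  show ?case
  proof (cases "k = Suc 0")
    case False
    then obtain j where "k = Suc (Suc j)" using less.prems
      by (metis even_zero not0_implies_Suc)
    then show ?thesis using less by (simp add: bessel_prod_fps_Suc_Suc)
  qed (simp add: bessel_prod_fps_Suc_0)
qed

lemma bessel_prod_fps_even_pos: "bessel_prod_fps $ (2 * k) > 0"
  by (induction k) (simp_all add: bessel_prod_fps_0 bessel_prod_fps_Suc_Suc)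

lemma bessel_prod_fps_nonneg: "bessel_prod_fps $ k \<ge> 0"
  using bessel_prod_fps_odd[of k] bessel_prod_fps_even_pos[of "k div 2"] by (cases "odd k") auto

text \<open>In the Cauchy product F * F^(m-1) no summand is negative, and one of them is
  \<open>F $ k\<close> times the constant term 1.\<close>

lemma fps_power_nth_pos:
  fixes F :: "real fps"
  assumes "F $ 0 = 1" "\<And>k. F $ k \<ge> 0" "F $ k > 0" "m \<ge> 1"
  shows "(F ^ m) $ k > 0"
proof -
  have nn: "(F ^ i) $ j \<ge> 0" for i j
    by (induction i arbitrary: j) (auto simp: fps_mult_nth intro!: sum_nonneg mult_nonneg_nonneg assms(2))
  obtain i where m: "m = Suc i" using assms(4) by (cases m) auto
  have "0 < F $ k * (F ^ i) $ 0" using assms by (simp add: fps_power_zeroth)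
  also have "\<dots> \<le> (\<Sum>j=0..k. F $ j * (F ^ i) $ (k - j))"
    using member_le_sum[of k "{0..k}" "\<lambda>j. F $ j * (F ^ i) $ (k - j)"] nn assms(2) by auto
  finally show ?thesis by (simp add: m fps_mult_nth)
qed

text \<open>First integral of the third order equation: the derivative of the difference of the two sides is
  twice the series times that equation.\<close>

lemma bessel_prod_fps_sq_eq:
  defines "g \<equiv> bessel_prod_fps ^ 2"
  shows "g - 1 = fps_X\<^sup>2 * (g + 2 * (fps_X * fps_deriv g)
    + fps_X\<^sup>2 * (fps_deriv (fps_deriv g) - 3 * (fps_deriv bessel_prod_fps)\<^sup>2))"
proof -
  define X :: "real fps" where "X = fps_X"
  have dX: "fps_deriv X = 1" by (simp add: X_def)
  define w0 w1 w2 w3 where "w0 = bessel_prod_fps" "w1 = fps_deriv w0" "w2 = fps_deriv w1" "w3 = fps_deriv w2"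
  note w = this
  have dw: "fps_deriv w0 = w1" "fps_deriv w1 = w2" "fps_deriv w2 = w3" by (simp_all add: w)
  have ode: "w1 = X * (w0 + 7 * (X * w1) + 6 * (X\<^sup>2 * w2) + X ^ 3 * w3)"
    using bessel_prod_fps_ode by (simp add: w X_def)
  have g0: "g = w0 * w0" by (simp add: g_def w power2_eq_square)
  have g1: "fps_deriv g = 2 * w0 * w1" unfolding g0 by (simp add: dw)
  have g2: "fps_deriv (fps_deriv g) = 2 * w1 * w1 + 2 * w0 * w2" unfolding g1 by (simp add: dw algebra_simps)
  define F where "F = X\<^sup>2 * (g + 2 * (X * fps_deriv g)
    + X\<^sup>2 * (fps_deriv (fps_deriv g) - 3 * w1\<^sup>2)) - g"
  have F: "F = X * X * (w0 * w0) + 4 * X * X * X * w0 * w1 + X * X * X * X * (2 * w0 * w2 - w1 * w1) - w0 * w0"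
    unfolding F_def g2 unfolding g1 unfolding g0 by (simp add: algebra_simps power2_eq_square)
  have "fps_deriv F = 2 * w0 * (X * (w0 + 7 * (X * w1) + 6 * (X\<^sup>2 * w2) + X ^ 3 * w3) - w1)"
    unfolding F by (simp add: dw dX algebra_simps power2_eq_square power3_eq_cube)
  also have "\<dots> = 0" using ode by simp
  finally have "fps_deriv F = 0" .
  then have "F = fps_const (F $ 0)" by simp
  also have "F $ 0 = -1" by (simp add: F X_def w bessel_prod_fps_0)
  finally have "F = - 1" by (simp add: fps_const_neg[symmetric] del: fps_const_neg)
  then show ?thesis unfolding F_def X_def[symmetric] w(1)[symmetric] dw by (simp add: algebra_simps)
qed

section \<open>Integrality of the even powers\<close>

lemma fps_quotient_nth_Ints:
  fixes g v q :: "real fps"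
  assumes "g * v = q" "g $ 0 = 1" "\<And>i. i \<le> N \<Longrightarrow> g $ i \<in> \<int>" "\<And>i. i \<le> N \<Longrightarrow> q $ i \<in> \<int>" "n \<le> N"
  shows "v $ n \<in> \<int>"
  using assms(5)
proof (induction n rule: less_induct)
  case (less n)
  have "q $ n = (\<Sum>i=0..n. g $ i * v $ (n - i))" by (simp add: assms(1)[symmetric] fps_mult_nth)
  also have "\<dots> = v $ n + (\<Sum>i=Suc 0..n. g $ i * v $ (n - i))"
    by (simp add: sum.atLeast_Suc_atMost assms(2))
  \<comment> \<open>The constant term 1 of \<open>g\<close> lets the coefficient be isolated without
    a division. The bound \<open>N\<close> confines the claim to initial segments, which is all that
    a strong induction on the coefficients of \<open>g\<close> can supply.\<close>
  finally have "v $ n = q $ n - (\<Sum>i=Suc 0..n. g $ i * v $ (n - i))" by simp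
  also have "\<dots> \<in> \<int>"
    using less assms(3,4) by (auto intro!: Ints_diff Ints_sum Ints_mult)
  finally show ?case .
qed

lemma bessel_prod_fps_sq_odd: "odd n \<Longrightarrow> (bessel_prod_fps ^ 2) $ n = 0"
  unfolding power2_eq_square fps_mult_nth
  by (intro sum.neutral ballI) (metis atLeastAtMost_iff bessel_prod_fps_odd even_add le_add_diff_inverse mult_eq_0_iff)

text \<open>The term $3w'^2$ in the first integral is integral because $4w'^2 w^2 = ((w^2)')^2$ and $w^2$ is even,
  so that $(w^2)'/2$ has integer coefficients.\<close>

lemma bessel_prod_fps_sq_Ints: "(bessel_prod_fps ^ 2) $ n \<in> \<int>"
proof (induction n rule: less_induct)
  case (less n)
  define g where "g = bessel_prod_fps ^ 2"
  define v where "v = (fps_deriv bessel_prod_fps)\<^sup>2"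
  define d where "d = Abs_fps (\<lambda>k. real (Suc k) / 2 * g $ Suc k)"
  have g0: "g $ 0 = 1" by (simp add: g_def bessel_prod_fps_0 fps_power_zeroth)
  have gint: "g $ k \<in> \<int>" if "k < n" for k using less that by (simp add: g_def)
  have "2 * d = fps_deriv g"
    by (rule fps_ext) (simp add: d_def fps_mult_numeral_left)
  also have "\<dots> = 2 * (bessel_prod_fps * fps_deriv bessel_prod_fps)"
    by (simp add: g_def power2_eq_square)
  finally have d: "d = bessel_prod_fps * fps_deriv bessel_prod_fps" by simp
  have gv: "g * v = d * d" unfolding d by (simp add: g_def v_def power2_eq_square)
  have dint: "d $ k \<in> \<int>" if "Suc k < n" for k
  proof (cases "odd (Suc k)")
    case True
    then show ?thesis using bessel_prod_fps_sq_odd by (simp add: d_def g_def del: of_nat_Suc)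
  next
    case False
    then obtain j where "Suc k = 2 * j" by (auto elim: evenE simp del: even_Suc)
    then show ?thesis using gint[OF that] by (simp add: d_def del: of_nat_Suc)
  qed
  have vint: "v $ k \<in> \<int>" if "Suc k < n" for k
    by (rule fps_quotient_nth_Ints[OF gv g0, of k])
       (use that in \<open>auto simp: fps_mult_nth intro!: gint dint Ints_sum Ints_mult\<close>)
  have eq: "g - 1 = fps_X\<^sup>2 * (g + 2 * (fps_X * fps_deriv g)
    + (fps_X\<^sup>2 * fps_deriv (fps_deriv g) - 3 * (fps_X\<^sup>2 * v)))"
    using bessel_prod_fps_sq_eq by (simp add: g_def v_def algebra_simps)
  show ?case
  proof (cases "n < 2")
    case True
    then have "n = 0 \<or> n = 1" by auto
    then show ?thesis using g0 bessel_prod_fps_sq_odd[of n] by (auto simp: g_def)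
  next
    case False
    \<comment> \<open>The first integral expresses \<open>g $ n\<close> by \<open>g\<close> at n - 2
      and \<open>v\<close> at n - 4. The latter depends on \<open>g\<close> only up to n - 3, so the
      induction closes; for n < 4 the term with \<open>v\<close> is absent.\<close>
    define k where "k = n - 2"
    have n: "n = k + 2" using False by (simp add: k_def)
    define R where "R = g + 2 * (fps_X * fps_deriv g)
      + (fps_X\<^sup>2 * fps_deriv (fps_deriv g) - 3 * (fps_X\<^sup>2 * v))"
    have "g $ n = (g - 1) $ n" using n by simp
    also have "\<dots> = (fps_X\<^sup>2 * R) $ n" using eq unfolding R_def by simp
    also have "\<dots> = R $ k" by (simp add: n fps_X_power_mult_nth)
    also have "\<dots> = g $ k + 2 * (real k * g $ k) + (real k * (real k - 1) * g $ k - 3 * (fps_X\<^sup>2 * v) $ k)"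
      unfolding R_def fps_add_nth fps_sub_nth fps_mult_numeral_left fps_X_power_deriv_nth ..
    also have "\<dots> \<in> \<int>"
      using gint[of k] vint[of "k - 2"] n by (auto simp: fps_X_power_mult_nth intro!: Ints_add Ints_diff Ints_mult)
    finally show ?thesis by (simp add: g_def)
  qed
qed

lemma bessel_prod_fps_power_Ints: "(bessel_prod_fps ^ (2 * m)) $ n \<in> \<int>"
  unfolding power_mult
  by (induction m arbitrary: n) (auto simp: fps_mult_nth bessel_prod_fps_sq_Ints intro!: Ints_sum Ints_mult)

lemma bessel_prod_fps_power_nat:
  assumes "m \<ge> 1"
  obtains c :: nat where "c > 0" "(bessel_prod_fps ^ (2 * m)) $ (2 * k) = real c"
proof -
  have "(bessel_prod_fps ^ (2 * m)) $ (2 * k) > 0"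
    using assms by (intro fps_power_nth_pos bessel_prod_fps_0 bessel_prod_fps_nonneg bessel_prod_fps_even_pos) auto
  moreover obtain z where "(bessel_prod_fps ^ (2 * m)) $ (2 * k) = of_int z"
    using bessel_prod_fps_power_Ints Ints_cases by blast
  ultimately show ?thesis by (intro that[of "nat z"]) auto
qed

section \<open>A singular Gaussian integral\<close>

lemma integrable_lborel_nonneg:
  fixes f :: "real \<Rightarrow> real"
  assumes [measurable]: "f \<in> borel_measurable borel" "S \<in> sets borel"
    and "f integrable_on S" "\<And>x. x \<in> S \<Longrightarrow> f x \<ge> 0"
  shows "integrable lborel (\<lambda>x. indicator S x * f x)"
proof -
  have "f absolutely_integrable_on S" using assms by (intro nonnegative_absolutely_integrable_1) auto
  then show ?thesis unfolding set_integrable_def by (subst (asm) integrable_completion) auto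
qed

lemma integrable_lborel_even:
  fixes f :: "real \<Rightarrow> real"
  assumes "integrable lborel (\<lambda>x. indicator {0..} x * f x)" "\<And>x. f (- x) = f x"
  shows "integrable lborel f"
  using has_bochner_integral_even_function[OF has_bochner_integral_integrable[OF assms(1)[folded real_scaleR_def]]] assms(2)
  by (auto intro: integrable.intros)

definition local_powr :: "real \<Rightarrow> real \<Rightarrow> real" where
  "local_powr a s = indicator {-1..1} s * \<bar>s\<bar> powr (- a)"

lemma local_powr_measurable [measurable]: "local_powr a \<in> borel_measurable borel"
  unfolding local_powr_def by measurable

lemma local_powr_nonneg: "local_powr a s \<ge> 0"
  by (simp add: local_powr_def)

lemma integrable_local_powr:
  assumes "0 < a" "a < 1"
  shows "integrable lborel (local_powr a)"
proof (rule integrable_lborel_even)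
  have "integrable lborel (\<lambda>x. indicator {0..1} x * x powr (- a))"
    by (rule integrable_lborel_nonneg) (use assms in \<open>auto intro: integrable_on_powr_from_0\<close>)
  also have "(\<lambda>x. indicator {0..1} x * x powr (- a)) = (\<lambda>x. indicator {0..} x * local_powr a x)"
    by (auto simp: fun_eq_iff local_powr_def indicator_def)
  finally show "integrable lborel \<dots>" .
qed (auto simp: local_powr_def indicator_def)

text \<open>Factor $|2x-s^2| = |r-|s||\,(r+|s|)$ with $r=\sqrt{2x}$ and bound the second factor below by
  $r^{2e}\,|r-|s||^{1-2e}$. An exponent $e$ near 0 is needed for high powers of the integral to be integrable
  at $x=0$.\<close>

lemma sing_kernel_le:
  fixes x s e p :: real
  assumes "x > 0" "0 < e" "e \<le> 1/2" "0 \<le> p" "p \<le> 1"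
  defines "r \<equiv> sqrt (2 * x)"
  shows "p / sqrt \<bar>2 * x - s\<^sup>2\<bar> \<le> r powr (- e) * (local_powr (1 - e) (s - r) + local_powr (1 - e) (s + r) + p)"
proof -
  have r: "r > 0" "r\<^sup>2 = 2 * x" using assms by (auto simp: r_def)
  define d where "d = \<bar>r - \<bar>s\<bar>\<bar>"
  have fac: "\<bar>2 * x - s\<^sup>2\<bar> = d * (r + \<bar>s\<bar>)"
  proof -
    have "2 * x - s\<^sup>2 = (r - \<bar>s\<bar>) * (r + \<bar>s\<bar>)" using r by (simp add: algebra_simps power2_eq_square flip: abs_mult)
    then show ?thesis using r by (simp add: abs_mult d_def)
  qed
  have rhs0: "0 \<le> r powr (- e) * (local_powr (1 - e) (s - r) + local_powr (1 - e) (s + r) + p)"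
    using assms by (auto intro!: mult_nonneg_nonneg add_nonneg_nonneg local_powr_nonneg)
  show ?thesis
  proof (cases "d = 0")
    \<comment> \<open>At this point the left side is a division by zero, whose value is 0.\<close>
    case True
    then show ?thesis using rhs0 by (simp add: fac)
  next
    case False
    then have d: "d > 0" by (simp add: d_def)
    have d_le: "d \<le> r + \<bar>s\<bar>" using r(1) by (auto simp: d_def)
    have "(r powr e * d powr (1 - e))\<^sup>2 = r powr (2 * e) * d powr (1 + (1 - 2 * e))"
      using r d by (simp add: power_mult_distrib powr_realpow[symmetric] powr_powr del: powr_numeral) (simp add: algebra_simps)
    also have "\<dots> = d * (r powr (2 * e) * d powr (1 - 2 * e))"
      using d by (subst powr_add) simp
    also have "r powr (2 * e) * d powr (1 - 2 * e) \<le> (r + \<bar>s\<bar>) powr (2 * e) * (r + \<bar>s\<bar>) powr (1 - 2 * e)"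
      using r d assms(2,3) d_le by (intro mult_mono powr_mono2) auto
    also have "\<dots> = r + \<bar>s\<bar>" using r by (simp add: powr_add[symmetric])
    finally have "(r powr e * d powr (1 - e))\<^sup>2 \<le> \<bar>2 * x - s\<^sup>2\<bar>"
      using d by (simp add: fac)
    then have le: "r powr e * d powr (1 - e) \<le> sqrt \<bar>2 * x - s\<^sup>2\<bar>"
      by (rule real_le_rsqrt)
    have pos: "0 < r powr e * d powr (1 - e)" using r d by simp
    have "p / sqrt \<bar>2 * x - s\<^sup>2\<bar> \<le> p / (r powr e * d powr (1 - e))"
      by (intro divide_left_mono le mult_pos_pos less_le_trans[OF pos le] pos assms(4))
    also have "\<dots> = r powr (- e) * (p * d powr (- (1 - e)))"
      by (simp only: powr_minus[of r e] powr_minus[of d "1 - e"]) (simp add: field_simps)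
    \<comment> \<open>Within distance 1 of the singularity, one of the two translates of
      \<open>local_powr\<close> equals the power; beyond it the power is at most 1 and the weight
      \<open>p\<close> remains.\<close>
    also have "p * d powr (- (1 - e)) \<le> local_powr (1 - e) (s - r) + local_powr (1 - e) (s + r) + p"
    proof (cases "d \<le> 1")
      case True
      have "p * d powr (- (1 - e)) \<le> d powr (- (1 - e))" using mult_right_mono[of p 1 "d powr (- (1 - e))"] assms(5) by simp
      also have "\<dots> \<le> local_powr (1 - e) (s - r) + local_powr (1 - e) (s + r)"
      proof (cases "s \<ge> 0")
        case s: True
        then have "d = \<bar>s - r\<bar>" by (simp add: d_def abs_minus_commute)
        then have "d powr (- (1 - e)) = local_powr (1 - e) (s - r)" using True by (auto simp: local_powr_def indicator_def)
        then show ?thesis using local_powr_nonneg by simp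
      next
        case s: False
        then have "d = \<bar>s + r\<bar>" by (simp add: d_def abs_minus_commute)
        then have "d powr (- (1 - e)) = local_powr (1 - e) (s + r)" using True by (auto simp: local_powr_def indicator_def)
        then show ?thesis using local_powr_nonneg by simp
      qed
      finally show ?thesis using assms by simp
    next
      case False
      then have "d powr (- (1 - e)) \<le> d powr 0" using assms by (intro powr_mono) auto
      then have "p * d powr (- (1 - e)) \<le> p" using False assms d by (simp add: mult_left_le)
      then show ?thesis using local_powr_nonneg[of "1 - e"] by (smt (verit))
    qed
    finally show ?thesis by (simp add: mult_left_mono)
  qed
qed

text \<open>Integration over the line undoes the translations by \<plusminus>r, so that x survives
  only in the factor \<open>r powr (- e)\<close>.\<close>

lemma sing_kernel_integral:
  fixes x e :: real and f :: "real \<Rightarrow> real"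
  assumes x: "x > 0" and e: "0 < e" "e \<le> 1/2"
    and f: "integrable lborel f" "\<And>s. 0 \<le> f s" "\<And>s. f s \<le> 1"
  shows "integrable lborel (\<lambda>s. f s / sqrt \<bar>2 * x - s\<^sup>2\<bar>)"
    and "(\<integral>s. f s / sqrt \<bar>2 * x - s\<^sup>2\<bar> \<partial>lborel)
      \<le> (2 * x) powr (- e / 2) * (2 * integral\<^sup>L lborel (local_powr (1 - e)) + integral\<^sup>L lborel f)"
proof -
  define r where "r = sqrt (2 * x)"
  have [measurable]: "f \<in> borel_measurable borel" using f(1) by auto
  have lp: "integrable lborel (local_powr (1 - e))" using e by (intro integrable_local_powr) auto
  have lpc: "integrable lborel (\<lambda>s. local_powr (1 - e) (s - r))"
    "integrable lborel (\<lambda>s. local_powr (1 - e) (s + r))"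
    using lborel_integrable_real_affine[OF lp, of 1 "-r"] lborel_integrable_real_affine[OF lp, of 1 r]
    by (simp_all add: add.commute)
  have lpi: "(\<integral>s. local_powr (1 - e) (s - r) \<partial>lborel) = integral\<^sup>L lborel (local_powr (1 - e))"
    "(\<integral>s. local_powr (1 - e) (s + r) \<partial>lborel) = integral\<^sup>L lborel (local_powr (1 - e))"
    using lborel_integral_real_affine[of 1 "local_powr (1 - e)" "-r"] lborel_integral_real_affine[of 1 "local_powr (1 - e)" r]
    by (simp_all add: add.commute)
  let ?g = "\<lambda>s. r powr (- e) * (local_powr (1 - e) (s - r) + local_powr (1 - e) (s + r) + f s)"
  have g: "integrable lborel ?g" using lpc f(1) by auto
  have le: "f s / sqrt \<bar>2 * x - s\<^sup>2\<bar> \<le> ?g s" for s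
    unfolding r_def by (rule sing_kernel_le) (use assms in auto)
  show int: "integrable lborel (\<lambda>s. f s / sqrt \<bar>2 * x - s\<^sup>2\<bar>)"
    by (rule Bochner_Integration.integrable_bound[OF g]) (use order_trans[OF le abs_ge_self] f in \<open>auto intro!: AE_I2\<close>)
  have "(\<integral>s. f s / sqrt \<bar>2 * x - s\<^sup>2\<bar> \<partial>lborel) \<le> integral\<^sup>L lborel ?g"
    by (rule integral_mono[OF int g le])
  also have "integral\<^sup>L lborel ?g = r powr (- e) * (2 * integral\<^sup>L lborel (local_powr (1 - e)) + integral\<^sup>L lborel f)"
    using lpc f(1) by (simp add: lpi)
  also have "r powr (- e) = (2 * x) powr (- e / 2)"
    using x by (simp add: r_def powr_half_sqrt[symmetric] powr_powr)
  finally show "(\<integral>s. f s / sqrt \<bar>2 * x - s\<^sup>2\<bar> \<partial>lborel)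
      \<le> (2 * x) powr (- e / 2) * (2 * integral\<^sup>L lborel (local_powr (1 - e)) + integral\<^sup>L lborel f)" .
qed

section \<open>Size of the Gaussian integral near 0 and near infinity\<close>

lemma integrable_gaussian: "integrable lborel (\<lambda>s::real. exp (- s\<^sup>2))"
  and integral_gaussian: "(\<integral>s. exp (- s\<^sup>2) \<partial>lborel) = sqrt pi"
proof -
  have "has_bochner_integral lborel (\<lambda>s::real. exp (- s\<^sup>2)) (2 * (sqrt pi / 2))"
    using has_bochner_integral_even_function[OF gaussian_moment_0] by simp
  then show "integrable lborel (\<lambda>s::real. exp (- s\<^sup>2))" "(\<integral>s. exp (- s\<^sup>2) \<partial>lborel) = sqrt pi"
    by (auto intro: integrable.intros dest: has_bochner_integral_integral_eq)
qed

lemma integrable_gaussian_half: "integrable lborel (\<lambda>s::real. exp (- s\<^sup>2 / 2))"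
proof -
  have "integrable lborel (\<lambda>s::real. exp (- (0 + (1 / sqrt 2) * s)\<^sup>2))"
    by (rule lborel_integrable_real_affine[OF integrable_gaussian]) simp
  then show ?thesis by (simp add: power_divide)
qed

text \<open>For almost every s this dominates exp(-s^2) / sqrt(2z + s^2) and exp(-s^2) / sqrt(2z -
  s^2) at every z with |Re z| = x, whatever the imaginary part.\<close>

definition sing_gauss :: "real \<Rightarrow> real \<Rightarrow> real" where
  "sing_gauss x s = exp (- s\<^sup>2) / sqrt \<bar>2 * x - s\<^sup>2\<bar>"

definition sing_gauss_int :: "real \<Rightarrow> real" where
  "sing_gauss_int x = (\<integral>s. sing_gauss x s \<partial>lborel)"

lemma sing_gauss_nonneg: "sing_gauss x s \<ge> 0"
  by (simp add: sing_gauss_def)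

lemma sing_gauss_int_nonneg: "sing_gauss_int x \<ge> 0"
  by (simp add: sing_gauss_int_def sing_gauss_nonneg)

lemma integrable_sing_gauss: "x > 0 \<Longrightarrow> integrable lborel (sing_gauss x)"
  unfolding sing_gauss_def by (rule sing_kernel_integral(1)[of _ "1/2"]) (auto intro: integrable_gaussian)

text \<open>The true growth at 0 is logarithmic; an arbitrarily small negative power is all that is
  needed, and it keeps logarithms out of the estimates.\<close>

lemma sing_gauss_int_small:
  assumes "0 < e" "e \<le> 1/2"
  obtains C where "C \<ge> 0" "\<And>x. x > 0 \<Longrightarrow> sing_gauss_int x \<le> C * (2 * x) powr (- e / 2)"
proof
  let ?C = "2 * integral\<^sup>L lborel (local_powr (1 - e)) + (\<integral>s. exp (- s\<^sup>2) \<partial>lborel)"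
  show "?C \<ge> 0" by (auto intro!: add_nonneg_nonneg Bochner_Integration.integral_nonneg local_powr_nonneg)
  show "sing_gauss_int x \<le> ?C * (2 * x) powr (- e / 2)" if "x > 0" for x
    using sing_kernel_integral(2)[OF that assms integrable_gaussian]
    by (simp add: sing_gauss_int_def sing_gauss_def mult.commute)
qed

lemma AE_lborel_square_neq: "AE s in lborel. s\<^sup>2 \<noteq> (c::real)"
proof (rule AE_I')
  have "s = sqrt c \<or> s = - sqrt c" if "s\<^sup>2 = c" for s
  proof -
    have "\<bar>s\<bar> = sqrt c" using real_sqrt_abs[of s] unfolding that by (rule sym)
    then show ?thesis by linarith
  qed
  then have "{s. s\<^sup>2 = c} \<subseteq> {sqrt c, - sqrt c}" by blast
  then show "{s. s\<^sup>2 = c} \<in> null_sets lborel"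
    by (intro finite_imp_null_set_lborel) (auto intro: finite_subset)
qed auto

text \<open>The decay comes from $\sqrt{2x} \le \sqrt{|2x-s^2|} + |s|$.\<close>

lemma sing_gauss_int_large:
  obtains C where "C \<ge> 0" "\<And>x. x \<ge> 1 \<Longrightarrow> sing_gauss_int x \<le> C / sqrt x"
proof
  let ?K = "2 * integral\<^sup>L lborel (local_powr (1/2)) + (\<integral>s. exp (- s\<^sup>2 / 2) \<partial>lborel)"
  let ?C = "sqrt pi + ?K"
  have K: "?K \<ge> 0" by (auto intro!: add_nonneg_nonneg Bochner_Integration.integral_nonneg local_powr_nonneg)
  then show "?C \<ge> 0" by simp
  show "sing_gauss_int x \<le> ?C / sqrt x" if x: "x \<ge> 1" for x
  proof -
    let ?h = "\<lambda>s. exp (- s\<^sup>2 / 2) / sqrt \<bar>2 * x - s\<^sup>2\<bar>"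
    have h: "integrable lborel ?h" and hle: "integral\<^sup>L lborel ?h \<le> (2 * x) powr (- (1/2) / 2) * ?K"
      using sing_kernel_integral[of x "1/2" "\<lambda>s. exp (- s\<^sup>2 / 2)"] x integrable_gaussian_half by auto
    have "(2 * x) powr (- (1/2) / 2) \<le> 1 powr (- (1/2) / 2)" using x by (intro powr_mono2') auto
    then have K1: "(2 * x) powr (- (1/2) / 2) * ?K \<le> 1 * ?K" by (intro mult_right_mono K) simp
    then have hK: "integral\<^sup>L lborel ?h \<le> ?K" using order_trans[OF hle K1] by simp
    have pt: "sqrt (2 * x) * sing_gauss x s \<le> exp (- s\<^sup>2) + ?h s" if "2 * x - s\<^sup>2 \<noteq> 0" for s
    proof -
      have "2 * x \<le> \<bar>2 * x - s\<^sup>2\<bar> + \<bar>s\<bar>\<^sup>2" by simp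
      also have "\<dots> \<le> (sqrt \<bar>2 * x - s\<^sup>2\<bar> + \<bar>s\<bar>)\<^sup>2" by (simp add: power2_sum)
      finally have "sqrt (2 * x) \<le> sqrt \<bar>2 * x - s\<^sup>2\<bar> + \<bar>s\<bar>" by (intro real_le_lsqrt) auto
      then have "sqrt (2 * x) * sing_gauss x s \<le> (sqrt \<bar>2 * x - s\<^sup>2\<bar> + \<bar>s\<bar>) * sing_gauss x s"
        by (intro mult_right_mono sing_gauss_nonneg)
      also have "\<dots> = exp (- s\<^sup>2) + (\<bar>s\<bar> * exp (- s\<^sup>2)) / sqrt \<bar>2 * x - s\<^sup>2\<bar>"
        using that by (simp add: sing_gauss_def field_simps)
      \<comment> \<open>The factor |s| is paid for with half of the Gaussian exponent. The weight
        that remains is still at most 1, as \<open>sing_kernel_integral\<close> requires.\<close>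
      also have "\<bar>s\<bar> * exp (- s\<^sup>2) \<le> exp (- s\<^sup>2 / 2)"
      proof -
        have "0 \<le> (\<bar>s\<bar> - 1)\<^sup>2" by simp
        then have "\<bar>s\<bar> \<le> 1 + s\<^sup>2 / 2" by (simp add: power2_diff)
        also have "\<dots> \<le> exp (s\<^sup>2 / 2)" by (rule exp_ge_add_one_self)
        finally have "\<bar>s\<bar> * exp (- s\<^sup>2) \<le> exp (s\<^sup>2 / 2) * exp (- s\<^sup>2)" by (intro mult_right_mono) auto
        then show ?thesis by (simp add: mult_exp_exp)
      qed
      finally show ?thesis by (simp add: divide_right_mono)
    qed
    have "AE s in lborel. 2 * x - s\<^sup>2 \<noteq> 0"
      using AE_lborel_square_neq[of "2 * x"] by eventually_elim simp
    then have ae: "AE s in lborel. sqrt (2 * x) * sing_gauss x s \<le> exp (- s\<^sup>2) + ?h s"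
      by eventually_elim (rule pt)
    have "sqrt (2 * x) * sing_gauss_int x = (\<integral>s. sqrt (2 * x) * sing_gauss x s \<partial>lborel)"
      by (simp add: sing_gauss_int_def)
    also have "\<dots> \<le> (\<integral>s. exp (- s\<^sup>2) + ?h s \<partial>lborel)"
      using x by (intro integral_mono_AE[OF _ _ ae] integrable_mult_right integrable_sing_gauss Bochner_Integration.integrable_add integrable_gaussian h) auto
    also have "\<dots> \<le> ?C" using hK h by (simp add: integrable_gaussian integral_gaussian)
    finally have "sqrt (2 * x) * sing_gauss_int x \<le> ?C" .
    moreover have "sqrt x * sing_gauss_int x \<le> sqrt (2 * x) * sing_gauss_int x"
      using x by (intro mult_right_mono sing_gauss_int_nonneg) auto
    ultimately show ?thesis using x by (simp add: field_simps)
  qed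
qed

section \<open>An integrable majorant for the powers of the Gaussian integral\<close>

definition decay_majorant :: "real \<Rightarrow> real" where
  "decay_majorant x = (if \<bar>x\<bar> \<le> 1 then \<bar>x\<bar> powr (-1/2) else \<bar>x\<bar> powr (-2))"

lemma decay_majorant_nonneg: "decay_majorant x \<ge> 0"
  by (simp add: decay_majorant_def)

lemma decay_majorant_abs [simp]: "decay_majorant \<bar>x\<bar> = decay_majorant x"
  by (simp add: decay_majorant_def)

lemma integrable_decay_majorant: "integrable lborel decay_majorant"
proof (rule integrable_lborel_even)
  have "integrable lborel (\<lambda>x::real. indicator {0..1} x * x powr (-1/2))"
    by (rule integrable_lborel_nonneg) (auto intro: integrable_on_powr_from_0)
  moreover have "(\<lambda>x::real. x powr (-2)) integrable_on {1..}"
    using has_integral_powr_to_inf[of "-2" 1] by (auto simp: integrable_on_def)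
  then have "integrable lborel (\<lambda>x::real. indicator {1..} x * x powr (-2))"
    by (intro integrable_lborel_nonneg) auto
  then have "integrable lborel (\<lambda>x::real. indicator {1<..} x * (indicator {1..} x * x powr (-2)))"
    using integrable_real_mult_indicator[of "{1<..}" lborel "\<lambda>x. indicator {1..} x * x powr (-2)"] by (simp only: mult.commute[of "indicator {1<..} _"]) simp
  ultimately have "integrable lborel (\<lambda>x::real. indicator {0..1} x * x powr (-1/2) + indicator {1<..} x * (indicator {1..} x * x powr (-2)))"
    by auto
  also have "\<dots> = (\<lambda>x. indicator {0..} x * decay_majorant x)"
    by (auto simp: fun_eq_iff decay_majorant_def indicator_def)
  finally show "integrable lborel \<dots>" .
qed (simp add: decay_majorant_def)

text \<open>The exponent is 4m because \<open>h\<close> has two factors and is raised to the power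
  2m. For x > 1 the decay x^(-2m) is at least that of x^(-2).\<close>

lemma sing_gauss_int_power_le:
  assumes "m \<ge> 1"
  obtains C where "C \<ge> 0" "\<And>x. x > 0 \<Longrightarrow> sing_gauss_int x ^ (4 * m) \<le> C * decay_majorant x"
proof -
  \<comment> \<open>The exponent e = 1/(4m) is chosen so that raising to the power 4m leaves
    x^(-1/2).\<close>
  obtain C1 where C1: "C1 \<ge> 0" "\<And>x. x > 0 \<Longrightarrow> sing_gauss_int x \<le> C1 * (2 * x) powr (- (1 / (4 * real m)) / 2)"
    using sing_gauss_int_small[of "1 / (4 * real m)"] assms by (auto simp: field_simps)
  obtain C2 where C2: "C2 \<ge> 0" "\<And>x. x \<ge> 1 \<Longrightarrow> sing_gauss_int x \<le> C2 / sqrt x"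
    using sing_gauss_int_large by auto
  show ?thesis
  proof (rule that[of "C1 ^ (4 * m) + C2 ^ (4 * m)"])
    show "C1 ^ (4 * m) + C2 ^ (4 * m) \<ge> 0" using C1 C2 by auto
    fix x :: real assume x: "x > 0"
    show "sing_gauss_int x ^ (4 * m) \<le> (C1 ^ (4 * m) + C2 ^ (4 * m)) * decay_majorant x"
    proof (cases "x \<le> 1")
      case True
      have "sing_gauss_int x ^ (4 * m) \<le> (C1 * (2 * x) powr (- (1 / (4 * real m)) / 2)) ^ (4 * m)"
        by (intro power_mono C1 x sing_gauss_int_nonneg)
      also have "\<dots> = C1 ^ (4 * m) * (2 * x) powr (- (1 / (4 * real m)) / 2 * real (4 * m))"
        using x by (simp add: power_mult_distrib powr_powr powr_realpow[symmetric])
      also have "- (1 / (4 * real m)) / 2 * real (4 * m) = -1/2" using assms by simp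
      also have "(2 * x) powr (-1/2) \<le> x powr (-1/2)" using x by (intro powr_mono2') auto
      also have "C1 ^ (4 * m) * x powr (-1/2) \<le> (C1 ^ (4 * m) + C2 ^ (4 * m)) * x powr (-1/2)"
        using C2 by (intro mult_right_mono) auto
      finally show ?thesis using True x C1 by (simp add: decay_majorant_def mult_left_mono)
    next
      case False
      have "sing_gauss_int x ^ (4 * m) \<le> (C2 / sqrt x) ^ (4 * m)"
        using False by (intro power_mono C2 sing_gauss_int_nonneg) auto
      also have "\<dots> = C2 ^ (4 * m) / x ^ (2 * m)"
        proof -
          have "sqrt x ^ (4 * m) = ((sqrt x)\<^sup>2) ^ (2 * m)" by (subst power_mult[symmetric]) simp
          then show ?thesis using x by (simp add: power_divide)
        qed
      also have "\<dots> \<le> C2 ^ (4 * m) / x ^ 2"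
        using False C2 assms by (intro divide_left_mono power_increasing) auto
      also have "\<dots> = C2 ^ (4 * m) * x powr (-2)"
        using x by (simp add: powr_minus field_simps)
      also have "\<dots> \<le> (C1 ^ (4 * m) + C2 ^ (4 * m)) * x powr (-2)"
        using C1 by (intro mult_right_mono) auto
      finally show ?thesis using False x by (simp add: decay_majorant_def)
    qed
  qed
qed

section \<open>Analytic continuation to the upper half plane\<close>

lemma csqrt_measurable [measurable]: "csqrt \<in> borel_measurable borel"
proof -
  have "(\<lambda>z::complex. z powr (1/2)) \<in> borel_measurable borel" by measurable
  then show ?thesis by (simp add: csqrt_conv_powr[symmetric])
qed

text \<open>On the cut, \<^const>\<open>csqrt\<close> takes the limit value from above.\<close>

lemma continuous_on_csqrt_Im_nonneg: "continuous_on {z. Im z \<ge> 0} csqrt"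
proof -
  \<comment> \<open>In the closed upper half plane the imaginary part of the root is nonnegative, so
    this formula holds without the sign that jumps across the cut.\<close>
  have "continuous_on {z. Im z \<ge> 0}
      (\<lambda>z. of_real (sqrt ((cmod z + Re z) / 2)) + \<i> * of_real (sqrt ((cmod z - Re z) / 2)))"
    by (intro continuous_intros) auto
  then show ?thesis
    by (rule continuous_on_eq) (auto simp: complex_eq_iff)
qed

text \<open>Substituting s = sqrt(2z) sinh(u/2) in the integral for K0 yields this kernel with
  \<sigma> = 1. Unlike exp(-z cosh u), it remains integrable throughout the upper half
  plane.\<close>

definition gauss_csqrt_kernel :: "real \<Rightarrow> complex \<Rightarrow> real \<Rightarrow> complex" where
  "gauss_csqrt_kernel \<sigma> z s = of_real (exp (- s\<^sup>2)) / csqrt (2 * z + of_real (\<sigma> * s\<^sup>2))"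

text \<open>For $\sigma = 1$ this is $e^z K_0(z)$, for $\sigma = -1$ it is $e^{-z} K_0(ze^{-i\pi})/i$.\<close>

definition gauss_csqrt :: "real \<Rightarrow> complex \<Rightarrow> complex" where
  "gauss_csqrt \<sigma> z = (\<integral>s. gauss_csqrt_kernel \<sigma> z s \<partial>lborel)"

lemma gauss_csqrt_kernel_measurable [measurable]: "gauss_csqrt_kernel \<sigma> z \<in> borel_measurable borel"
  unfolding gauss_csqrt_kernel_def by measurable

lemma norm_gauss_csqrt_kernel:
  "norm (gauss_csqrt_kernel \<sigma> z s) = exp (- s\<^sup>2) / sqrt (norm (2 * z + of_real (\<sigma> * s\<^sup>2)))"
  by (simp add: gauss_csqrt_kernel_def norm_divide)

text \<open>Dropping the imaginary part of 2z + \<sigma> s^2 only decreases its modulus. At the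
  excluded s the right side is a division by zero with value 0, while the left side need not
  vanish.\<close>

lemma norm_gauss_csqrt_kernel_le:
  assumes "\<bar>\<sigma>\<bar> = 1" "s\<^sup>2 \<noteq> 2 * \<bar>Re z\<bar>"
  shows "norm (gauss_csqrt_kernel \<sigma> z s) \<le> sing_gauss \<bar>Re z\<bar> s"
proof -
  have "\<bar>2 * \<bar>Re z\<bar> - s\<^sup>2\<bar> \<le> \<bar>2 * Re z + \<sigma> * s\<^sup>2\<bar>"
  proof -
    have "\<bar>\<bar>2 * Re z\<bar> - \<bar>\<sigma> * s\<^sup>2\<bar>\<bar> \<le> \<bar>2 * Re z + \<sigma> * s\<^sup>2\<bar>" by linarith
    then show ?thesis using assms by (simp add: abs_mult)
  qed
  also have "\<dots> \<le> norm (2 * z + of_real (\<sigma> * s\<^sup>2))"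
    using abs_Re_le_cmod[of "2 * z + of_real (\<sigma> * s\<^sup>2)"] by simp
  finally show ?thesis
    unfolding norm_gauss_csqrt_kernel sing_gauss_def
    using assms(2) by (intro divide_left_mono mult_pos_pos real_sqrt_gt_zero real_sqrt_le_mono) auto
qed

lemma AE_norm_gauss_csqrt_kernel_le:
  assumes "\<bar>\<sigma>\<bar> = 1"
  shows "AE s in lborel. norm (gauss_csqrt_kernel \<sigma> z s) \<le> sing_gauss \<bar>Re z\<bar> s"
  using AE_lborel_square_neq[of "2 * \<bar>Re z\<bar>"]
  by eventually_elim (rule norm_gauss_csqrt_kernel_le[OF assms])

text \<open>Complements the bound by the real part, which gives nothing on the imaginary axis. It is
  uniform on half planes Im z \<ge> d and thus serves for holomorphy.\<close>

lemma norm_gauss_csqrt_kernel_le_Im: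
  assumes "0 < d" "d \<le> Im z"
  shows "norm (gauss_csqrt_kernel \<sigma> z s) \<le> exp (- s\<^sup>2) / sqrt (2 * d)"
proof -
  have "2 * d \<le> norm (2 * z + of_real (\<sigma> * s\<^sup>2))"
    using abs_Im_le_cmod[of "2 * z + of_real (\<sigma> * s\<^sup>2)"] assms by simp
  then show ?thesis
    unfolding norm_gauss_csqrt_kernel
    using assms by (intro divide_left_mono mult_pos_pos real_sqrt_gt_zero real_sqrt_le_mono) auto
qed

lemma integrable_gauss_csqrt_kernel:
  assumes "\<bar>\<sigma>\<bar> = 1" "Re z \<noteq> 0"
  shows "integrable lborel (gauss_csqrt_kernel \<sigma> z)"
  using assms by (intro Bochner_Integration.integrable_bound[OF integrable_sing_gauss[of "\<bar>Re z\<bar>"]])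
     (auto simp: sing_gauss_nonneg AE_norm_gauss_csqrt_kernel_le)

lemma integrable_gauss_csqrt_kernel_Im:
  assumes "Im z > 0"
  shows "integrable lborel (gauss_csqrt_kernel \<sigma> z)"
  by (rule Bochner_Integration.integrable_bound[where f = "\<lambda>s. exp (- s\<^sup>2) / sqrt (2 * Im z)"])
     (use assms norm_gauss_csqrt_kernel_le_Im[of "Im z" z] in \<open>auto intro: integrable_gaussian\<close>)

lemma norm_gauss_csqrt_le:
  assumes "\<bar>\<sigma>\<bar> = 1" "Re z \<noteq> 0"
  shows "norm (gauss_csqrt \<sigma> z) \<le> sing_gauss_int \<bar>Re z\<bar>"
proof -
  have "norm (gauss_csqrt \<sigma> z) \<le> (\<integral>s. norm (gauss_csqrt_kernel \<sigma> z s) \<partial>lborel)"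
    unfolding gauss_csqrt_def by (rule integral_norm_bound)
  also have "\<dots> \<le> sing_gauss_int \<bar>Re z\<bar>"
    unfolding sing_gauss_int_def using assms
    by (intro integral_mono_AE integrable_norm integrable_gauss_csqrt_kernel integrable_sing_gauss
        AE_norm_gauss_csqrt_kernel_le) auto
  finally show ?thesis .
qed

text \<open>The majorant depends on the real part only, so dominated convergence applies along
  vertical lines. For almost every s the radicand has a nonzero limit, and \<open>csqrt\<close> is
  continuous from above even on the cut.\<close>

lemma gauss_csqrt_boundary_limit:
  assumes "\<bar>\<sigma>\<bar> = 1" "x \<noteq> 0" "y \<longlonglongrightarrow> 0" "\<And>n. y n \<ge> 0"
  shows "(\<lambda>n. gauss_csqrt \<sigma> (Complex x (y n))) \<longlonglongrightarrow> gauss_csqrt \<sigma> (of_real x)"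
  unfolding gauss_csqrt_def
proof (rule integral_dominated_convergence[where w = "sing_gauss \<bar>x\<bar>"])
  show "integrable lborel (sing_gauss \<bar>x\<bar>)" using assms by (intro integrable_sing_gauss) auto
  show "AE s in lborel. norm (gauss_csqrt_kernel \<sigma> (Complex x (y n)) s) \<le> sing_gauss \<bar>x\<bar> s" for n
    using AE_norm_gauss_csqrt_kernel_le[OF assms(1), of "Complex x (y n)"] by simp
  show "AE s in lborel. (\<lambda>n. gauss_csqrt_kernel \<sigma> (Complex x (y n)) s) \<longlonglongrightarrow> gauss_csqrt_kernel \<sigma> (of_real x) s"
    using AE_lborel_square_neq[of "2 * \<bar>x\<bar>"]
  proof eventually_elim
    case (elim s)
    have ne: "2 * x + \<sigma> * s\<^sup>2 \<noteq> 0"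
    proof
      assume "2 * x + \<sigma> * s\<^sup>2 = 0"
      then have "\<bar>2 * x\<bar> = \<bar>\<sigma> * s\<^sup>2\<bar>" by linarith
      then show False using elim assms by (simp add: abs_mult)
    qed
    then have ne': "2 * complex_of_real x + of_real (\<sigma> * s\<^sup>2) \<noteq> 0"
      using ne by (simp add: complex_eq_iff)
    have "(\<lambda>n. Complex x (y n)) \<longlonglongrightarrow> Complex x 0"
      by (rule tendsto_Complex[OF tendsto_const assms(3)])
    then have "(\<lambda>n. 2 * Complex x (y n) + of_real (\<sigma> * s\<^sup>2)) \<longlonglongrightarrow> 2 * of_real x + of_real (\<sigma> * s\<^sup>2)"
      by (intro tendsto_intros) (simp add: complex_of_real_def)
    then have "(\<lambda>n. csqrt (2 * Complex x (y n) + of_real (\<sigma> * s\<^sup>2))) \<longlonglongrightarrow> csqrt (2 * of_real x + of_real (\<sigma> * s\<^sup>2))"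
      by (rule continuous_on_tendsto_compose[OF continuous_on_csqrt_Im_nonneg]) (use assms in auto)
    then show ?case
      unfolding gauss_csqrt_kernel_def by (intro tendsto_intros) (use ne' in auto)
  qed
qed measurable

lemma csqrt_arg_notin_nonpos_Reals:
  assumes "Im z > 0"
  shows "2 * z + of_real (\<sigma> * s\<^sup>2) \<notin> \<real>\<^sub>\<le>\<^sub>0"
  using assms by (auto simp: complex_nonpos_Reals_iff)

lemma csqrt_arg_nonzero:
  assumes "Im z > 0"
  shows "csqrt (2 * z + of_real (\<sigma> * s\<^sup>2)) \<noteq> 0"
proof
  assume "csqrt (2 * z + of_real (\<sigma> * s\<^sup>2)) = 0"
  then have "2 * z + of_real (\<sigma> * s\<^sup>2) \<in> \<real>\<^sub>\<le>\<^sub>0" unfolding csqrt_eq_0 by simp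
  then show False using csqrt_arg_notin_nonpos_Reals[OF assms] by blast
qed

lemma continuous_on_csqrt_arg:
  "continuous_on ({z. Im z > 0} \<times> UNIV) (\<lambda>x. csqrt (2 * fst x + of_real (\<sigma> * (snd x)\<^sup>2)))"
  by (rule continuous_on_compose2[OF continuous_on_csqrt])
     (use csqrt_arg_notin_nonpos_Reals in \<open>auto intro!: continuous_intros simp del: of_real_mult of_real_power\<close>)

lemma continuous_on_gauss_csqrt_kernel:
  assumes "Im z > 0"
  shows "continuous_on S (gauss_csqrt_kernel \<sigma> z)"
proof -
  have "continuous_on S (\<lambda>s. csqrt (2 * z + of_real (\<sigma> * s\<^sup>2)))"
    by (rule continuous_on_compose2[OF continuous_on_csqrt])
       (use csqrt_arg_notin_nonpos_Reals[OF assms] in \<open>auto intro!: continuous_intros simp del: of_real_mult of_real_power\<close>)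
  then show ?thesis
    unfolding gauss_csqrt_kernel_def
    by (intro continuous_on_divide) (use csqrt_arg_nonzero[OF assms] in \<open>auto intro!: continuous_intros\<close>)
qed

lemma gauss_csqrt_kernel_has_field_derivative:
  assumes "Im z > 0"
  shows "((\<lambda>z. gauss_csqrt_kernel \<sigma> z s) has_field_derivative
    - of_real (exp (- s\<^sup>2)) / csqrt (2 * z + of_real (\<sigma> * s\<^sup>2)) ^ 3) (at z within S)"
proof -
  have inner: "((\<lambda>z. 2 * z + of_real (\<sigma> * s\<^sup>2)) has_field_derivative 2) (at z within S)"
    by (auto intro!: derivative_eq_intros)
  note D = has_field_derivative_csqrt'[OF inner csqrt_arg_notin_nonpos_Reals[OF assms]]
  show ?thesis
    unfolding gauss_csqrt_kernel_def
    by (rule DERIV_cong[OF DERIV_divide[OF DERIV_const D csqrt_arg_nonzero[OF assms]]])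
       (use csqrt_arg_nonzero[OF assms, of \<sigma> s] in \<open>simp add: power3_eq_cube\<close>)
qed

lemma holomorphic_integral_gauss_csqrt_kernel:
  "(\<lambda>z. integral (cbox (- real n) (real n)) (gauss_csqrt_kernel \<sigma> z)) holomorphic_on {z. Im z > 0}"
proof (rule leibniz_rule_holomorphic[where f = "gauss_csqrt_kernel \<sigma>"
    and fx = "\<lambda>z s. - of_real (exp (- s\<^sup>2)) / csqrt (2 * z + of_real (\<sigma> * s\<^sup>2)) ^ 3"])
  show "convex {z. Im z > 0}" by (rule convex_halfspace_Im_gt)
  fix z :: complex and s :: real assume "z \<in> {z. Im z > 0}"
  then have z: "Im z > 0" by simp
  show "((\<lambda>z. gauss_csqrt_kernel \<sigma> z s) has_field_derivative
      - of_real (exp (- s\<^sup>2)) / csqrt (2 * z + of_real (\<sigma> * s\<^sup>2)) ^ 3) (at z within {z. Im z > 0})"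
    by (rule gauss_csqrt_kernel_has_field_derivative[OF z])
  show "gauss_csqrt_kernel \<sigma> z integrable_on cbox (- real n) (real n)"
    by (intro integrable_continuous continuous_on_gauss_csqrt_kernel z)
next
  have "continuous_on ({z. Im z > 0} \<times> cbox (- real n) (real n))
      (\<lambda>x. csqrt (2 * fst x + of_real (\<sigma> * (snd x)\<^sup>2)))"
    by (rule continuous_on_subset[OF continuous_on_csqrt_arg]) auto
  then have "continuous_on ({z. Im z > 0} \<times> cbox (- real n) (real n))
     (\<lambda>x. - of_real (exp (- (snd x)\<^sup>2)) / csqrt (2 * fst x + of_real (\<sigma> * (snd x)\<^sup>2)) ^ 3)"
    by (intro continuous_on_divide continuous_on_power)
       (use csqrt_arg_nonzero in \<open>auto intro!: continuous_intros simp del: of_real_mult of_real_power csqrt_eq_0\<close>)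
  then show "continuous_on ({z. Im z > 0} \<times> cbox (- real n) (real n))
     (\<lambda>(z, s). - of_real (exp (- s\<^sup>2)) / csqrt (2 * z + of_real (\<sigma> * s\<^sup>2)) ^ 3)"
    by (simp add: case_prod_beta)
qed

text \<open>The integrals over [-n, n] are holomorphic by differentiation under the integral sign.
  They converge locally uniformly, since the remainder is a Gaussian tail divided by a lower bound
  for the root.\<close>

lemma gauss_csqrt_holomorphic: "gauss_csqrt \<sigma> holomorphic_on {z. Im z > 0}"
proof -
  let ?k = "gauss_csqrt_kernel \<sigma>"
  define F where "F = (\<lambda>n z. integral (cbox (- real n) (real n)) (?k z))"
  have holF: "F n holomorphic_on {z. Im z > 0}" for n
    unfolding F_def by (rule holomorphic_integral_gauss_csqrt_kernel)
  show ?thesis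
  proof (rule holomorphic_uniform_sequence[OF open_halfspace_Im_gt holF])
    fix z0 :: complex assume "z0 \<in> {z. Im z > 0}"
    then have z0: "Im z0 > 0" by simp
    \<comment> \<open>Half the height of \<open>z0\<close>, so that the closed ball of this radius
      stays in Im z \<ge> d.\<close>
    define d where "d = Im z0 / 2"
    have d: "d > 0" using z0 by (simp add: d_def)
    have Im_ge: "Im z \<ge> d" if "z \<in> cball z0 d" for z
    proof -
      have "\<bar>Im (z0 - z)\<bar> \<le> d" using that abs_Im_le_cmod[of "z0 - z"] by (simp add: dist_norm)
      then show ?thesis using abs_ge_self[of "Im z0 - Im z"] unfolding d_def by simp
    qed
    define tail where "tail = (\<lambda>n. \<integral>s. indicator (- cbox (- real n) (real n)) s * exp (- s\<^sup>2) \<partial>lborel)"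
    have tail: "tail \<longlonglongrightarrow> 0"
    proof -
      have "(\<lambda>n. \<integral>s. indicator (- cbox (- real n) (real n)) s * exp (- s\<^sup>2) \<partial>lborel) \<longlonglongrightarrow> integral\<^sup>L lborel (\<lambda>s::real. 0::real)"
      proof (rule integral_dominated_convergence[where w = "\<lambda>s. exp (- s\<^sup>2)"])
        show "AE s in lborel. (\<lambda>n. indicator (- cbox (- real n) (real n)) s * exp (- s\<^sup>2)) \<longlonglongrightarrow> 0"
        proof (rule AE_I2)
          fix s :: real
          obtain N where N: "\<bar>s\<bar> \<le> real N" using real_arch_simple by blast
          have "\<forall>n\<ge>N. indicator (- cbox (- real n) (real n)) s * exp (- s\<^sup>2) = 0"
            using N by (auto simp: indicator_def)
          then show "(\<lambda>n. indicator (- cbox (- real n) (real n)) s * exp (- s\<^sup>2)) \<longlonglongrightarrow> 0"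
            by (intro tendsto_eventually) (auto simp: eventually_sequentially)
        qed
        show "integrable lborel (\<lambda>s::real. exp (- s\<^sup>2))" by (rule integrable_gaussian)
        show "AE s in lborel. norm (indicator (- cbox (- real n) (real n)) s * exp (- s\<^sup>2)) \<le> exp (- s\<^sup>2)" for n
          by (rule AE_I2) (simp split: split_indicator)
      qed measurable
      then show ?thesis by (simp add: tail_def)
    qed
    have bound: "dist (F n z) (gauss_csqrt \<sigma> z) \<le> tail n / sqrt (2 * d)" if "z \<in> cball z0 d" for n z
    proof -
      have z: "Im z > 0" using Im_ge[OF that] d by linarith
      have ik: "integrable lborel (?k z)" by (rule integrable_gauss_csqrt_kernel_Im[OF z])
      have si: "set_integrable lborel S (?k z)" if [measurable]: "S \<in> sets borel" for S
        unfolding set_integrable_def by (intro integrable_mult_indicator ik) auto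
      have F: "F n z = (\<integral>s. indicator (cbox (- real n) (real n)) s *\<^sub>R ?k z s \<partial>lborel)"
        using set_borel_integral_eq_integral(2)[OF si[of "cbox (- real n) (real n)"]]
        by (simp add: F_def set_lebesgue_integral_def)
      have "gauss_csqrt \<sigma> z - F n z = (\<integral>s. ?k z s - indicator (cbox (- real n) (real n)) s *\<^sub>R ?k z s \<partial>lborel)"
        unfolding F gauss_csqrt_def
        by (rule Bochner_Integration.integral_diff[symmetric]) (use ik si[unfolded set_integrable_def] in auto)
      also have "\<dots> = (\<integral>s. indicator (- cbox (- real n) (real n)) s *\<^sub>R ?k z s \<partial>lborel)"
        by (intro Bochner_Integration.integral_cong) (auto simp: indicator_def)
      finally have eq: "gauss_csqrt \<sigma> z - F n z = \<dots>" .
      have "dist (F n z) (gauss_csqrt \<sigma> z) = norm (\<integral>s. indicator (- cbox (- real n) (real n)) s *\<^sub>R ?k z s \<partial>lborel)"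
        unfolding eq[symmetric] by (simp add: dist_norm norm_minus_commute)
      also have "\<dots> \<le> (\<integral>s. norm (indicator (- cbox (- real n) (real n)) s *\<^sub>R ?k z s) \<partial>lborel)"
        by (rule integral_norm_bound)
      also have "\<dots> \<le> (\<integral>s. indicator (- cbox (- real n) (real n)) s * exp (- s\<^sup>2) / sqrt (2 * d) \<partial>lborel)"
      proof (rule integral_mono)
        show "integrable lborel (\<lambda>s. norm (indicator (- cbox (- real n) (real n)) s *\<^sub>R ?k z s))"
          by (intro integrable_norm integrable_mult_indicator ik) auto
        have "integrable lborel (\<lambda>s. indicator (- cbox (- real n) (real n)) s *\<^sub>R (exp (- s\<^sup>2) / sqrt (2 * d)))"
          by (intro integrable_mult_indicator integrable_divide integrable_gaussian) auto
        then show "integrable lborel (\<lambda>s. indicator (- cbox (- real n) (real n)) s * exp (- s\<^sup>2) / sqrt (2 * d))"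
          by simp
        show "norm (indicator (- cbox (- real n) (real n)) s *\<^sub>R ?k z s)
            \<le> indicator (- cbox (- real n) (real n)) s * exp (- s\<^sup>2) / sqrt (2 * d)" for s
          using norm_gauss_csqrt_kernel_le_Im[OF d Im_ge[OF that], of \<sigma> s] by (auto simp: indicator_def)
      qed
      also have "\<dots> = tail n / sqrt (2 * d)" by (simp add: tail_def)
      finally show ?thesis .
    qed
    have "uniform_limit (cball z0 d) F (gauss_csqrt \<sigma>) sequentially"
    proof (rule uniform_limitI)
      fix e :: real assume "e > 0"
      have "(\<lambda>n. tail n / sqrt (2 * d)) \<longlonglongrightarrow> 0 / sqrt (2 * d)"
        using d by (intro tendsto_intros tail) auto
      then have "eventually (\<lambda>n. tail n / sqrt (2 * d) < e) sequentially"
        using \<open>e > 0\<close> by (simp add: order_tendstoD)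
      then show "\<forall>\<^sub>F n in sequentially. \<forall>z\<in>cball z0 d. dist (F n z) (gauss_csqrt \<sigma> z) < e"
        by eventually_elim (intro ballI le_less_trans[OF bound])
    qed
    moreover have "cball z0 d \<subseteq> {z. Im z > 0}" using Im_ge d less_le_trans by (intro subsetI CollectI) blast
    ultimately show "\<exists>d. 0 < d \<and> cball z0 d \<subseteq> {z. Im z > 0} \<and> uniform_limit (cball z0 d) F (gauss_csqrt \<sigma>) sequentially"
      using d by (intro exI[of _ d] conjI)
  qed
qed

text \<open>The function h of the overview: the factors e^z and e^(-z) contained in the two
  integrals cancel.\<close>

definition bessel_hp :: "complex \<Rightarrow> complex" where
  "bessel_hp z = gauss_csqrt 1 z * gauss_csqrt (- 1) z"

lemma bessel_hp_holomorphic: "bessel_hp holomorphic_on {z. Im z > 0}"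
  unfolding bessel_hp_def by (intro holomorphic_intros gauss_csqrt_holomorphic)

lemma norm_bessel_hp_le:
  assumes "Re z \<noteq> 0"
  shows "norm (bessel_hp z) \<le> sing_gauss_int \<bar>Re z\<bar> ^ 2"
  unfolding bessel_hp_def norm_mult power2_eq_square
  by (intro mult_mono norm_gauss_csqrt_le assms sing_gauss_int_nonneg) auto

lemma bessel_hp_boundary_limit:
  assumes "x \<noteq> 0" "y \<longlonglongrightarrow> 0" "\<And>n. y n \<ge> 0"
  shows "(\<lambda>n. bessel_hp (Complex x (y n))) \<longlonglongrightarrow> bessel_hp (of_real x)"
  unfolding bessel_hp_def by (intro tendsto_mult gauss_csqrt_boundary_limit assms) auto

lemma csqrt_minus_cnj: "Im z \<ge> 0 \<Longrightarrow> csqrt (- cnj z) = \<i> * cnj (csqrt z)"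
  by (auto simp: complex_eq_iff)

text \<open>Reflection in the imaginary axis turns 2z + \<sigma> s^2 into -conj(2z - \<sigma> s^2)
  and so exchanges the two signs; the root of the minus sign contributes the factor -i.\<close>

lemma gauss_csqrt_minus_cnj:
  assumes "Im z \<ge> 0"
  shows "gauss_csqrt \<sigma> (- cnj z) = - \<i> * cnj (gauss_csqrt (- \<sigma>) z)"
proof -
  have "gauss_csqrt_kernel \<sigma> (- cnj z) s = - \<i> * cnj (gauss_csqrt_kernel (- \<sigma>) z s)" for s
  proof -
    have "csqrt (2 * (- cnj z) + of_real (\<sigma> * s\<^sup>2)) = csqrt (- cnj (2 * z + of_real (- \<sigma> * s\<^sup>2)))" by simp
    also have "\<dots> = \<i> * cnj (csqrt (2 * z + of_real (- \<sigma> * s\<^sup>2)))"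
      using assms by (intro csqrt_minus_cnj) simp
    finally show ?thesis by (simp add: gauss_csqrt_kernel_def divide_inverse)
  qed
  then show ?thesis by (simp add: gauss_csqrt_def integral_cnj)
qed

text \<open>The two factors are exchanged and (-i)^2 = -1. Consequently an even power of
  \<open>bessel_hp\<close> takes conjugate values at x and -x.\<close>

lemma bessel_hp_minus_cnj: "Im z \<ge> 0 \<Longrightarrow> bessel_hp (- cnj z) = - cnj (bessel_hp z)"
  unfolding bessel_hp_def gauss_csqrt_minus_cnj by (simp add: complex_eq_iff algebra_simps)

section \<open>Cauchy's formula in the upper half plane\<close>

lemma contour_integral_linepath_same_Im:
  assumes "a < b"
  shows "contour_integral (linepath (Complex a c) (Complex b c)) f = integral {a..b} (\<lambda>x. f (Complex x c))"
proof -
  have "contour_integral (linepath (Complex a c) (Complex b c)) f =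
         (Complex b c - Complex a c) * integral {0..1} (\<lambda>x. f (linepath (Complex a c) (Complex b c) x))"
    by (simp add: contour_integral_integral)
  also have "Complex b c - Complex a c = of_real (b - a)"
    by (simp add: complex_eq_iff)
  also have "integral {0..1} (\<lambda>x. f (linepath (Complex a c) (Complex b c) x)) =
             integral {0..1} (\<lambda>x. f (Complex (linepath a b x) c))"
    by (simp add: linepath_def Complex_eq scaleR_conv_of_real algebra_simps)
  also have "\<dots> = integral {0..(b - a) / (b - a)} (\<lambda>x. f (Complex (a + (b - a) * x) c))"
    using \<open>a < b\<close> by (simp add: algebra_simps linepath_def)
  also have "{0..(b - a) / (b - a)} = (\<lambda>x. x / (b - a)) ` {0..b - a}"
    using \<open>a < b\<close> by simp
  also have "integral \<dots> (\<lambda>x. f (Complex (a + (b - a) * x) c)) =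
             integral {a-a..b-a} (\<lambda>x. f (Complex (x + a) c)) / of_real (b - a)"
    using \<open>a < b\<close> by (subst integral_stretch_real) (auto simp: scaleR_conv_of_real add_ac)
  also have "\<dots> = integral {a..b} (\<lambda>x. f (Complex x c)) / of_real (b - a)"
    by (subst integral_shift_real_ivl) (rule refl)
  finally show ?thesis
    using \<open>a < b\<close> by simp
qed

lemma contour_integral_rectpath:
  assumes "continuous_on (path_image (rectpath (Complex a c) (Complex b d))) f" "a < b" "c < d"
  shows "contour_integral (rectpath (Complex a c) (Complex b d)) f
    = integral {a..b} (\<lambda>x. f (Complex x c)) + contour_integral (linepath (Complex b c) (Complex b d)) f
      - integral {a..b} (\<lambda>x. f (Complex x d)) - contour_integral (linepath (Complex a c) (Complex a d)) f"
proof -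
  have pi: "path_image (rectpath (Complex a c) (Complex b d)) = closed_segment (Complex a c) (Complex b c)
      \<union> (closed_segment (Complex b c) (Complex b d) \<union> (closed_segment (Complex b d) (Complex a d)
      \<union> closed_segment (Complex a d) (Complex a c)))"
    by (simp add: rectpath_def Let_def path_image_join)
  have ci: "f contour_integrable_on linepath (Complex a c) (Complex b c)"
    "f contour_integrable_on linepath (Complex b c) (Complex b d)"
    "f contour_integrable_on linepath (Complex b d) (Complex a d)"
    "f contour_integrable_on linepath (Complex a d) (Complex a c)"
    by (intro contour_integrable_continuous_linepath continuous_on_subset[OF assms(1)]; auto simp: pi)+
  have "contour_integral (rectpath (Complex a c) (Complex b d)) f
    = contour_integral (linepath (Complex a c) (Complex b c)) f
      + (contour_integral (linepath (Complex b c) (Complex b d)) f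
      + (contour_integral (linepath (Complex b d) (Complex a d)) f
      + contour_integral (linepath (Complex a d) (Complex a c)) f))"
    unfolding rectpath_def Let_def
    by (simp add: contour_integral_join contour_integrable_joinI ci)
  also have "contour_integral (linepath (Complex b d) (Complex a d)) f = - contour_integral (linepath (Complex a d) (Complex b d)) f"
    using ci(3) by (subst contour_integral_reverse_linepath) (auto intro: continuous_on_subset[OF assms(1)] simp: pi)
  also have "contour_integral (linepath (Complex a d) (Complex a c)) f = - contour_integral (linepath (Complex a c) (Complex a d)) f"
    by (subst contour_integral_reverse_linepath) (auto intro: continuous_on_subset[OF assms(1)] simp: pi closed_segment_commute)
  finally show ?thesis
    using assms(2) by (simp add: contour_integral_linepath_same_Im)
qed

text \<open>This is 1/(z - iy) + 1/(z + iy). The second pole lies in the lower half plane and does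
  not affect the value of the contour integral; it is added because the sum is real and odd on the
  real axis, which suits the symmetry of the boundary values.\<close>

definition cauchy_kernel :: "real \<Rightarrow> complex \<Rightarrow> complex" where
  "cauchy_kernel y z = 2 * z / (z\<^sup>2 + of_real (y\<^sup>2))"

lemma cauchy_kernel_factor: "z\<^sup>2 + of_real (y\<^sup>2) = (z - \<i> * of_real y) * (z + \<i> * of_real y)"
  by (simp add: algebra_simps power2_eq_square)

text \<open>Below height y/2 the point z is at least y/2 away from iy, and |z + iy| \<ge> |z|
  cancels the numerator. The bound is constant along the bottom side and permits dominated
  convergence there.\<close>

lemma norm_cauchy_kernel_low:
  assumes "y > 0" "0 < Im z" "Im z \<le> y / 2"
  shows "norm (cauchy_kernel y z) \<le> 4 / y"
proof -
  have "y / 2 \<le> norm (z - \<i> * of_real y)"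
    using abs_Im_le_cmod[of "z - \<i> * of_real y"] assms by simp
  moreover have "norm z \<le> norm (z + \<i> * of_real y)"
  proof -
    have "(Im z)\<^sup>2 \<le> (Im z + y)\<^sup>2" using assms by (intro power_mono) auto
    then show ?thesis by (simp add: cmod_def)
  qed
  ultimately have le: "y / 2 * norm z \<le> norm (z\<^sup>2 + of_real (y\<^sup>2))"
    unfolding cauchy_kernel_factor norm_mult using assms by (intro mult_mono) auto
  have z: "norm z > 0" using assms by auto
  then have pos: "0 < y / 2 * norm z" using assms by simp
  have "norm (cauchy_kernel y z) \<le> norm (2 * z) / (y / 2 * norm z)"
    unfolding cauchy_kernel_def norm_divide by (intro divide_left_mono le mult_pos_pos[OF less_le_trans[OF pos le] pos]) simp
  also have "\<dots> = 4 / y" using z assms by (simp add: norm_mult field_simps)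
  finally show ?thesis .
qed

lemma norm_cauchy_kernel_far:
  assumes "y > 0" "2 * y \<le> R" "R \<le> norm z"
  shows "norm (cauchy_kernel y z) \<le> 4 / R"
proof -
  have "(2 * y)\<^sup>2 \<le> (norm z)\<^sup>2" using assms by (intro power_mono) auto
  then have "4 * y\<^sup>2 \<le> (norm z)\<^sup>2" by (simp add: power_mult_distrib)
  moreover have "0 \<le> y\<^sup>2" by simp
  ultimately have "(norm z)\<^sup>2 / 2 \<le> (norm z)\<^sup>2 - y\<^sup>2" by linarith
  also have "\<dots> \<le> norm (z\<^sup>2 + of_real (y\<^sup>2))"
    using norm_diff_ineq[of "z\<^sup>2" "of_real (y\<^sup>2)"] by (simp add: norm_power)
  finally have le: "(norm z)\<^sup>2 / 2 \<le> norm (z\<^sup>2 + of_real (y\<^sup>2))" .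
  have z: "norm z > 0" using assms by linarith
  then have "0 < (norm z)\<^sup>2 / 2" by simp
  then have "norm (cauchy_kernel y z) \<le> norm (2 * z) / ((norm z)\<^sup>2 / 2)"
    unfolding cauchy_kernel_def norm_divide
    by (intro divide_left_mono le mult_pos_pos[OF less_le_trans[OF _ le]]) auto
  also have "\<dots> = 4 / norm z" using z by (simp add: norm_mult field_simps power2_eq_square)
  also have "\<dots> \<le> 4 / R" using assms by (intro divide_left_mono mult_pos_pos) auto
  finally show ?thesis .
qed

lemma integral_eq_lborel_indicator:
  fixes f :: "real \<Rightarrow> complex"
  assumes "continuous_on {a..b} f"
  shows "integral {a..b} f = (\<integral>x. indicator {a..b} x *\<^sub>R f x \<partial>lborel)"
  using set_borel_integral_eq_integral(2)[OF borel_integrable_atLeastAtMost'[OF assms]]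
  by (simp add: set_lebesgue_integral_def)

lemma measurable_indicator_continuous_on:
  fixes f :: "real \<Rightarrow> complex"
  assumes "continuous_on {a..b} f"
  shows "(\<lambda>x. indicator {a..b} x *\<^sub>R f x) \<in> borel_measurable borel"
  using assms by (intro borel_measurable_continuous_on_indicator) auto

text \<open>Cauchy's formula on the rectangles [-R, R] x [1/R, R]. The bottom side converges to the
  boundary integral by dominated convergence. On the top side the kernel is O(1/R) against an
  integrable majorant. On the vertical sides the integrand is O(1/R^2) over a length at most R. The
  bound must exclude Re z = 0, where \<open>decay_majorant\<close> has the default value 0; this is
  a single point of each horizontal side.\<close>

lemma upper_half_plane_cauchy:
  fixes f :: "complex \<Rightarrow> complex" and g :: "real \<Rightarrow> complex"
  assumes hol: "f holomorphic_on {z. Im z > 0}"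
    and bound: "\<And>z. Im z > 0 \<Longrightarrow> Re z \<noteq> 0 \<Longrightarrow> norm (f z) \<le> C * decay_majorant (Re z)"
    and lim: "\<And>x Y. x \<noteq> 0 \<Longrightarrow> Y \<longlonglongrightarrow> 0 \<Longrightarrow> (\<And>n. Y n \<ge> 0) \<Longrightarrow> (\<lambda>n::nat. f (Complex x (Y n))) \<longlonglongrightarrow> g x"
    and meas: "g \<in> borel_measurable borel"
    and C: "C \<ge> 0" and y: "y > 0"
  shows "2 * pi * \<i> * f (\<i> * of_real y) = (\<integral>x. g x * cauchy_kernel y (of_real x) \<partial>lborel)"
proof -
  \<comment> \<open>The three summands secure R > 2y for the far estimate of the kernel, 1/R \<le>
    y/2 for the low one, and R > 1 for the x^(-2) branch of the majorant.\<close>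
  define R0 where "R0 = 1 + 2 * y + 2 / y"
  define R where "R = (\<lambda>n. R0 + real (Suc n))"
  have R: "R n > 2 * y" "R n > 2 / y" "R n > 1" for n
  proof -
    have "2 / y > 0" "real (Suc n) > 0" using y by simp_all
    then show "R n > 2 * y" "R n > 2 / y" "R n > 1" using y unfolding R_def R0_def by linarith+
  qed
  have Rpos: "R n > 0" for n using R(3)[of n] by linarith
  define \<delta> where "\<delta> = (\<lambda>n. 1 / R n)"
  have \<delta>: "\<delta> n > 0" "\<delta> n \<le> y / 2" "\<delta> n < R n" for n
  proof -
    show "\<delta> n > 0" using Rpos by (simp add: \<delta>_def)
    show "\<delta> n \<le> y / 2" using R(2)[of n] Rpos[of n] y by (simp add: \<delta>_def field_simps)
    have "\<delta> n < 1" using R(3)[of n] by (simp add: \<delta>_def)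
    then show "\<delta> n < R n" using R(3)[of n] by linarith
  qed
  have Rlim: "filterlim R at_top sequentially"
    unfolding R_def by (intro filterlim_tendsto_add_at_top[OF tendsto_const] filterlim_compose[OF filterlim_real_sequentially filterlim_Suc])
  have \<delta>lim: "\<delta> \<longlonglongrightarrow> 0"
    unfolding \<delta>_def using tendsto_divide_0[OF tendsto_const filterlim_at_top_imp_at_infinity[OF Rlim]] .
  define F where "F = (\<lambda>z. f z * cauchy_kernel y z)"
  have contf: "continuous_on {z. Im z > 0} f" by (rule holomorphic_on_imp_continuous_on[OF hol])
  have den: "z\<^sup>2 + of_real (y\<^sup>2) \<noteq> 0" if "Im z > 0" "z \<noteq> \<i> * of_real y" for z
  proof -
    have "Im (z + \<i> * of_real y) > 0" using that y by simp
    then have "z + \<i> * of_real y \<noteq> 0" by (metis less_irrefl zero_complex.simps(2))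
    then show ?thesis unfolding cauchy_kernel_factor using that by simp
  qed
  have contF: "continuous_on ({z. Im z > 0} - {\<i> * of_real y}) F"
    unfolding F_def cauchy_kernel_def using den
    by (intro continuous_intros continuous_on_subset[OF contf]) auto
  have cauchy: "contour_integral (rectpath (Complex (- R n) (\<delta> n)) (Complex (R n) (R n))) F
      = 2 * pi * \<i> * f (\<i> * of_real y)" and
    rect: "path_image (rectpath (Complex (- R n) (\<delta> n)) (Complex (R n) (R n))) \<subseteq> {z. Im z > 0} - {\<i> * of_real y}" for n
  proof -
    let ?a = "Complex (- R n) (\<delta> n)" and ?b = "Complex (R n) (R n)"
    have box: "\<i> * of_real y \<in> box ?a ?b"
      using \<delta>[of n] R[of n] y by (auto simp: in_box_complex_iff)
    show sub: "path_image (rectpath ?a ?b) \<subseteq> {z. Im z > 0} - {\<i> * of_real y}"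
      using box \<delta>[of n] R[of n] y
      by (subst path_image_rectpath_cbox_minus_box) (auto simp: in_box_complex_iff in_cbox_complex_iff)
    \<comment> \<open>The part of the integrand that is holomorphic in the whole half plane; at iy
      the extra factor 2z/(z + iy) equals 1.\<close>
    define G where "G = (\<lambda>z. f z * (2 * z / (z + \<i> * of_real y)))"
    have ne: "z + \<i> * of_real y \<noteq> 0" if "Im z > 0" for z
    proof -
      have "Im (z + \<i> * of_real y) > 0" using that y by simp
      then show ?thesis by (metis less_irrefl zero_complex.simps(2))
    qed
    have hG: "G holomorphic_on {z. Im z > 0}"
      unfolding G_def using ne by (intro holomorphic_intros hol) auto
    have "((\<lambda>w. G w / (w - \<i> * of_real y)) has_contour_integral
        (2 * pi * \<i> * winding_number (rectpath ?a ?b) (\<i> * of_real y) * G (\<i> * of_real y))) (rectpath ?a ?b)"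
      by (rule Cauchy_integral_formula_convex_simple[OF convex_halfspace_Im_gt hG])
         (use sub y in \<open>auto simp: interior_open open_halfspace_Im_gt\<close>)
    also have "winding_number (rectpath ?a ?b) (\<i> * of_real y) = 1"
      by (rule winding_number_rectpath[OF box])
    also have "G (\<i> * of_real y) = f (\<i> * of_real y)"
      using y by (simp add: G_def field_simps)
    also have "(\<lambda>w. G w / (w - \<i> * of_real y)) = F"
      by (simp add: fun_eq_iff G_def F_def cauchy_kernel_def cauchy_kernel_factor mult.commute del: of_real_power)
    finally show "contour_integral (rectpath ?a ?b) F = 2 * pi * \<i> * f (\<i> * of_real y)"
      by (simp add: contour_integral_unique)
  qed
  have pi: "path_image (rectpath (Complex (- R n) (\<delta> n)) (Complex (R n) (R n))) =
      {z. Re z \<in> {- R n, R n} \<and> Im z \<in> {\<delta> n..R n}} \<union> {z. Im z \<in> {\<delta> n, R n} \<and> Re z \<in> {- R n..R n}}" for n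
    using \<delta>[of n] Rpos[of n] by (subst path_image_rectpath) auto
  have conth: "continuous_on {- R n..R n} (\<lambda>x. F (Complex x c))" if "c = \<delta> n \<or> c = R n" for n c
  proof (rule continuous_on_compose2[OF continuous_on_subset[OF contF rect[of n]]])
    show "continuous_on {- R n..R n} (\<lambda>x. Complex x c)" by (intro continuous_intros)
    show "(\<lambda>x. Complex x c) ` {- R n..R n} \<subseteq> path_image (rectpath (Complex (- R n) (\<delta> n)) (Complex (R n) (R n)))"
      unfolding pi using that by auto
  qed
  define bot where "bot = (\<lambda>n. integral {- R n..R n} (\<lambda>x. F (Complex x (\<delta> n))))"
  define top' where "top' = (\<lambda>n. integral {- R n..R n} (\<lambda>x. F (Complex x (R n))))"
  define side where "side = (\<lambda>n s. contour_integral (linepath (Complex s (\<delta> n)) (Complex s (R n))) F)"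
  have sum: "2 * pi * \<i> * f (\<i> * of_real y) = bot n + side n (R n) - top' n - side n (- R n)" for n
    unfolding bot_def top'_def side_def cauchy[of n, symmetric]
    using \<delta>[of n] Rpos[of n]
    by (intro contour_integral_rectpath continuous_on_subset[OF contF rect]) auto
  have bot: "bot \<longlonglongrightarrow> (\<integral>x. g x * cauchy_kernel y (of_real x) \<partial>lborel)"
  proof -
    have "(\<lambda>n. \<integral>x. indicator {- R n..R n} x *\<^sub>R F (Complex x (\<delta> n)) \<partial>lborel)
        \<longlonglongrightarrow> (\<integral>x. g x * cauchy_kernel y (of_real x) \<partial>lborel)"
    proof (rule integral_dominated_convergence[where w = "\<lambda>x. C * decay_majorant x * (4 / y)"])
      show "(\<lambda>x. g x * cauchy_kernel y (of_real x)) \<in> borel_measurable lborel"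
        using meas unfolding cauchy_kernel_def by measurable
      show "(\<lambda>x. indicator {- R n..R n} x *\<^sub>R F (Complex x (\<delta> n))) \<in> borel_measurable lborel" for n
        using measurable_indicator_continuous_on[OF conth[of "\<delta> n" n]] by simp
      show "integrable lborel (\<lambda>x. C * decay_majorant x * (4 / y))"
        by (intro integrable_mult_left integrable_mult_right integrable_decay_majorant)
      show "AE x in lborel. norm (indicator {- R n..R n} x *\<^sub>R F (Complex x (\<delta> n))) \<le> C * decay_majorant x * (4 / y)" for n
        using AE_lborel_singleton[of 0]
      proof eventually_elim
        case (elim x)
        have "norm (F (Complex x (\<delta> n))) \<le> C * decay_majorant x * (4 / y)"
          unfolding F_def norm_mult using \<delta>[of n] y elim bound[of "Complex x (\<delta> n)"] C
          by (intro mult_mono norm_cauchy_kernel_low) (auto simp: decay_majorant_nonneg)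
        moreover have "0 \<le> C * decay_majorant x * (4 / y)" using C y by (simp add: decay_majorant_nonneg)
        ultimately show ?case by (auto simp: indicator_def)
      qed
      show "AE x in lborel. (\<lambda>n. indicator {- R n..R n} x *\<^sub>R F (Complex x (\<delta> n))) \<longlonglongrightarrow> g x * cauchy_kernel y (of_real x)"
        using AE_lborel_singleton[of 0]
      proof eventually_elim
        case (elim x)
        have l1: "(\<lambda>n. f (Complex x (\<delta> n))) \<longlonglongrightarrow> g x"
          using elim \<delta>(1) by (intro lim \<delta>lim) (auto intro: less_imp_le)
        have "(\<lambda>n. Complex x (\<delta> n)) \<longlonglongrightarrow> Complex x 0"
          by (rule tendsto_Complex[OF tendsto_const \<delta>lim])
        then have l2: "(\<lambda>n. Complex x (\<delta> n)) \<longlonglongrightarrow> of_real x" by (simp add: complex_of_real_def)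
        have "x\<^sup>2 + y\<^sup>2 > 0" using y by (intro add_nonneg_pos) auto
        then have "complex_of_real (x\<^sup>2 + y\<^sup>2) \<noteq> 0" by (metis of_real_eq_0_iff less_irrefl)
        then have ne: "(complex_of_real x)\<^sup>2 + of_real (y\<^sup>2) \<noteq> 0" by simp
        have l3: "(\<lambda>n. cauchy_kernel y (Complex x (\<delta> n))) \<longlonglongrightarrow> cauchy_kernel y (of_real x)"
          unfolding cauchy_kernel_def by (intro tendsto_intros l2 ne)
        have "eventually (\<lambda>n. \<bar>x\<bar> \<le> R n) sequentially"
          using Rlim by (simp add: filterlim_at_top)
        then have ev: "eventually (\<lambda>n. F (Complex x (\<delta> n)) = indicator {- R n..R n} x *\<^sub>R F (Complex x (\<delta> n))) sequentially"
          by eventually_elim (auto simp: indicator_def)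
        have "(\<lambda>n. F (Complex x (\<delta> n))) \<longlonglongrightarrow> g x * cauchy_kernel y (of_real x)"
          unfolding F_def by (rule tendsto_mult[OF l1 l3])
        then show ?case by (rule Lim_transform_eventually[OF _ ev])
      qed
    qed
    then show ?thesis unfolding bot_def using integral_eq_lborel_indicator[OF conth] by simp
  qed
  have top: "top' \<longlonglongrightarrow> 0"
  proof (rule Lim_null_comparison)
    have "norm (top' n) \<le> C * integral\<^sup>L lborel decay_majorant * (4 / R n)" for n
    proof -
      have int: "integrable lborel (\<lambda>x. indicator {- R n..R n} x *\<^sub>R F (Complex x (R n)))"
        using borel_integrable_atLeastAtMost'[OF conth[of "R n" n]] by (simp add: set_integrable_def)
      have "norm (top' n) \<le> (\<integral>x. norm (indicator {- R n..R n} x *\<^sub>R F (Complex x (R n))) \<partial>lborel)"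
        unfolding top'_def integral_eq_lborel_indicator[OF conth[of "R n" n, simplified]] by (rule integral_norm_bound)
      also have "\<dots> \<le> (\<integral>x. C * decay_majorant x * (4 / R n) \<partial>lborel)"
      proof (rule integral_mono_AE)
        show "integrable lborel (\<lambda>x. norm (indicator {- R n..R n} x *\<^sub>R F (Complex x (R n))))"
          by (rule integrable_norm[OF int])
        show "integrable lborel (\<lambda>x. C * decay_majorant x * (4 / R n))"
          by (intro integrable_mult_left integrable_mult_right integrable_decay_majorant)
        show "AE x in lborel. norm (indicator {- R n..R n} x *\<^sub>R F (Complex x (R n))) \<le> C * decay_majorant x * (4 / R n)"
          using AE_lborel_singleton[of 0]
        proof eventually_elim
          case (elim x)
          have far: "R n \<le> norm (Complex x (R n))" using abs_Im_le_cmod[of "Complex x (R n)"] by simp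
          have "norm (F (Complex x (R n))) \<le> C * decay_majorant x * (4 / R n)"
            unfolding F_def norm_mult using Rpos[of n] R(1)[of n] y elim bound[of "Complex x (R n)"] C far
            by (intro mult_mono norm_cauchy_kernel_far) (auto simp: decay_majorant_nonneg)
          moreover have "0 \<le> C * decay_majorant x * (4 / R n)" using C Rpos[of n] by (simp add: decay_majorant_nonneg)
          ultimately show ?case by (auto simp: indicator_def)
        qed
      qed
      also have "\<dots> = C * integral\<^sup>L lborel decay_majorant * (4 / R n)" by simp
      finally show ?thesis .
    qed
    then show "\<forall>\<^sub>F n in sequentially. norm (top' n) \<le> C * integral\<^sup>L lborel decay_majorant * (4 / R n)"
      by simp
    have "(\<lambda>n. C * integral\<^sup>L lborel decay_majorant * (4 / R n)) \<longlonglongrightarrow> C * integral\<^sup>L lborel decay_majorant * 0"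
      by (intro tendsto_mult tendsto_const tendsto_divide_0[OF tendsto_const] filterlim_at_top_imp_at_infinity[OF Rlim])
    then show "(\<lambda>n. C * integral\<^sup>L lborel decay_majorant * (4 / R n)) \<longlonglongrightarrow> 0" by simp
  qed
  have side: "(\<lambda>n. side n (s n)) \<longlonglongrightarrow> 0" if s: "s = R \<or> s = (\<lambda>n. - R n)" for s
  proof (rule Lim_null_comparison)
    have "norm (side n (s n)) \<le> C * (4 / R n)" for n
    proof -
      have sn: "\<bar>s n\<bar> = R n" using s Rpos[of n] by auto
      have seg: "closed_segment (Complex (s n) (\<delta> n)) (Complex (s n) (R n)) \<subseteq> {z. Re z = s n \<and> \<delta> n \<le> Im z \<and> Im z \<le> R n}"
        using \<delta>(3)[of n] by (auto simp: closed_segment_same_Re closed_segment_eq_real_ivl)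
      have sub: "closed_segment (Complex (s n) (\<delta> n)) (Complex (s n) (R n)) \<subseteq> {z. Im z > 0} - {\<i> * of_real y}"
        using seg sn Rpos[of n] \<delta>(1)[of n] by fastforce
      \<comment> \<open>The weaker order 1/R suffices: together with the kernel and the length of
        the side it leaves O(1/R).\<close>
      have maj: "decay_majorant (s n) \<le> 1 / R n"
      proof -
        have "decay_majorant (s n) = R n powr (- 2)"
          using R(3)[of n] sn by (simp add: decay_majorant_def)
        also have "\<dots> \<le> R n powr (- 1)" using R(3)[of n] by (intro powr_mono) auto
        also have "\<dots> = 1 / R n" using Rpos[of n] by (simp add: powr_minus_divide)
        finally show ?thesis .
      qed
      have b: "norm (F z) \<le> C * (1 / R n) * (4 / R n)"
        if "z \<in> closed_segment (Complex (s n) (\<delta> n)) (Complex (s n) (R n))" for z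
      proof -
        have z: "Re z = s n" "Im z > 0" using that seg \<delta>(1)[of n] by auto
        have far: "R n \<le> norm z" using abs_Re_le_cmod[of z] z sn by simp
        have "norm (f z) \<le> C * decay_majorant (s n)" using bound[of z] z sn Rpos[of n] by auto
        also have "\<dots> \<le> C * (1 / R n)" using maj C by (rule mult_left_mono)
        finally show ?thesis
          unfolding F_def norm_mult using far R(1)[of n] Rpos[of n] y C
          by (intro mult_mono norm_cauchy_kernel_far) auto
      qed
      have "norm (side n (s n)) \<le> C * (1 / R n) * (4 / R n) * norm (Complex (s n) (R n) - Complex (s n) (\<delta> n))"
        unfolding side_def
        by (rule contour_integral_bound_linepath) (use b C Rpos[of n] in \<open>auto intro!: contour_integrable_continuous_linepath continuous_on_subset[OF contF sub]\<close>)
      also have "norm (Complex (s n) (R n) - Complex (s n) (\<delta> n)) = R n - \<delta> n"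
        using \<delta>(3)[of n] by (simp add: cmod_def)
      also have "C * (1 / R n) * (4 / R n) * (R n - \<delta> n) \<le> C * (1 / R n) * (4 / R n) * R n"
        using C Rpos[of n] \<delta>(1)[of n] by (intro mult_left_mono) auto
      also have "\<dots> = C * (4 / R n)" using Rpos[of n] by simp
      finally show ?thesis .
    qed
    then show "\<forall>\<^sub>F n in sequentially. norm (side n (s n)) \<le> C * (4 / R n)" by simp
    have "(\<lambda>n. C * (4 / R n)) \<longlonglongrightarrow> C * 0"
      by (intro tendsto_mult tendsto_const tendsto_divide_0[OF tendsto_const] filterlim_at_top_imp_at_infinity[OF Rlim])
    then show "(\<lambda>n. C * (4 / R n)) \<longlonglongrightarrow> 0" by simp
  qed
  have "(\<lambda>n. bot n + side n (R n) - top' n - side n (- R n)) \<longlonglongrightarrow> (\<integral>x. g x * cauchy_kernel y (of_real x) \<partial>lborel) + 0 - 0 - 0"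
    using side[of R] side[of "\<lambda>n. - R n"] by (intro tendsto_intros bot top) auto
  then show ?thesis
    unfolding sum[symmetric] by (simp add: LIMSEQ_const_iff)
qed

section \<open>The Stieltjes integral on the imaginary axis\<close>

lemma gauss_csqrt_of_real_measurable [measurable]:
  "(\<lambda>x. gauss_csqrt \<sigma> (of_real x)) \<in> borel_measurable borel"
  unfolding gauss_csqrt_def gauss_csqrt_kernel_def by measurable

lemma bessel_hp_of_real_measurable [measurable]:
  "(\<lambda>x. bessel_hp (of_real x)) \<in> borel_measurable borel"
  unfolding bessel_hp_def by measurable

lemma norm_bessel_hp_power_le:
  assumes "m \<ge> 1"
  obtains C where "C \<ge> 0" "\<And>z. Re z \<noteq> 0 \<Longrightarrow> norm (bessel_hp z ^ (2 * m)) \<le> C * decay_majorant (Re z)"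
proof -
  obtain C where C: "C \<ge> 0" "\<And>x. x > 0 \<Longrightarrow> sing_gauss_int x ^ (4 * m) \<le> C * decay_majorant x"
    using sing_gauss_int_power_le[OF assms] by blast
  show ?thesis
  proof (rule that[OF C(1)])
    fix z assume z: "Re z \<noteq> 0"
    have "norm (bessel_hp z ^ (2 * m)) \<le> (sing_gauss_int \<bar>Re z\<bar> ^ 2) ^ (2 * m)"
      unfolding norm_power by (intro power_mono norm_bessel_hp_le z) auto
    also have "\<dots> = sing_gauss_int \<bar>Re z\<bar> ^ (4 * m)" by (simp flip: power_mult)
    also have "\<dots> \<le> C * decay_majorant (Re z)" using C(2)[of "\<bar>Re z\<bar>"] z by simp
    finally show "norm (bessel_hp z ^ (2 * m)) \<le> C * decay_majorant (Re z)" .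
  qed
qed

lemma bessel_hp_minus_of_real: "bessel_hp (of_real (- x)) = - cnj (bessel_hp (of_real x))"
  using bessel_hp_minus_cnj[of "of_real x"] by simp

text \<open>The boundary values at x and -x are conjugate and the kernel is odd. Hence the real part
  of the Cauchy integral vanishes, and the imaginary part is twice the integral over the half
  line.\<close>

lemma bessel_hp_stieltjes:
  assumes m: "m \<ge> 1" and y: "y > 0"
  shows "bessel_hp (\<i> * of_real y) ^ (2 * m) =
    of_real (2 / pi * (\<integral>x. indicator {0..} x * (Im (bessel_hp (of_real x) ^ (2 * m)) * (x / (x\<^sup>2 + y\<^sup>2))) \<partial>lborel))"
proof -
  obtain C where C: "C \<ge> 0" "\<And>z. Re z \<noteq> 0 \<Longrightarrow> norm (bessel_hp z ^ (2 * m)) \<le> C * decay_majorant (Re z)"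
    using norm_bessel_hp_power_le[OF m] by blast
  define g where "g = (\<lambda>x. bessel_hp (of_real x) ^ (2 * m))"
  have [measurable]: "g \<in> borel_measurable borel" unfolding g_def by measurable
  define k where "k = (\<lambda>x. 2 * x / (x\<^sup>2 + y\<^sup>2))"
  have [measurable]: "k \<in> borel_measurable borel" unfolding k_def by measurable
  have K: "cauchy_kernel y (of_real x) = of_real (k x)" for x
    by (simp add: cauchy_kernel_def k_def)
  have kle: "\<bar>k x\<bar> \<le> 1 / y" for x
  proof -
    have "0 \<le> (\<bar>x\<bar> - y)\<^sup>2" by simp
    then have "2 * \<bar>x\<bar> * y \<le> x\<^sup>2 + y\<^sup>2" by (simp add: power2_diff)
    moreover have "x\<^sup>2 + y\<^sup>2 > 0" using y by (intro add_nonneg_pos) auto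
    ultimately show ?thesis using y by (simp add: k_def abs_mult field_simps)
  qed
  define I where "I = (\<integral>x. g x * of_real (k x) \<partial>lborel)"
  have cauchy: "2 * pi * \<i> * bessel_hp (\<i> * of_real y) ^ (2 * m) = I"
    unfolding I_def K[symmetric]
  proof (rule upper_half_plane_cauchy[OF _ _ _ _ C(1) y])
    show "(\<lambda>z. bessel_hp z ^ (2 * m)) holomorphic_on {z. Im z > 0}"
      by (intro holomorphic_intros bessel_hp_holomorphic)
    show "(\<lambda>n. bessel_hp (Complex x (Y n)) ^ (2 * m)) \<longlonglongrightarrow> g x"
      if "x \<noteq> 0" "Y \<longlonglongrightarrow> 0" "\<And>n. Y n \<ge> 0" for x and Y :: "nat \<Rightarrow> real"
      unfolding g_def by (intro tendsto_power bessel_hp_boundary_limit that)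
    show "g \<in> borel_measurable borel" by measurable
  qed (use C(2) in auto)
  have int: "integrable lborel (\<lambda>x. g x * of_real (k x))"
  proof (rule Bochner_Integration.integrable_bound)
    show "integrable lborel (\<lambda>x. C * decay_majorant x * (1 / y))"
      by (intro integrable_mult_left integrable_mult_right integrable_decay_majorant)
    show "AE x in lborel. norm (g x * of_real (k x)) \<le> norm (C * decay_majorant x * (1 / y))"
      using AE_lborel_singleton[of 0]
    proof eventually_elim
      case (elim x)
      have "norm (g x * of_real (k x)) \<le> C * decay_majorant x * (1 / y)"
        unfolding norm_mult using elim C(2)[of "of_real x"] C(1) kle[of x]
        by (intro mult_mono) (auto simp: g_def decay_majorant_nonneg)
      also have "\<dots> \<le> norm \<dots>" unfolding real_norm_def by (rule abs_ge_self)
      finally show ?case .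
    qed
  qed measurable
  have gm: "g (- x) = cnj (g x)" for x
    unfolding g_def bessel_hp_minus_of_real by simp
  have km: "k (- x) = - k x" for x by (simp add: k_def)
  \<comment> \<open>Reflecting x gives I = -conj(I), so I is purely imaginary.\<close>
  have "I = (\<integral>x. g (0 + (- 1) * x) * of_real (k (0 + (- 1) * x)) \<partial>lborel)"
    unfolding I_def by (subst lborel_integral_real_affine[where c = "- 1" and t = 0]) auto
  also have "\<dots> = (\<integral>x. - cnj (g x * of_real (k x)) \<partial>lborel)" by (simp add: gm km)
  also have "\<dots> = - cnj I"
    using Bochner_Integration.integral_cnj[of lborel "\<lambda>x. g x * of_real (k x)"] by (simp add: I_def del: Bochner_Integration.integral_cnj)
  finally have "Re I = - Re I" by (metis uminus_complex.simps(1) cnj.simps(1))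
  then have "Re I = 0" by simp
  have ImI: "Im I = (\<integral>x. Im (g x) * k x \<partial>lborel)"
    unfolding I_def using Bochner_Integration.integral_Im[OF int] by simp
  have int': "integrable lborel (\<lambda>x. Im (g x) * k x)"
    using integrable_Im[OF int] by simp
  have even: "Im (g (- x)) * k (- x) = Im (g x) * k x" for x by (simp add: gm km)
  have inth: "integrable lborel (\<lambda>x. indicator {0..} x *\<^sub>R (Im (g x) * k x))"
    by (intro integrable_mult_indicator int') auto
  have "has_bochner_integral lborel (\<lambda>x. Im (g x) * k x) (2 *\<^sub>R (\<integral>x. indicator {0..} x *\<^sub>R (Im (g x) * k x) \<partial>lborel))"
    by (rule has_bochner_integral_even_function[OF has_bochner_integral_integrable[OF inth] even])
  then have "Im I = 2 * (\<integral>x. indicator {0..} x *\<^sub>R (Im (g x) * k x) \<partial>lborel)"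
    unfolding ImI by (simp add: has_bochner_integral_integral_eq)
  also have "\<dots> = 2 * (\<integral>x. 2 * (indicator {0..} x * (Im (g x) * (x / (x\<^sup>2 + y\<^sup>2)))) \<partial>lborel)"
    by (simp add: k_def mult_ac)
  also have "\<dots> = 4 * (\<integral>x. indicator {0..} x * (Im (g x) * (x / (x\<^sup>2 + y\<^sup>2))) \<partial>lborel)"
    by (subst Bochner_Integration.integral_mult_right_zero) simp
  finally have Im: "Im I = 4 * (\<integral>x. indicator {0..} x * (Im (g x) * (x / (x\<^sup>2 + y\<^sup>2))) \<partial>lborel)" .
  have "I = \<i> * of_real (Im I)" using \<open>Re I = 0\<close> by (simp add: complex_eq_iff)
  then have "2 * pi * \<i> * bessel_hp (\<i> * of_real y) ^ (2 * m) = \<i> * of_real (Im I)" using cauchy by simp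
  then have "bessel_hp (\<i> * of_real y) ^ (2 * m) = of_real (Im I / (2 * pi))"
    by (simp add: field_simps)
  then show ?thesis unfolding Im g_def by simp
qed

section \<open>Asymptotic expansions\<close>

text \<open>Equivalently $f(e) = \sum_{j<N} F_j e^j + O(e^N)$ on $(0,1]$; the recursive form makes products easy.\<close>

primrec asym_fps :: "nat \<Rightarrow> (real \<Rightarrow> complex) \<Rightarrow> complex fps \<Rightarrow> bool" where
  "asym_fps 0 f F \<longleftrightarrow> (\<exists>C. \<forall>e. 0 < e \<and> e \<le> 1 \<longrightarrow> norm (f e) \<le> C)"
| "asym_fps (Suc N) f F \<longleftrightarrow> asym_fps N (\<lambda>e. (f e - fps_nth F 0) / of_real e) (fps_shift 1 F)"

lemma asym_fps_cong:
  assumes "\<And>e. 0 < e \<Longrightarrow> e \<le> 1 \<Longrightarrow> f e = g e"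
  shows "asym_fps N f F \<longleftrightarrow> asym_fps N g F"
  using assms
proof (induction N arbitrary: f g F)
  case 0
  then show ?case by auto
next
  case (Suc N)
  show ?case unfolding asym_fps.simps by (rule Suc.IH) (simp add: Suc.prems)
qed

lemma asym_fps_I:
  assumes "\<And>e. 0 < e \<Longrightarrow> e \<le> 1 \<Longrightarrow> norm (f e - (\<Sum>j<N. fps_nth F j * of_real e ^ j)) \<le> C * e ^ N"
  shows "asym_fps N f F"
  using assms
proof (induction N arbitrary: f F)
  case 0
  then show ?case by auto
next
  case (Suc N)
  show ?case unfolding asym_fps.simps
  proof (rule Suc.IH)
    fix e :: real assume e: "0 < e" "e \<le> 1"
    have "(\<Sum>j<Suc N. fps_nth F j * of_real e ^ j) = fps_nth F 0 + of_real e * (\<Sum>j<N. fps_nth F (Suc j) * of_real e ^ j)"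
      by (subst sum.lessThan_Suc_shift) (simp add: sum_distrib_left mult_ac)
    then have "(f e - fps_nth F 0) / of_real e - (\<Sum>j<N. fps_nth (fps_shift 1 F) j * of_real e ^ j)
      = (f e - (\<Sum>j<Suc N. fps_nth F j * of_real e ^ j)) / of_real e"
      using e by (simp add: field_simps)
    then show "norm ((f e - fps_nth F 0) / of_real e - (\<Sum>j<N. fps_nth (fps_shift 1 F) j * of_real e ^ j)) \<le> C * e ^ N"
      using Suc.prems[OF e] e by (simp add: norm_divide field_simps)
  qed
qed

lemma asym_fps_Suc_bounded:
  assumes "asym_fps 0 (\<lambda>e. (f e - c) / of_real e) F"
  shows "asym_fps 0 f G"
proof -
  obtain C where C: "\<And>e. 0 < e \<Longrightarrow> e \<le> 1 \<Longrightarrow> norm ((f e - c) / of_real e) \<le> C"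
    using assms by auto
  have "norm (f e) \<le> norm c + \<bar>C\<bar>" if "0 < e" "e \<le> 1" for e
  proof -
    have "norm (f e - c) \<le> C * e" using C[OF that] that by (simp add: norm_divide field_simps)
    also have "\<dots> \<le> \<bar>C\<bar> * 1" using that by (intro mult_mono) auto
    finally have "norm (f e - c) \<le> \<bar>C\<bar>" by simp
    then show ?thesis using norm_triangle_ineq2[of "f e" c] by linarith
  qed
  then show ?thesis by auto
qed

lemma asym_fps_SucD: "asym_fps (Suc N) f F \<Longrightarrow> asym_fps N f F"
proof (induction N arbitrary: f F)
  case 0
  then show ?case using asym_fps_Suc_bounded by simp
next
  case (Suc N)
  show ?case using Suc.IH Suc.prems by simp
qed

lemma asym_fps_mono: "asym_fps M f F \<Longrightarrow> N \<le> M \<Longrightarrow> asym_fps N f F"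
  by (induction M) (auto simp: le_Suc_eq dest: asym_fps_SucD simp del: asym_fps.simps)

lemma asym_fps_add: "asym_fps N f F \<Longrightarrow> asym_fps N g G \<Longrightarrow> asym_fps N (\<lambda>e. f e + g e) (F + G)"
proof (induction N arbitrary: f g F G)
  case 0
  then obtain C D where "\<And>e. 0 < e \<Longrightarrow> e \<le> 1 \<Longrightarrow> norm (f e) \<le> C" "\<And>e. 0 < e \<Longrightarrow> e \<le> 1 \<Longrightarrow> norm (g e) \<le> D"
    by auto
  then have "\<forall>e. 0 < e \<and> e \<le> 1 \<longrightarrow> norm (f e + g e) \<le> C + D" by (auto intro: norm_triangle_mono)
  then show ?case unfolding asym_fps.simps by blast
next
  case (Suc N)
  have "asym_fps N (\<lambda>e. (f e - fps_nth F 0) / of_real e + (g e - fps_nth G 0) / of_real e) (fps_shift 1 F + fps_shift 1 G)"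
    using Suc by simp
  then show ?case by (simp add: add_divide_distrib[symmetric] algebra_simps fps_shift_add)
qed

lemma asym_fps_cmult: "asym_fps N f F \<Longrightarrow> asym_fps N (\<lambda>e. c * f e) (fps_const c * F)"
proof (induction N arbitrary: f F)
  case 0
  then obtain C where "\<And>e. 0 < e \<Longrightarrow> e \<le> 1 \<Longrightarrow> norm (f e) \<le> C" by auto
  then have "\<forall>e. 0 < e \<and> e \<le> 1 \<longrightarrow> norm (c * f e) \<le> norm c * C" by (auto simp: norm_mult mult_left_mono)
  then show ?case unfolding asym_fps.simps by blast
next
  case (Suc N)
  have "asym_fps N (\<lambda>e. c * ((f e - fps_nth F 0) / of_real e)) (fps_const c * fps_shift 1 F)"
    by (rule Suc.IH) (use Suc.prems in simp)
  moreover have "fps_shift 1 (fps_const c * F) = fps_const c * fps_shift 1 F" by (rule fps_ext) simp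
  ultimately show ?case by (simp add: algebra_simps)
qed

text \<open>The formal counterpart of (f g - f0 g0)/e = ((f - f0)/e) g + f0 ((g - g0)/e), the
  identity behind the induction for products of expansions.\<close>

lemma fps_shift_1_mult:
  fixes F G :: "complex fps"
  shows "fps_shift 1 (F * G) = fps_shift 1 F * G + fps_const (fps_nth F 0) * fps_shift 1 G"
proof (rule fps_ext)
  fix n
  have "fps_nth (F * G) (Suc n) = fps_nth F 0 * fps_nth G (Suc n) + (\<Sum>i=0..n. fps_nth F (Suc i) * fps_nth G (n - i))"
    unfolding fps_mult_nth by (subst sum.atLeast0_atMost_Suc_shift) simp
  then show "fps_nth (fps_shift 1 (F * G)) n = fps_nth (fps_shift 1 F * G + fps_const (fps_nth F 0) * fps_shift 1 G) n"
    using fps_mult_nth[of "fps_shift 1 F" G n] by simp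
qed

lemma asym_fps_mult: "asym_fps N f F \<Longrightarrow> asym_fps N g G \<Longrightarrow> asym_fps N (\<lambda>e. f e * g e) (F * G)"
proof (induction N arbitrary: f g F G)
  case 0
  then obtain C D where CD: "\<And>e. 0 < e \<Longrightarrow> e \<le> 1 \<Longrightarrow> norm (f e) \<le> C" "\<And>e. 0 < e \<Longrightarrow> e \<le> 1 \<Longrightarrow> norm (g e) \<le> D"
    by auto
  have "norm (f e * g e) \<le> C * D" if "0 < e" "e \<le> 1" for e
    unfolding norm_mult
    by (intro mult_mono CD that norm_ge_zero order_trans[OF norm_ge_zero CD(1)[OF that]])
  then show ?case unfolding asym_fps.simps by blast
next
  case (Suc N)
  have "asym_fps N (\<lambda>e. (f e - fps_nth F 0) / of_real e * g e + fps_nth F 0 * ((g e - fps_nth G 0) / of_real e))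
      (fps_shift 1 F * G + fps_const (fps_nth F 0) * fps_shift 1 G)"
    using Suc.prems asym_fps_SucD[OF Suc.prems(2)] by (intro asym_fps_add asym_fps_cmult Suc.IH) auto
  also have "(\<lambda>e. (f e - fps_nth F 0) / of_real e * g e + fps_nth F 0 * ((g e - fps_nth G 0) / of_real e))
    = (\<lambda>e. (f e * g e - fps_nth (F * G) 0) / of_real e)"
    by (simp add: fun_eq_iff add_divide_distrib[symmetric] algebra_simps)
  finally show ?case unfolding asym_fps.simps fps_shift_1_mult .
qed

lemma asym_fps_const: "asym_fps N (\<lambda>e. c) (fps_const c)"
proof (rule asym_fps_I[where C = "norm c"])
  fix e :: real assume "0 < e" "e \<le> 1"
  show "norm (c - (\<Sum>j<N. fps_nth (fps_const c) j * of_real e ^ j)) \<le> norm c * e ^ N"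
  proof (cases N)
    case (Suc M)
    have "(\<Sum>j<N. fps_nth (fps_const c) j * of_real e ^ j) = c"
      unfolding Suc by (subst sum.lessThan_Suc_shift) simp
    then show ?thesis using \<open>0 < e\<close> by simp
  qed simp
qed

lemma asym_fps_of_real: "asym_fps N (\<lambda>e. of_real e) fps_X"
proof (cases N)
  case 0
  then show ?thesis by auto
next
  case (Suc M)
  have "asym_fps M (\<lambda>e. (of_real e - fps_nth fps_X 0) / of_real e) (fps_const 1)"
    by (subst asym_fps_cong[where g = "\<lambda>_. 1"]) (use asym_fps_const[of M 1] in auto)
  moreover have "fps_shift 1 fps_X = (fps_const 1 :: complex fps)" by (rule fps_ext) (simp add: fps_X_def)
  ultimately show ?thesis unfolding Suc asym_fps.simps by metis
qed

lemma asym_fps_power: "asym_fps N f F \<Longrightarrow> asym_fps N (\<lambda>e. f e ^ k) (F ^ k)"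
proof (induction k)
  case 0
  show ?case using asym_fps_const[of N 1] by simp
next
  case (Suc k)
  then show ?case using asym_fps_mult by simp
qed

lemma asym_fps_nth_0_unique:
  assumes "asym_fps 1 f F" "asym_fps 1 f G"
  shows "fps_nth F 0 = fps_nth G 0"
proof -
  obtain C where C: "\<And>e. 0 < e \<Longrightarrow> e \<le> 1 \<Longrightarrow> norm ((f e - fps_nth F 0) / of_real e) \<le> C"
    using assms(1) by auto
  obtain D where D: "\<And>e. 0 < e \<Longrightarrow> e \<le> 1 \<Longrightarrow> norm ((f e - fps_nth G 0) / of_real e) \<le> D"
    using assms(2) by auto
  define d where "d = norm (fps_nth F 0 - fps_nth G 0)"
  have le: "d \<le> (C + D) * e" if e: "0 < e" "e \<le> 1" for e
  proof -
    have "norm (f e - fps_nth F 0) \<le> C * e" "norm (f e - fps_nth G 0) \<le> D * e"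
      using C[OF e] D[OF e] e by (simp_all add: norm_divide field_simps)
    moreover have "d = norm ((f e - fps_nth G 0) - (f e - fps_nth F 0))" by (simp add: d_def norm_minus_commute)
    ultimately show ?thesis using norm_triangle_ineq4[of "f e - fps_nth G 0" "f e - fps_nth F 0"]
      by (simp add: algebra_simps)
  qed
  have "d = 0"
  proof (rule ccontr)
    assume "d \<noteq> 0"
    then have d: "d > 0" by (simp add: d_def)
    define q where "q = \<bar>C + D\<bar> + 1"
    have q: "q > 0" "C + D \<le> q" using abs_ge_zero[of "C + D"] abs_ge_self[of "C + D"] unfolding q_def by linarith+
    define e where "e = min 1 (d / (2 * q))"
    have e: "0 < e" "e \<le> 1" using d q by (auto simp: e_def)
    have "d \<le> (C + D) * e" by (rule le[OF e])
    also have "\<dots> \<le> q * (d / (2 * q))"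
      using e d q by (intro mult_mono) (auto simp: e_def)
    also have "\<dots> = d / 2" using q by (simp add: field_simps)
    finally show False using d by simp
  qed
  then show ?thesis by (simp add: d_def)
qed

lemma asym_fps_unique:
  assumes "\<And>N. asym_fps N f F" "\<And>N. asym_fps N f G"
  shows "F = G"
proof (rule fps_ext)
  fix n
  show "fps_nth F n = fps_nth G n"
    using assms
  proof (induction n arbitrary: f F G)
    case 0
    show ?case using asym_fps_nth_0_unique[OF 0(1) 0(2)] .
  next
    case (Suc n)
    have eq: "fps_nth F 0 = fps_nth G 0" using asym_fps_nth_0_unique Suc.prems by blast
    have "fps_nth (fps_shift 1 F) n = fps_nth (fps_shift 1 G) n"
    proof (rule Suc.IH)
      show "asym_fps N (\<lambda>e. (f e - fps_nth F 0) / of_real e) (fps_shift 1 F)" for N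
        using Suc.prems(1)[of "Suc N"] by simp
      show "asym_fps N (\<lambda>e. (f e - fps_nth F 0) / of_real e) (fps_shift 1 G)" for N
        using Suc.prems(2)[of "Suc N"] by (simp add: eq)
    qed
    then show ?case by simp
  qed
qed

section \<open>Expansion of \<open>h\<close> along the imaginary axis\<close>

lemma has_bochner_integral_gaussian_moment:
  "has_bochner_integral lborel (\<lambda>s::real. exp (- s\<^sup>2) * s ^ (2 * k)) (sqrt pi * (fact (2 * k) / (4 ^ k * fact k)))"
proof -
  have "has_bochner_integral lborel (\<lambda>s::real. exp (- s\<^sup>2) * s ^ (2 * k))
      (2 *\<^sub>R ((sqrt pi / 2) * (fact (2 * k) / (2 ^ (2 * k) * fact k))))"
    by (rule has_bochner_integral_even_function[OF gaussian_moment_even_pos]) simp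
  then show ?thesis by (simp add: power_mult)
qed

text \<open>On Re u \<ge> 0 one has |1 + u| \<ge> 1, so every derivative of (1 + u)^(-1/2) is
  bounded there and the Taylor remainder is controlled for all u, not only for small ones. This
  matters because u = \<plusminus>i e s^2 is unbounded as s runs over the line.\<close>

lemma inverse_csqrt_taylor:
  obtains C where "C \<ge> 0" "\<And>u. Re u \<ge> 0 \<Longrightarrow>
    norm (1 / csqrt (1 + u) - (\<Sum>j<N. of_real ((-1/2) gchoose j) * u ^ j)) \<le> C * norm u ^ N"
proof (cases N)
  case 0
  have "norm (1 / csqrt (1 + u)) \<le> 1" if "Re u \<ge> 0" for u
  proof -
    have "1 \<le> norm (1 + u)" using that complex_Re_le_cmod[of "1 + u"] by simp
    then have "1 \<le> sqrt (norm (1 + u))" by simp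
    then show ?thesis by (simp add: norm_divide divide_le_eq_1)
  qed
  then show ?thesis using that[of 1] 0 by simp
next
  case (Suc n)
  define c where "c = (\<lambda>i. complex_of_real (fact i * ((-1/2) gchoose i)))"
  define f where "f = (\<lambda>i u. c i * (1 + u) powr (- 1/2 - of_nat i))"
  have cS: "c (Suc i) = c i * (- 1/2 - of_nat i)" for i
  proof -
    have "fact (Suc i) * ((-1/2::real) gchoose (Suc i)) = fact i * (real (Suc i) * ((-1/2) gchoose (Suc i)))"
      by (simp add: algebra_simps)
    also have "\<dots> = fact i * ((-1/2) gchoose i) * (-1/2 - real i)"
      unfolding gbinomial_minus_half_Suc by (simp only: mult_ac)
    finally have "c (Suc i) = of_real (fact i * ((-1/2) gchoose i) * (-1/2 - real i))" unfolding c_def by (rule arg_cong)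
    then show ?thesis unfolding c_def of_real_mult of_real_diff by simp
  qed
  have np: "1 + u \<notin> \<real>\<^sub>\<le>\<^sub>0" if "Re u \<ge> 0" for u
    using that by (auto simp: complex_nonpos_Reals_iff)
  have der: "(f i has_field_derivative f (Suc i) u) (at u within {u. Re u \<ge> 0})" if "Re u \<ge> 0" for i u
  proof -
    have "((\<lambda>u. (1 + u) powr (- 1/2 - of_nat i)) has_field_derivative
        (- 1/2 - of_nat i) * (1 + u) powr (- 1/2 - of_nat i - 1)) (at u within {u. Re u \<ge> 0})"
      using np[OF that] by (auto intro!: derivative_eq_intros)
    from DERIV_cmult[OF this, of "c i"] show ?thesis
      unfolding f_def cS by (simp add: algebra_simps)
  qed
  have B: "norm (f (Suc n) u) \<le> norm (c (Suc n))" if "Re u \<ge> 0" for u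
  proof -
    have "1 \<le> norm (1 + u)" using that complex_Re_le_cmod[of "1 + u"] by simp
    then have "norm (1 + u) powr (- 1/2 - real (Suc n)) \<le> 1 powr (- 1/2 - real (Suc n))"
      by (intro powr_mono2') auto
    moreover have "norm ((1 + u) powr of_real (- 1/2 - real (Suc n))) = norm (1 + u) powr (- 1/2 - real (Suc n))"
      by (subst norm_powr_real_powr') auto
    ultimately have "norm ((1 + u) powr of_real (- 1/2 - real (Suc n))) \<le> 1" by simp
    then show ?thesis unfolding f_def norm_mult by (simp add: mult_left_le)
  qed
  have "norm (1 / csqrt (1 + u) - (\<Sum>j<N. of_real ((-1/2) gchoose j) * u ^ j)) \<le> norm (c (Suc n)) / fact n * norm u ^ N"
    if "Re u \<ge> 0" for u
  proof -
    have "norm (f 0 u - (\<Sum>i\<le>n. f i 0 * (u - 0) ^ i / fact i)) \<le> norm (c (Suc n)) * norm (u - 0) ^ Suc n / fact n"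
    proof (rule complex_Taylor[where S = "{u. Re u \<ge> 0}"])
      show "convex {u. Re u \<ge> 0}" by (rule convex_halfspace_Re_ge)
    qed (use der B that in auto)
    moreover have "f 0 u = 1 / csqrt (1 + u)"
      by (simp add: f_def c_def csqrt_conv_powr powr_minus_divide)
    moreover have "(\<Sum>i\<le>n. f i 0 * (u - 0) ^ i / fact i) = (\<Sum>j<N. of_real ((-1/2) gchoose j) * u ^ j)"
      unfolding Suc lessThan_Suc_atMost by (intro sum.cong) (auto simp: f_def c_def)
    ultimately show ?thesis by (simp add: Suc)
  qed
  then show ?thesis by (intro that[of "norm (c (Suc n)) / fact n"]) auto
qed

text \<open>The Gaussian integral at z = i/(2e) with the factor 1/sqrt(2z) removed. Since 1/(2z) =
  -ie, the sign \<sigma> here is opposite to that of \<open>gauss_csqrt\<close>.\<close>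

definition bessel_phi :: "real \<Rightarrow> real \<Rightarrow> complex" where
  "bessel_phi \<sigma> e = (\<integral>s. of_real (exp (- s\<^sup>2)) / csqrt (1 + \<i> * of_real (\<sigma> * e * s\<^sup>2)) \<partial>lborel)"

definition bessel_phi_fps :: "real \<Rightarrow> complex fps" where
  "bessel_phi_fps \<sigma> = Abs_fps (\<lambda>j. of_real (sqrt pi * bessel_asym_coeff j) * (\<i> * of_real \<sigma>) ^ j)"

text \<open>The binomial series is integrated term by term against the Gaussian; its even moments
  turn the binomial coefficients into \<open>bessel_asym_coeff\<close>. The remainder of order
  s^(2N) costs one more moment, which gives the constant \<open>C * M N\<close>.\<close>

lemma bessel_phi_asym:
  assumes \<sigma>: "\<bar>\<sigma>\<bar> = 1"
  shows "asym_fps N (bessel_phi \<sigma>) (bessel_phi_fps \<sigma>)"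
proof -
  obtain C where C: "C \<ge> 0" "\<And>u. Re u \<ge> 0 \<Longrightarrow>
      norm (1 / csqrt (1 + u) - (\<Sum>j<N. of_real ((-1/2) gchoose j) * u ^ j)) \<le> C * norm u ^ N"
    using inverse_csqrt_taylor by blast
  define M where "M = (\<lambda>k. sqrt pi * (fact (2 * k) / (4 ^ k * fact k)))"
  have mom: "has_bochner_integral lborel (\<lambda>s::real. exp (- s\<^sup>2) * s ^ (2 * k)) (M k)" for k
    unfolding M_def by (rule has_bochner_integral_gaussian_moment)
  show ?thesis
  proof (rule asym_fps_I[where C = "C * M N"])
    fix e :: real assume e: "0 < e" "e \<le> 1"
    define u where "u = (\<lambda>s. \<i> * of_real (\<sigma> * e * s\<^sup>2))"
    have nu: "norm (u s) = e * s\<^sup>2" for s using \<sigma> e by (simp add: u_def norm_mult abs_mult norm_power)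
    define h where "h = (\<lambda>s. of_real (exp (- s\<^sup>2)) / csqrt (1 + u s))"
    define t where "t = (\<lambda>j s. of_real ((-1/2) gchoose j) * (\<i> * of_real (\<sigma> * e)) ^ j * of_real (exp (- s\<^sup>2) * s ^ (2 * j)))"
    have [measurable]: "h \<in> borel_measurable borel" unfolding h_def u_def by measurable
    have t_int: "has_bochner_integral lborel (t j) (of_real ((-1/2) gchoose j) * (\<i> * of_real (\<sigma> * e)) ^ j * of_real (M j))" for j
      unfolding t_def by (intro has_bochner_integral_mult_right has_bochner_integral_of_real mom)
    have ti: "integrable lborel (t j)" for j using t_int integrable.intros by blast
    have d: "norm (h s - (\<Sum>j<N. t j s)) \<le> C * e ^ N * (exp (- s\<^sup>2) * s ^ (2 * N))" for s
    proof -
      have "t j s = of_real (exp (- s\<^sup>2)) * (of_real ((-1/2) gchoose j) * u s ^ j)" for j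
        by (simp add: t_def u_def power_mult_distrib power_mult)
      then have "h s - (\<Sum>j<N. t j s) = of_real (exp (- s\<^sup>2)) * (1 / csqrt (1 + u s) - (\<Sum>j<N. of_real ((-1/2) gchoose j) * u s ^ j))"
        by (simp add: h_def sum_distrib_left right_diff_distrib)
      then have "norm (h s - (\<Sum>j<N. t j s)) = exp (- s\<^sup>2) * norm (1 / csqrt (1 + u s) - (\<Sum>j<N. of_real ((-1/2) gchoose j) * u s ^ j))"
        by (simp add: norm_mult)
      also have "\<dots> \<le> exp (- s\<^sup>2) * (C * norm (u s) ^ N)"
        by (intro mult_left_mono C(2)) (auto simp: u_def)
      also have "norm (u s) ^ N = e ^ N * s ^ (2 * N)" unfolding nu power_mult_distrib power_mult[symmetric] ..
      finally show ?thesis by (simp only: mult_ac)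
    qed
    have "integrable lborel (\<lambda>s. C * e ^ N * (exp (- s\<^sup>2) * s ^ (2 * N)))"
      using mom[of N] by (intro integrable_mult_right) (rule integrable.intros)
    then have di: "integrable lborel (\<lambda>s. h s - (\<Sum>j<N. t j s))"
    proof (rule Bochner_Integration.integrable_bound)
      show "(\<lambda>s. h s - (\<Sum>j<N. t j s)) \<in> borel_measurable lborel"
        by (intro borel_measurable_diff borel_measurable_sum borel_measurable_integrable[OF ti]) measurable
      show "AE s in lborel. norm (h s - (\<Sum>j<N. t j s)) \<le> norm (C * e ^ N * (exp (- s\<^sup>2) * s ^ (2 * N)))"
        unfolding real_norm_def by (intro AE_I2 order_trans[OF d abs_ge_self])
    qed
    have si: "integrable lborel (\<lambda>s. \<Sum>j<N. t j s)" using ti by auto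
    have hi: "integrable lborel h"
      using Bochner_Integration.integrable_add[OF di si] by simp
    have "(\<integral>s. h s - (\<Sum>j<N. t j s) \<partial>lborel) = bessel_phi \<sigma> e - (\<Sum>j<N. integral\<^sup>L lborel (t j))"
      using hi si ti by (simp add: bessel_phi_def h_def u_def)
    also have "(\<Sum>j<N. integral\<^sup>L lborel (t j)) = (\<Sum>j<N. fps_nth (bessel_phi_fps \<sigma>) j * of_real e ^ j)"
    proof (rule sum.cong[OF refl])
      fix j
      have "integral\<^sup>L lborel (t j) = of_real ((-1/2) gchoose j) * (\<i> * of_real (\<sigma> * e)) ^ j * of_real (M j)"
        by (rule has_bochner_integral_integral_eq[OF t_int])
      also have "\<dots> = of_real (((-1/2) gchoose j) * M j) * (\<i> * of_real \<sigma>) ^ j * of_real e ^ j"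
        by (simp add: power_mult_distrib)
      also have "((-1/2) gchoose j) * M j = sqrt pi * bessel_asym_coeff j"
        by (simp add: M_def bessel_asym_coeff_def)
      finally show "integral\<^sup>L lborel (t j) = fps_nth (bessel_phi_fps \<sigma>) j * of_real e ^ j"
        by (simp add: bessel_phi_fps_def)
    qed
    finally have eq: "bessel_phi \<sigma> e - (\<Sum>j<N. fps_nth (bessel_phi_fps \<sigma>) j * of_real e ^ j) = (\<integral>s. h s - (\<Sum>j<N. t j s) \<partial>lborel)" ..
    have "norm (\<integral>s. h s - (\<Sum>j<N. t j s) \<partial>lborel) \<le> (\<integral>s. norm (h s - (\<Sum>j<N. t j s)) \<partial>lborel)"
      by (rule integral_norm_bound)
    also have "\<dots> \<le> (\<integral>s. C * e ^ N * (exp (- s\<^sup>2) * s ^ (2 * N)) \<partial>lborel)"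
      using d mom[of N] by (intro integral_mono integrable_norm di integrable_mult_right) (auto intro: integrable.intros)
    also have "\<dots> = C * e ^ N * M N"
      using has_bochner_integral_integral_eq[OF mom[of N]] by simp
    finally show "norm (bessel_phi \<sigma> e - (\<Sum>j<N. fps_nth (bessel_phi_fps \<sigma>) j * of_real e ^ j)) \<le> C * M N * e ^ N"
      unfolding eq by (simp add: mult_ac)
  qed
qed

text \<open>The principal root is not multiplicative in general. Here q =
  \<open>csqrt (1 + \<i> * of_real v)\<close> satisfies (Re q)^2 - (Im q)^2 = 1, so |Im q| < Re q,
  and multiplication by 1 + i keeps it in the right half plane.\<close>

lemma csqrt_imag_mult:
  assumes "y > 0"
  shows "csqrt (2 * \<i> * of_real y * (1 + \<i> * of_real v)) = (1 + \<i>) * of_real (sqrt y) * csqrt (1 + \<i> * of_real v)"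
proof (rule csqrt_unique)
  define q where "q = csqrt (1 + \<i> * of_real v)"
  have q2: "q\<^sup>2 = 1 + \<i> * of_real v" by (simp add: q_def)
  have "((1 + \<i>) * of_real (sqrt y) * q)\<^sup>2 = (1 + \<i>)\<^sup>2 * (of_real (sqrt y))\<^sup>2 * q\<^sup>2"
    by (simp add: power_mult_distrib)
  also have "(1 + \<i>)\<^sup>2 = 2 * \<i>" by (simp add: power2_eq_square algebra_simps)
  also have "(complex_of_real (sqrt y))\<^sup>2 = of_real y" using assms by (simp flip: of_real_power)
  finally show "((1 + \<i>) * of_real (sqrt y) * csqrt (1 + \<i> * of_real v))\<^sup>2 = 2 * \<i> * of_real y * (1 + \<i> * of_real v)"
    by (simp add: q2 q_def)
  have "(Re q)\<^sup>2 - (Im q)\<^sup>2 = 1" using arg_cong[OF q2, of Re] by (simp add: power2_eq_square)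
  then have "\<bar>Im q\<bar>\<^sup>2 < (Re q)\<^sup>2" by simp
  moreover have "Re q \<ge> 0" unfolding q_def by (rule Re_csqrt)
  ultimately have "\<bar>Im q\<bar> < Re q" by (rule power2_less_imp_less)
  then have "0 < sqrt y * (Re q - Im q)" using assms by simp
  also have "sqrt y * (Re q - Im q) = Re ((1 + \<i>) * of_real (sqrt y) * q)" by (simp add: algebra_simps)
  finally show "0 < Re ((1 + \<i>) * of_real (sqrt y) * csqrt (1 + \<i> * of_real v)) \<or>
      Re ((1 + \<i>) * of_real (sqrt y) * csqrt (1 + \<i> * of_real v)) = 0 \<and>
      0 \<le> Im ((1 + \<i>) * of_real (sqrt y) * csqrt (1 + \<i> * of_real v))"
    unfolding q_def by blast
qed

lemma gauss_csqrt_imag: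
  assumes "e > 0"
  shows "gauss_csqrt \<sigma> (\<i> * of_real (1 / (2 * e))) = bessel_phi (- \<sigma>) e / ((1 + \<i>) * of_real (sqrt (1 / (2 * e))))"
proof -
  let ?y = "1 / (2 * e)"
  have eq: "gauss_csqrt_kernel \<sigma> (\<i> * of_real ?y) s = of_real (exp (- s\<^sup>2)) / csqrt (1 + \<i> * of_real (- \<sigma> * e * s\<^sup>2)) / ((1 + \<i>) * of_real (sqrt ?y))" for s
  proof -
    have "2 * (\<i> * of_real ?y) + of_real (\<sigma> * s\<^sup>2) = 2 * \<i> * of_real ?y * (1 + \<i> * of_real (- \<sigma> * e * s\<^sup>2))"
      using assms by (simp add: field_simps)
    also have "csqrt \<dots> = (1 + \<i>) * of_real (sqrt ?y) * csqrt (1 + \<i> * of_real (- \<sigma> * e * s\<^sup>2))"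
      using assms by (intro csqrt_imag_mult) simp
    finally have "csqrt (2 * (\<i> * of_real ?y) + of_real (\<sigma> * s\<^sup>2)) = \<dots>" .
    then show ?thesis unfolding gauss_csqrt_kernel_def by (metis divide_divide_eq_left mult.commute)
  qed
  show ?thesis
    unfolding gauss_csqrt_def bessel_phi_def eq by (rule Bochner_Integration.integral_divide_zero)
qed

text \<open>The prefactor -ie is 1/(2z) at z = i/(2e), the product of the two removed roots.\<close>

lemma bessel_hp_imag:
  assumes "e > 0"
  shows "bessel_hp (\<i> * of_real (1 / (2 * e))) = - \<i> * of_real e * (bessel_phi (- 1) e * bessel_phi 1 e)"
proof -
  define q where "q = complex_of_real (sqrt (1 / (2 * e)))"
  have q: "q * q = 1 / (2 * of_real e)"
  proof -
    have "q * q = of_real (sqrt (1 / (2 * e)) * sqrt (1 / (2 * e)))" by (simp only: q_def of_real_mult)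
    then show ?thesis using assms by simp
  qed
  have "bessel_hp (\<i> * of_real (1 / (2 * e))) = (bessel_phi (- 1) e * bessel_phi 1 e) / (((1 + \<i>) * (1 + \<i>)) * (q * q))"
    unfolding bessel_hp_def gauss_csqrt_imag[OF assms] q_def[symmetric] by simp
  also have "(1 + \<i>) * (1 + \<i>) = 2 * \<i>" by (simp add: algebra_simps)
  also have "(bessel_phi (- 1) e * bessel_phi 1 e) / (2 * \<i> * (q * q)) = - \<i> * of_real e * (bessel_phi (- 1) e * bessel_phi 1 e)"
    unfolding q using assms by (simp add: field_simps)
  finally show ?thesis .
qed

text \<open>Substitution of -ie for the variable, because 1/(2z) = -ie on the imaginary
  axis.\<close>

definition fps_twist :: "real fps \<Rightarrow> complex fps" where
  "fps_twist F = Abs_fps (\<lambda>n. (- \<i>) ^ n * of_real (fps_nth F n))"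

lemma fps_twist_mult: "fps_twist (F * G) = fps_twist F * fps_twist G"
proof (rule fps_ext)
  fix n
  have "fps_nth (fps_twist F * fps_twist G) n = (\<Sum>i=0..n. ((- \<i>) ^ i * (- \<i>) ^ (n - i)) * of_real (fps_nth F i * fps_nth G (n - i)))"
    by (simp add: fps_twist_def fps_mult_nth mult_ac)
  also have "\<dots> = (\<Sum>i=0..n. (- \<i>) ^ n * of_real (fps_nth F i * fps_nth G (n - i)))"
    by (intro sum.cong refl) (simp flip: power_add)
  finally show "fps_nth (fps_twist (F * G)) n = fps_nth (fps_twist F * fps_twist G) n"
    by (simp add: fps_twist_def fps_mult_nth sum_distrib_left)
qed

lemma fps_twist_power: "fps_twist (F ^ k) = fps_twist F ^ k"
proof (induction k)
  case 0
  have "fps_twist 1 = 1" by (rule fps_ext) (simp add: fps_twist_def)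
  then show ?case by simp
qed (simp add: fps_twist_mult)

lemma bessel_phi_fps_prod:
  "bessel_phi_fps (- 1) * bessel_phi_fps 1 = fps_const (of_real pi) * fps_twist bessel_prod_fps"
proof -
  have "bessel_phi_fps (- 1) = fps_const (of_real (sqrt pi)) * fps_twist bessel_fps"
    by (rule fps_ext) (simp add: bessel_phi_fps_def fps_twist_def bessel_fps_def)
  moreover have "bessel_phi_fps 1 = fps_const (of_real (sqrt pi)) * fps_twist bessel_fps_neg"
    by (rule fps_ext) (simp add: bessel_phi_fps_def fps_twist_def bessel_fps_neg_def mult_ac flip: power_mult_distrib)
  moreover have "fps_const (complex_of_real (sqrt pi)) * fps_const (of_real (sqrt pi)) = fps_const (of_real pi)"
    by (simp flip: of_real_mult)
  ultimately show ?thesis unfolding bessel_prod_fps_def fps_twist_mult by (metis mult.assoc mult.left_commute)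
qed

lemma bessel_phi_prod_power_asym:
  "asym_fps N (\<lambda>e. (bessel_phi (- 1) e * bessel_phi 1 e) ^ k)
    (fps_const (of_real (pi ^ k)) * fps_twist (bessel_prod_fps ^ k))"
proof -
  have "asym_fps N (\<lambda>e. (bessel_phi (- 1) e * bessel_phi 1 e) ^ k) ((bessel_phi_fps (- 1) * bessel_phi_fps 1) ^ k)"
    by (intro asym_fps_power asym_fps_mult bessel_phi_asym) auto
  also have "(bessel_phi_fps (- 1) * bessel_phi_fps 1) ^ k = fps_const (of_real (pi ^ k)) * fps_twist (bessel_prod_fps ^ k)"
    unfolding bessel_phi_fps_prod fps_twist_power by (simp add: power_mult_distrib fps_const_power)
  finally show ?thesis .
qed

section \<open>Bessel functions on the positive axis\<close>

lemma lborel_substitution: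
  fixes f g g' h :: "real \<Rightarrow> real"
  assumes [measurable]: "S \<in> sets borel" "h \<in> borel_measurable borel"
    and der: "\<And>x. x \<in> S \<Longrightarrow> (g has_field_derivative g' x) (at x within S)"
    and inj: "inj_on g S" and img: "g ` S = T"
    and f: "set_integrable lborel T f"
    and h: "\<And>x. x \<in> S \<Longrightarrow> \<bar>g' x\<bar> * f (g x) = h x"
  shows "(LBINT x:S. h x) = (LBINT x:T. f x)"
proof -
  have "f absolutely_integrable_on T"
    using f integrable_completion[OF borel_measurable_integrable, of lborel]
    unfolding set_integrable_def by blast
  then have *: "(\<lambda>x. \<bar>g' x\<bar> * f (g x)) absolutely_integrable_on S \<and>
      integral S (\<lambda>x. \<bar>g' x\<bar> * f (g x)) = integral T f"
    by (subst has_absolute_integral_change_of_variables_1'[OF _ der inj]) (auto simp: img)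
  have "h absolutely_integrable_on S"
    using * h by (subst set_integrable_cong[OF refl refl, of _ h "\<lambda>x. \<bar>g' x\<bar> * f (g x)"]) auto
  then have hS: "set_integrable lborel S h"
    unfolding set_integrable_def by (subst (asm) integrable_completion) auto
  have "integral S h = integral S (\<lambda>x. \<bar>g' x\<bar> * f (g x))"
    by (rule Henstock_Kurzweil_Integration.integral_cong) (simp add: h)
  then show ?thesis
    using * set_borel_integral_eq_integral(2)[OF hS] set_borel_integral_eq_integral(2)[OF f] by simp
qed

lemma integral_even_lborel:
  fixes f :: "real \<Rightarrow> real"
  assumes "integrable lborel f" "\<And>x. f (- x) = f x"
  shows "integral\<^sup>L lborel f = 2 * (LBINT x:{0<..}. f x)"
proof -
  have i: "integrable lborel (\<lambda>x. indicator {0..} x *\<^sub>R f x)"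
    by (intro integrable_mult_indicator assms) auto
  have "integral\<^sup>L lborel f = 2 *\<^sub>R (\<integral>x. indicator {0..} x *\<^sub>R f x \<partial>lborel)"
    using has_bochner_integral_even_function[OF has_bochner_integral_integrable[OF i] assms(2)]
    by (rule has_bochner_integral_integral_eq)
  also have "(\<integral>x. indicator {0..} x *\<^sub>R f x \<partial>lborel) = (LBINT x:{0<..}. f x)"
    unfolding set_lebesgue_integral_def
  proof (rule integral_cong_AE)
    show "AE x in lborel. indicator {0..} x *\<^sub>R f x = indicator {0<..} x *\<^sub>R f x"
      using AE_lborel_singleton[of 0] by eventually_elim (auto simp: indicator_def)
  qed (use assms(1) in auto)
  finally show ?thesis by simp
qed

lemma set_integrable_of_integrable:
  fixes f :: "real \<Rightarrow> real"
  assumes "integrable lborel f" "S \<in> sets borel"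
  shows "set_integrable lborel S f"
  unfolding set_integrable_def using assms by (intro integrable_mult_indicator) auto

lemma integrable_gauss_plus:
  assumes "t > 0"
  shows "integrable lborel (\<lambda>s. exp (- s\<^sup>2) / sqrt (2 * t + s\<^sup>2))"
proof (rule Bochner_Integration.integrable_bound)
  show "integrable lborel (\<lambda>s. exp (- s\<^sup>2) / sqrt (2 * t))"
    by (intro integrable_divide integrable_gaussian)
  have "exp (- s\<^sup>2) / sqrt (2 * t + s\<^sup>2) \<le> exp (- s\<^sup>2) / sqrt (2 * t)" for s
    using assms by (intro divide_left_mono real_sqrt_le_mono mult_pos_pos) (auto simp: add_pos_nonneg)
  then show "AE s in lborel. norm (exp (- s\<^sup>2) / sqrt (2 * t + s\<^sup>2)) \<le> norm (exp (- s\<^sup>2) / sqrt (2 * t))"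
    using assms by (intro AE_I2) (simp add: add_nonneg_nonneg)
qed measurable

text \<open>For s = sqrt(2t) sinh(u/2) one has t + s^2 = t cosh u, and the Jacobian is half the root
  in the denominator.\<close>

lemma integral_gauss_plus:
  assumes t: "t > 0"
  shows "(LBINT s:{0<..}. exp (- s\<^sup>2) / sqrt (2 * t + s\<^sup>2)) = exp t * bessel_K0 t / 2"
proof -
  define r where "r = sqrt (2 * t)"
  have r: "r > 0" "r\<^sup>2 = 2 * t" using t by (auto simp: r_def)
  have "(LBINT u:{0<..}. exp t / 2 * exp (- t * cosh u)) = (LBINT s:{0<..}. exp (- s\<^sup>2) / sqrt (2 * t + s\<^sup>2))"
  proof (rule lborel_substitution[where g = "\<lambda>u. r * sinh (u / 2)" and g' = "\<lambda>u. r * cosh (u / 2) / 2"])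
    show "((\<lambda>u. r * sinh (u / 2)) has_field_derivative r * cosh (u / 2) / 2) (at u within {0<..})" for u
      by (auto intro!: derivative_eq_intros)
    show "inj_on (\<lambda>u. r * sinh (u / 2)) {0<..}" using r by (auto simp: inj_on_def)
    show "(\<lambda>u. r * sinh (u / 2)) ` {0<..} = {0<..}"
    proof (intro equalityI subsetI)
      fix s :: real assume "s \<in> {0<..}"
      then have "s = r * sinh (2 * arsinh (s / r) / 2)" "2 * arsinh (s / r) > 0"
        using r by (auto simp: arsinh_real_pos_iff)
      then show "s \<in> (\<lambda>u. r * sinh (u / 2)) ` {0<..}" by blast
    qed (use r in auto)
    show "set_integrable lborel {0<..} (\<lambda>s. exp (- s\<^sup>2) / sqrt (2 * t + s\<^sup>2))"
      by (rule set_integrable_of_integrable[OF integrable_gauss_plus[OF t]]) auto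
    fix u :: real
    have c: "cosh u = 1 + 2 * (sinh (u / 2))\<^sup>2"
      using cosh_double[of "u / 2"] cosh_square_eq[of "u / 2"] by simp
    have sq: "2 * t + (r * sinh (u / 2))\<^sup>2 = (r * cosh (u / 2))\<^sup>2"
      using r by (simp add: power_mult_distrib cosh_square_eq algebra_simps)
    have "exp (- (r * sinh (u / 2))\<^sup>2) = exp t * exp (- t * cosh u)"
      using r by (simp add: c power_mult_distrib mult_exp_exp algebra_simps)
    then show "\<bar>r * cosh (u / 2) / 2\<bar> * (exp (- (r * sinh (u / 2))\<^sup>2) / sqrt (2 * t + (r * sinh (u / 2))\<^sup>2)) = exp t / 2 * exp (- t * cosh u)"
      unfolding sq using r by (simp add: abs_mult)
  qed (auto simp: cosh_def)
  then show ?thesis by (simp add: bessel_K0_def)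
qed

text \<open>Beyond the singularity s = sqrt(2t) cosh(u/2) gives s^2 - t = t cosh u, again the
  integrand of K0.\<close>

lemma integral_sing_gauss_outer:
  assumes t: "t > 0"
  shows "(LBINT s:{sqrt (2 * t)<..}. sing_gauss t s) = exp (- t) * bessel_K0 t / 2"
proof -
  define r where "r = sqrt (2 * t)"
  have r: "r > 0" "r\<^sup>2 = 2 * t" using t by (auto simp: r_def)
  have "(LBINT u:{0<..}. exp (- t) / 2 * exp (- t * cosh u)) = (LBINT s:{r<..}. sing_gauss t s)"
  proof (rule lborel_substitution[where g = "\<lambda>u. r * cosh (u / 2)" and g' = "\<lambda>u. r * sinh (u / 2) / 2"])
    show "((\<lambda>u. r * cosh (u / 2)) has_field_derivative r * sinh (u / 2) / 2) (at u within {0<..})" for u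
      by (auto intro!: derivative_eq_intros)
    show "inj_on (\<lambda>u. r * cosh (u / 2)) {0<..}" using r by (auto simp: inj_on_def)
    show "(\<lambda>u. r * cosh (u / 2)) ` {0<..} = {r<..}"
    proof (intro equalityI subsetI)
      fix s :: real assume "s \<in> {r<..}"
      then have "s / r > 1" using r by simp
      then have "s = r * cosh (2 * arcosh (s / r) / 2)" "2 * arcosh (s / r) > 0"
        using r by (auto simp: arcosh_real_gt_1_iff)
      then show "s \<in> (\<lambda>u. r * cosh (u / 2)) ` {0<..}" by blast
    next
      fix s assume "s \<in> (\<lambda>u. r * cosh (u / 2)) ` {0<..}"
      then show "s \<in> {r<..}" using r cosh_real_nonneg_less_iff[of 0] by auto
    qed
    show "set_integrable lborel {r<..} (sing_gauss t)"
      by (rule set_integrable_of_integrable[OF integrable_sing_gauss[OF t]]) auto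
    fix u :: real assume u: "u \<in> {0<..}"
    have c: "cosh u = 2 * (cosh (u / 2))\<^sup>2 - 1"
      using cosh_double_cosh[of "u / 2"] by simp
    have sq: "\<bar>2 * t - (r * cosh (u / 2))\<^sup>2\<bar> = (r * sinh (u / 2))\<^sup>2"
    proof -
      have "2 * t - (r * cosh (u / 2))\<^sup>2 = - (r * sinh (u / 2))\<^sup>2"
        using r by (simp add: power_mult_distrib cosh_square_eq algebra_simps)
      then show ?thesis by simp
    qed
    have "exp (- (r * cosh (u / 2))\<^sup>2) = exp (- t) * exp (- t * cosh u)"
      using r by (simp add: c power_mult_distrib mult_exp_exp algebra_simps)
    then show "\<bar>r * sinh (u / 2) / 2\<bar> * sing_gauss t (r * cosh (u / 2)) = exp (- t) / 2 * exp (- t * cosh u)"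
      unfolding sing_gauss_def sq using r u by (simp add: abs_mult)
  qed (auto simp: cosh_def)
  then show ?thesis by (simp add: bessel_K0_def r_def)
qed

text \<open>Between 0 and the singularity s = sqrt(2t) sin(u/2) gives t - s^2 = t cos u, the
  integrand of I0.\<close>

lemma integral_sing_gauss_inner:
  assumes t: "t > 0"
  shows "(LBINT s:{0<..<sqrt (2 * t)}. sing_gauss t s) = exp (- t) * (pi * bessel_I0 t) / 2"
proof -
  define r where "r = sqrt (2 * t)"
  have r: "r > 0" "r\<^sup>2 = 2 * t" using t by (auto simp: r_def)
  have "(LBINT u:{0<..<pi}. exp (- t) / 2 * exp (t * cos u)) = (LBINT s:{0<..<r}. sing_gauss t s)"
  proof (rule lborel_substitution[where g = "\<lambda>u. r * sin (u / 2)" and g' = "\<lambda>u. r * cos (u / 2) / 2"])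
    show "((\<lambda>u. r * sin (u / 2)) has_field_derivative r * cos (u / 2) / 2) (at u within {0<..<pi})" for u
      by (auto intro!: derivative_eq_intros)
    show "inj_on (\<lambda>u. r * sin (u / 2)) {0<..<pi}"
    proof (rule inj_onI)
      fix u v assume "u \<in> {0<..<pi}" "v \<in> {0<..<pi}" "r * sin (u / 2) = r * sin (v / 2)"
      then have "u / 2 = v / 2" using r sin_inj_pi[of "u / 2" "v / 2"] by auto
      then show "u = v" by simp
    qed
    show "(\<lambda>u. r * sin (u / 2)) ` {0<..<pi} = {0<..<r}"
    proof (intro equalityI subsetI)
      fix s :: real assume "s \<in> {0<..<r}"
      then have s: "0 < s / r" "s / r < 1" using r by simp_all
      then have "s = r * sin (2 * arcsin (s / r) / 2)" using r by simp
      moreover have "arcsin (s / r) > arcsin 0" "arcsin (s / r) < arcsin 1"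
        using s arcsin_less_arcsin[of 0 "s / r"] arcsin_less_arcsin[of "s / r" 1] by simp_all
      then have "2 * arcsin (s / r) \<in> {0<..<pi}" by simp
      ultimately show "s \<in> (\<lambda>u. r * sin (u / 2)) ` {0<..<pi}" by blast
    next
      fix s assume "s \<in> (\<lambda>u. r * sin (u / 2)) ` {0<..<pi}"
      then obtain u where u: "0 < u" "u < pi" "s = r * sin (u / 2)" by auto
      have "0 < sin (u / 2)" using u by (intro sin_gt_zero) auto
      moreover have "sin (u / 2) < sin (pi / 2)" using u by (intro sin_monotone_2pi) auto
      ultimately show "s \<in> {0<..<r}" using r u by simp
    qed
    show "set_integrable lborel {0<..<r} (sing_gauss t)"
      by (rule set_integrable_of_integrable[OF integrable_sing_gauss[OF t]]) auto
    fix u :: real assume u: "u \<in> {0<..<pi}"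
    have cu: "cos (u / 2) > 0" using u by (intro cos_gt_zero) auto
    have c: "cos u = 1 - 2 * (sin (u / 2))\<^sup>2"
      using cos_double_sin[of "u / 2"] by simp
    have sq: "\<bar>2 * t - (r * sin (u / 2))\<^sup>2\<bar> = (r * cos (u / 2))\<^sup>2"
    proof -
      have "2 * t - (r * sin (u / 2))\<^sup>2 = (r * cos (u / 2))\<^sup>2"
        using r by (simp add: power_mult_distrib cos_squared_eq algebra_simps)
      then show ?thesis by simp
    qed
    have "exp (- (r * sin (u / 2))\<^sup>2) = exp (- t) * exp (t * cos u)"
      using r by (simp add: c power_mult_distrib mult_exp_exp algebra_simps)
    then show "\<bar>r * cos (u / 2) / 2\<bar> * sing_gauss t (r * sin (u / 2)) = exp (- t) / 2 * exp (t * cos u)"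
      unfolding sing_gauss_def sq using r cu by (simp add: abs_mult)
  qed auto
  also have "(LBINT u:{0<..<pi}. exp (- t) / 2 * exp (t * cos u)) = exp (- t) / 2 * (LBINT u:{0<..<pi}. exp (t * cos u))"
    by simp
  also have "(LBINT u:{0<..<pi}. exp (t * cos u)) = (LBINT u:{0..pi}. exp (t * cos u))"
    unfolding set_lebesgue_integral_def
  proof (rule integral_cong_AE)
    show "AE u in lborel. indicator {0<..<pi} u *\<^sub>R exp (t * cos u) = indicator {0..pi} u *\<^sub>R exp (t * cos u)"
      using AE_lborel_singleton[of 0] AE_lborel_singleton[of pi] by eventually_elim (auto simp: indicator_def)
  qed auto
  finally show ?thesis by (simp add: bessel_I0_def r_def)
qed

lemma gauss_csqrt_1_of_real:
  assumes t: "t > 0"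
  shows "gauss_csqrt 1 (of_real t) = of_real (exp t * bessel_K0 t)"
proof -
  have eq: "gauss_csqrt_kernel 1 (of_real t) = (\<lambda>s. of_real (exp (- s\<^sup>2) / sqrt (2 * t + s\<^sup>2)))"
  proof
    fix s
    have "csqrt (2 * of_real t + of_real (1 * s\<^sup>2)) = csqrt (of_real (2 * t + s\<^sup>2))" by simp
    also have "\<dots> = of_real (sqrt (2 * t + s\<^sup>2))" using t by (intro csqrt_of_real) simp
    finally show "gauss_csqrt_kernel 1 (of_real t) s = of_real (exp (- s\<^sup>2) / sqrt (2 * t + s\<^sup>2))"
      by (simp add: gauss_csqrt_kernel_def)
  qed
  have "gauss_csqrt 1 (of_real t) = of_real (\<integral>s. exp (- s\<^sup>2) / sqrt (2 * t + s\<^sup>2) \<partial>lborel)"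
    unfolding gauss_csqrt_def eq by (rule integral_complex_of_real)
  also have "(\<integral>s. exp (- s\<^sup>2) / sqrt (2 * t + s\<^sup>2) \<partial>lborel) = exp t * bessel_K0 t"
    using integral_even_lborel[OF integrable_gauss_plus[OF t]] integral_gauss_plus[OF t] by simp
  finally show ?thesis .
qed

text \<open>The connection formula K0(t e^(-i pi)) = K0(t) + i pi I0(t), divided by i. It comes from
  splitting the line at |s| = sqrt(2t): inside, the root is real and the integral is an I0; outside,
  the root is i times a positive number and the integral is a K0.\<close>

lemma gauss_csqrt_minus_1_of_real:
  assumes t: "t > 0"
  shows "gauss_csqrt (- 1) (of_real t) = of_real (exp (- t)) * (of_real (pi * bessel_I0 t) - \<i> * of_real (bessel_K0 t))"
proof -
  define r where "r = sqrt (2 * t)"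
  have r: "r > 0" "r\<^sup>2 = 2 * t" using t by (auto simp: r_def)
  note sg = integrable_sing_gauss[OF t]
  define I where "I = (\<lambda>s. indicator {- r<..<r} s * sing_gauss t s)"
  define O' where "O' = (\<lambda>s. indicator (- {- r..r}) s * sing_gauss t s)"
  have I: "integrable lborel I" and O': "integrable lborel O'"
    unfolding I_def O'_def using integrable_mult_indicator[OF _ sg, of "{- r<..<r}"]
      integrable_mult_indicator[OF _ sg, of "- {- r..r}"] by simp_all
  have even: "sing_gauss t (- s) = sing_gauss t s" for s by (simp add: sing_gauss_def)
  have "AE s in lborel. gauss_csqrt_kernel (- 1) (of_real t) s = of_real (I s) - \<i> * of_real (O' s)"
    using AE_lborel_square_neq[of "2 * t"]
  proof eventually_elim
    case (elim s)
    define d where "d = 2 * t - s\<^sup>2"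
    have k: "gauss_csqrt_kernel (- 1) (of_real t) s = of_real (exp (- s\<^sup>2)) / csqrt (of_real d)"
      by (simp add: gauss_csqrt_kernel_def d_def)
    show ?case
    proof (cases "d > 0")
      case True
      then have "s\<^sup>2 < r\<^sup>2" using r by (simp add: d_def)
      then have "\<bar>s\<bar> < r" using r abs_le_square_iff[of r s] by auto
      then have "I s = sing_gauss t s" "O' s = 0" by (auto simp: I_def O'_def indicator_def)
      then show ?thesis unfolding k csqrt_of_real' using True by (simp add: sing_gauss_def d_def)
    next
      case False
      then have d: "d < 0" using elim by (simp add: d_def)
      then have "s\<^sup>2 > r\<^sup>2" using r by (simp add: d_def)
      then have "\<bar>s\<bar> > r" using r abs_le_square_iff[of s r] by auto
      then have "I s = 0" "O' s = sing_gauss t s" by (auto simp: I_def O'_def indicator_def)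
      moreover have "a / (b * \<i>) = - \<i> * (a / b)" for a b :: complex by (simp add: divide_inverse)
      ultimately show ?thesis unfolding k csqrt_of_real' using d by (simp add: sing_gauss_def d_def)
    qed
  qed
  then have "gauss_csqrt (- 1) (of_real t) = (\<integral>s. of_real (I s) - \<i> * of_real (O' s) \<partial>lborel)"
    unfolding gauss_csqrt_def using I O'
    by (intro integral_cong_AE) (auto simp: borel_measurable_integrable)
  also have "\<dots> = of_real (integral\<^sup>L lborel I) - \<i> * of_real (integral\<^sup>L lborel O')"
    using I O' by (subst Bochner_Integration.integral_diff) auto
  also have "integral\<^sup>L lborel I = 2 * (LBINT s:{0<..}. I s)"
    using I by (rule integral_even_lborel) (auto simp: I_def even indicator_def)
  also have "(LBINT s:{0<..}. I s) = (LBINT s:{0<..<r}. sing_gauss t s)"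
    unfolding set_lebesgue_integral_def using r
    by (intro Bochner_Integration.integral_cong) (auto simp: I_def indicator_def)
  also have "integral\<^sup>L lborel O' = 2 * (LBINT s:{0<..}. O' s)"
    using O' by (rule integral_even_lborel) (auto simp: O'_def even indicator_def)
  also have "(LBINT s:{0<..}. O' s) = (LBINT s:{r<..}. sing_gauss t s)"
    unfolding set_lebesgue_integral_def using r
    by (intro Bochner_Integration.integral_cong) (auto simp: O'_def indicator_def)
  finally show ?thesis
    unfolding r_def integral_sing_gauss_inner[OF t] integral_sing_gauss_outer[OF t]
    by (simp add: algebra_simps)
qed

lemma bessel_hp_of_real:
  assumes "t > 0"
  shows "bessel_hp (of_real t) = of_real (bessel_K0 t) * (of_real (pi * bessel_I0 t) - \<i> * of_real (bessel_K0 t))"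
proof -
  have "complex_of_real (exp t) * of_real (exp (- t)) = 1"
    by (simp flip: of_real_mult add: mult_exp_exp)
  then show ?thesis
    unfolding bessel_hp_def gauss_csqrt_1_of_real[OF assms] gauss_csqrt_minus_1_of_real[OF assms] of_real_mult
    by (metis (no_types, lifting) mult.assoc mult.left_commute mult_1)
qed

section \<open>Moments\<close>

lemma bessel_K0_measurable [measurable]: "bessel_K0 \<in> borel_measurable borel"
  unfolding bessel_K0_def set_lebesgue_integral_def cosh_def by measurable

lemma bessel_I0_measurable [measurable]: "bessel_I0 \<in> borel_measurable borel"
  unfolding bessel_I0_def set_lebesgue_integral_def by measurable

lemma power_le_fact_exp:
  fixes x :: real
  assumes "x \<ge> 0"
  shows "x ^ n \<le> fact n * exp x"
proof -
  have "(\<Sum>k\<in>{n}. inverse (fact k) * x ^ k) \<le> (\<Sum>k. inverse (fact k) * x ^ k)"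
    using assms summable_exp[of x] by (intro sum_le_suminf) auto
  then have "x ^ n / fact n \<le> exp x" by (simp add: exp_def divide_inverse mult.commute scaleR_conv_of_real)
  then show ?thesis by (simp add: field_simps)
qed

text \<open>The bounds |K0| \<le> e^(-t) N and |pi I0| \<le> e^t N, with N =
  \<open>sing_gauss_int t\<close>, leave e^(-2rt) N^(4m), because K0 occurs 2r times more often than
  I0. As r \<ge> 1, the exponential absorbs any power of 2t, and N^(4m) has an integrable
  majorant.\<close>

lemma bessel_product_integrable:
  assumes m: "m \<ge> 1" and r: "1 \<le> r" "r \<le> 2 * m"
  shows "set_integrable lborel {0<..}
    (\<lambda>t. (pi * bessel_I0 t) ^ (2 * m - r) * bessel_K0 t ^ (2 * m + r) * (2 * t) ^ M)"
proof -
  obtain C where C: "C \<ge> 0" "\<And>x. x > 0 \<Longrightarrow> sing_gauss_int x ^ (4 * m) \<le> C * decay_majorant x"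
    using sing_gauss_int_power_le[OF m] by blast
  have le: "\<bar>(pi * bessel_I0 t) ^ (2 * m - r) * bessel_K0 t ^ (2 * m + r) * (2 * t) ^ M\<bar> \<le> fact M * (C * decay_majorant t)"
    if t: "t > 0" for t
  proof -
    let ?N = "sing_gauss_int t"
    have "norm (gauss_csqrt 1 (of_real t)) \<le> ?N" using norm_gauss_csqrt_le[of 1 "of_real t"] t by simp
    then have "exp t * \<bar>bessel_K0 t\<bar> \<le> ?N" unfolding gauss_csqrt_1_of_real[OF t] by (simp add: norm_mult)
    then have K: "\<bar>bessel_K0 t\<bar> \<le> exp (- t) * ?N" by (simp add: exp_minus field_simps)
    let ?w = "of_real (pi * bessel_I0 t) - \<i> * of_real (bessel_K0 t)"
    have "norm (gauss_csqrt (- 1) (of_real t)) \<le> ?N" using norm_gauss_csqrt_le[of "- 1" "of_real t"] t by simp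
    then have "exp (- t) * norm ?w \<le> ?N" unfolding gauss_csqrt_minus_1_of_real[OF t] by (simp add: norm_mult)
    moreover have "\<bar>pi * bessel_I0 t\<bar> \<le> norm ?w" using abs_Re_le_cmod[of ?w] by simp
    ultimately have "exp (- t) * \<bar>pi * bessel_I0 t\<bar> \<le> ?N" by (smt (verit) exp_ge_zero mult_left_mono)
    then have I: "\<bar>pi * bessel_I0 t\<bar> \<le> exp t * ?N" by (simp add: exp_minus field_simps)
    have "\<bar>(pi * bessel_I0 t) ^ (2 * m - r) * bessel_K0 t ^ (2 * m + r)\<bar>
        = \<bar>pi * bessel_I0 t\<bar> ^ (2 * m - r) * \<bar>bessel_K0 t\<bar> ^ (2 * m + r)"
      by (simp only: abs_mult power_abs)
    also have "\<dots> \<le> (exp t * ?N) ^ (2 * m - r) * (exp (- t) * ?N) ^ (2 * m + r)"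
      by (intro mult_mono power_mono I K) (auto intro!: zero_le_power mult_nonneg_nonneg sing_gauss_int_nonneg)
    also have "\<dots> = (exp t ^ (2 * m - r) * exp (- t) ^ (2 * m + r)) * ?N ^ ((2 * m - r) + (2 * m + r))"
      by (simp only: power_mult_distrib power_add mult_ac)
    also have "(2 * m - r) + (2 * m + r) = 4 * m" using r by simp
    also have "exp t ^ (2 * m - r) * exp (- t) ^ (2 * m + r) = exp (- 2 * real r * t)"
      using r by (simp add: exp_of_nat_mult[symmetric] mult_exp_exp of_nat_diff algebra_simps)
    also have "exp (- 2 * real r * t) * ?N ^ (4 * m) \<le> exp (- 2 * t) * (C * decay_majorant t)"
      using r t C(2)[OF t] sing_gauss_int_nonneg[of t] by (intro mult_mono) auto
    finally have "\<bar>(pi * bessel_I0 t) ^ (2 * m - r) * bessel_K0 t ^ (2 * m + r)\<bar> \<le> exp (- 2 * t) * (C * decay_majorant t)" .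
    then have "\<bar>(pi * bessel_I0 t) ^ (2 * m - r) * bessel_K0 t ^ (2 * m + r)\<bar> * (2 * t) ^ M
        \<le> exp (- 2 * t) * (C * decay_majorant t) * (fact M * exp (2 * t))"
      using t C(1) by (intro mult_mono power_le_fact_exp) (auto simp: decay_majorant_nonneg)
    also have "\<dots> = fact M * (C * decay_majorant t) * (exp (- 2 * t) * exp (2 * t))" by (simp only: mult_ac)
    also have "exp (- 2 * t) * exp (2 * t) = 1" by (simp add: mult_exp_exp)
    finally show ?thesis using t by (simp add: abs_mult)
  qed
  show ?thesis
    unfolding set_integrable_def
  proof (rule Bochner_Integration.integrable_bound)
    show "integrable lborel (\<lambda>t. fact M * (C * decay_majorant t))"
      by (intro integrable_mult_right integrable_decay_majorant)
    show "AE t in lborel. norm (indicator {0<..} t *\<^sub>R ((pi * bessel_I0 t) ^ (2 * m - r) * bessel_K0 t ^ (2 * m + r) * (2 * t) ^ M))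
        \<le> norm (fact M * (C * decay_majorant t))"
    proof (rule AE_I2)
      fix t
      show "norm (indicator {0<..} t *\<^sub>R ((pi * bessel_I0 t) ^ (2 * m - r) * bessel_K0 t ^ (2 * m + r) * (2 * t) ^ M))
        \<le> norm (fact M * (C * decay_majorant t))"
      proof (cases "t > 0")
        case True
        then show ?thesis using order_trans[OF le[OF True] abs_ge_self] by simp
      qed simp
    qed
  qed measurable
qed

lemma sum_atMost_double_odd:
  fixes f :: "nat \<Rightarrow> real"
  assumes "\<And>i. f (2 * i) = 0"
  shows "(\<Sum>r\<le>2 * m. f r) = (\<Sum>j=1..m. f (2 * j - 1))"
proof (induction m)
  case 0
  show ?case using assms[of 0] by simp
next
  case (Suc m)
  have "(\<Sum>r\<le>2 * Suc m. f r) = (\<Sum>r\<le>2 * m. f r) + f (2 * m + 1) + f (2 * Suc m)" by simp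
  then show ?case using Suc assms[of "Suc m"] by simp
qed

text \<open>In the binomial expansion even powers of -i are real and drop out; for the odd ones
  Im((-i)^(2j-1)) = -(-1)^(j-1), which is the source of the overall minus sign.\<close>

lemma Im_bessel_power:
  fixes l k :: real
  shows "Im ((of_real k * (of_real l - \<i> * of_real k)) ^ (2 * m))
    = - (\<Sum>j=1..m. (- 1) ^ (j - 1) * real (2 * m choose (2 * j - 1)) * (l ^ (2 * m - (2 * j - 1)) * k ^ (2 * m + (2 * j - 1))))"
proof -
  have Imr: "Im (of_real a * z) = a * Im z" for a z by simp
  define f where "f = (\<lambda>r. k ^ (2 * m) * (real (2 * m choose r) * Im ((- \<i>) ^ r) * (k ^ r * l ^ (2 * m - r))))"
  have "(of_real l - \<i> * of_real k) ^ (2 * m) = (- \<i> * of_real k + of_real l) ^ (2 * m)" by simp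
  also have "\<dots> = (\<Sum>r\<le>2 * m. of_nat (2 * m choose r) * (- \<i> * of_real k) ^ r * of_real l ^ (2 * m - r))"
    by (rule binomial_ring)
  also have "\<dots> = (\<Sum>r\<le>2 * m. of_real (real (2 * m choose r) * (k ^ r * l ^ (2 * m - r))) * (- \<i>) ^ r)"
    by (intro sum.cong refl) (simp only: power_mult_distrib of_real_mult of_real_power of_real_of_nat_eq mult_ac)
  finally have e: "(of_real l - \<i> * of_real k) ^ (2 * m) = \<dots>" .
  have "Im ((of_real k * (of_real l - \<i> * of_real k)) ^ (2 * m))
      = Im (of_real (k ^ (2 * m)) * (\<Sum>r\<le>2 * m. of_real (real (2 * m choose r) * (k ^ r * l ^ (2 * m - r))) * (- \<i>) ^ r))"
    unfolding power_mult_distrib e of_real_power ..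
  also have "\<dots> = (\<Sum>r\<le>2 * m. f r)"
    unfolding Imr Im_sum sum_distrib_left f_def by (simp only: mult_ac)
  also have "\<dots> = (\<Sum>j=1..m. f (2 * j - 1))"
    by (rule sum_atMost_double_odd) (simp add: f_def power_mult flip: of_real_power)
  also have "\<dots> = (\<Sum>j=1..m. - ((- 1) ^ (j - 1) * real (2 * m choose (2 * j - 1)) * (l ^ (2 * m - (2 * j - 1)) * k ^ (2 * m + (2 * j - 1)))))"
  proof (rule sum.cong[OF refl])
    fix j assume "j \<in> {1..m}"
    then obtain i where j: "j = Suc i" by (metis atLeastAtMost_iff One_nat_def Suc_le_D)
    have "(- \<i>) ^ (2 * j - 1) = (- \<i>) * ((- \<i>)\<^sup>2) ^ i" by (simp add: j power_mult)
    also have "(- \<i>)\<^sup>2 = - 1" by simp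
    finally have "Im ((- \<i>) ^ (2 * j - 1)) = - ((- 1) ^ (j - 1))" by (cases "even i") (simp_all add: j)
    then show "f (2 * j - 1) = - ((- 1) ^ (j - 1) * real (2 * m choose (2 * j - 1)) * (l ^ (2 * m - (2 * j - 1)) * k ^ (2 * m + (2 * j - 1))))"
      unfolding f_def power_add by (simp only: mult_minus_left mult_minus_right mult_ac)
  qed
  finally show ?thesis by (simp only: sum_negf)
qed

definition bessel_moment :: "nat \<Rightarrow> nat \<Rightarrow> real" where
  "bessel_moment m M = (\<integral>x. indicator {0..} x * (Im (bessel_hp (of_real x) ^ (2 * m)) * (2 * x) ^ M) \<partial>lborel)"

lemma bessel_moment_integrable_eq:
  assumes m: "m \<ge> 1"
  shows "integrable lborel (\<lambda>x. indicator {0..} x * (Im (bessel_hp (of_real x) ^ (2 * m)) * (2 * x) ^ M))" (is "integrable _ ?f")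
    and "bessel_moment m M = - (\<Sum>j=1..m. (- 1) ^ (j - 1) * real (2 * m choose (2 * j - 1)) *
      (LBINT t:{0<..}. (pi * bessel_I0 t) ^ (2 * m - (2 * j - 1)) * bessel_K0 t ^ (2 * m + (2 * j - 1)) * (2 * t) ^ M))"
proof -
  define T where "T = (\<lambda>j t. (pi * bessel_I0 t) ^ (2 * m - (2 * j - 1)) * bessel_K0 t ^ (2 * m + (2 * j - 1)) * (2 * t) ^ M)"
  define c where "c = (\<lambda>j. (- 1) ^ (j - 1) * real (2 * m choose (2 * j - 1)))"
  define G where "G = (\<lambda>t. - (\<Sum>j=1..m. c j * (indicator {0<..} t *\<^sub>R T j t)))"
  have Ti: "integrable lborel (\<lambda>t. indicator {0<..} t *\<^sub>R T j t)" if "j \<in> {1..m}" for j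
    using bessel_product_integrable[OF m, of "2 * j - 1" M] that unfolding T_def set_integrable_def by auto
  have Gi: "integrable lborel G"
    unfolding G_def using Ti by (intro integrable_minus Bochner_Integration.integrable_sum integrable_mult_right) auto
  \<comment> \<open>The explicit form of \<open>bessel_hp\<close> is available for positive
    arguments only; the point 0 is a null set.\<close>
  have eq: "?f t = G t" if "t \<noteq> 0" for t
  proof (cases "t > 0")
    case True
    have "Im (bessel_hp (of_real t) ^ (2 * m)) * (2 * t) ^ M = - (\<Sum>j=1..m. c j * T j t)"
      unfolding bessel_hp_of_real[OF True] Im_bessel_power T_def c_def mult_minus_left sum_distrib_right
      by (simp only: mult.assoc)
    then show ?thesis using True by (simp add: G_def)
  next
    case False
    then show ?thesis using that by (simp add: G_def)
  qed
  have ae: "AE t in lborel. G t = ?f t"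
    using AE_lborel_singleton[of 0] by eventually_elim (rule eq[symmetric])
  have [measurable]: "?f \<in> borel_measurable lborel" by measurable
  show "integrable lborel ?f"
    using Gi ae by (subst integrable_cong_AE[of _ _ G]) (auto intro: borel_measurable_integrable)
  have "bessel_moment m M = integral\<^sup>L lborel G"
    unfolding bessel_moment_def using Gi ae by (intro integral_cong_AE) (auto intro: borel_measurable_integrable)
  also have "\<dots> = - (\<Sum>j=1..m. c j * (LBINT t:{0<..}. T j t))"
    unfolding G_def set_lebesgue_integral_def using Ti
    by (subst Bochner_Integration.integral_minus, subst Bochner_Integration.integral_sum) auto
  finally show "bessel_moment m M = - (\<Sum>j=1..m. (- 1) ^ (j - 1) * real (2 * m choose (2 * j - 1)) *
      (LBINT t:{0<..}. (pi * bessel_I0 t) ^ (2 * m - (2 * j - 1)) * bessel_K0 t ^ (2 * m + (2 * j - 1)) * (2 * t) ^ M))"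
    unfolding c_def T_def .
qed

section \<open>Expansion of the Stieltjes integral and comparison of coefficients\<close>

definition bessel_stieltjes :: "nat \<Rightarrow> real \<Rightarrow> real" where
  "bessel_stieltjes m e = (\<integral>x. indicator {0..} x * (Im (bessel_hp (of_real x) ^ (2 * m)) * (2 * x / (1 + (2 * e * x)\<^sup>2))) \<partial>lborel)"

text \<open>Read off from 2x / (1 + (2ex)^2) = 2x - e^2 (2x)^3 + ..., the Stieltjes kernel for y =
  1/(2e) up to the factor 2e^2. The normalization makes the moments in powers of 2x the
  coefficients, and only odd moments occur.\<close>

definition bessel_stieltjes_fps :: "nat \<Rightarrow> complex fps" where
  "bessel_stieltjes_fps m = Abs_fps (\<lambda>n. if even n then of_real ((- 1) ^ (n div 2) * bessel_moment m (n + 1)) else 0)"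

text \<open>The remainder of the finite geometric sum is bounded for every v \<ge> 0, beyond the
  radius of convergence as well; this permits integration over the whole half line.\<close>

lemma inverse_1_plus_truncation:
  fixes v :: real
  assumes "v \<ge> 0"
  shows "\<bar>1 / (1 + v) - (\<Sum>k<K. (- v) ^ k)\<bar> \<le> v ^ K"
proof -
  have "1 - (- v) ^ K = (1 + v) * (\<Sum>k<K. (- v) ^ k)"
    using one_diff_power_eq[of "- v" K] by simp
  then have "1 / (1 + v) - (\<Sum>k<K. (- v) ^ k) = (- v) ^ K / (1 + v)"
    using assms by (simp add: field_simps)
  then have "\<bar>1 / (1 + v) - (\<Sum>k<K. (- v) ^ k)\<bar> = v ^ K / (1 + v)"
    using assms by (simp add: power_abs abs_divide)
  also have "\<dots> \<le> v ^ K / 1" using assms by (intro divide_left_mono) auto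
  finally show ?thesis by simp
qed

lemma bessel_stieltjes_asym:
  assumes m: "m \<ge> 1"
  shows "asym_fps N (\<lambda>e. of_real (bessel_stieltjes m e)) (bessel_stieltjes_fps m)"
proof -
  define q where "q = (\<lambda>x. indicator {0..} x * Im (bessel_hp (of_real x) ^ (2 * m)))"
  have [measurable]: "q \<in> borel_measurable borel" unfolding q_def by measurable
  have q_int: "integrable lborel (\<lambda>x. q x * (2 * x) ^ M)" for M
    using bessel_moment_integrable_eq(1)[OF m, of M] by (simp add: q_def mult.assoc)
  have q_mom: "bessel_moment m M = (\<integral>x. q x * (2 * x) ^ M \<partial>lborel)" for M
    by (simp add: bessel_moment_def q_def mult.assoc)
  have q0: "q x = 0" if "x < 0" for x using that by (simp add: q_def)
  \<comment> \<open>Truncation after N terms of the geometric sum gives an expansion of even order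
    2N; order N follows by monotonicity.\<close>
  have "asym_fps (2 * N) (\<lambda>e. of_real (bessel_stieltjes m e)) (bessel_stieltjes_fps m)"
  proof (rule asym_fps_I[where C = "\<integral>x. \<bar>q x * (2 * x) ^ (2 * N + 1)\<bar> \<partial>lborel"])
    fix e :: real assume e: "0 < e" "e \<le> 1"
    let ?s = "\<lambda>x. \<Sum>k<N. (- 1) ^ k * e ^ (2 * k) * (q x * (2 * x) ^ (2 * k + 1))"
    let ?h = "\<lambda>x. q x * (2 * x / (1 + (2 * e * x)\<^sup>2))"
    have d: "\<bar>?h x - ?s x\<bar> \<le> e ^ (2 * N) * \<bar>q x * (2 * x) ^ (2 * N + 1)\<bar>" for x
    proof (cases "x < 0")
      case True
      then show ?thesis by (simp add: q0)
    next
      case False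
      define v where "v = (2 * e * x)\<^sup>2"
      have vk: "v ^ k * (2 * x) = e ^ (2 * k) * (2 * x) ^ (2 * k + 1)" for k
      proof -
        have "v = e\<^sup>2 * (2 * x)\<^sup>2" by (simp add: v_def power2_eq_square)
        then have "v ^ k = e ^ (2 * k) * (2 * x) ^ (2 * k)" by (simp only: power_mult_distrib power_mult)
        then show ?thesis by simp
      qed
      have "?s x = q x * (2 * x) * (\<Sum>k<N. (- v) ^ k)"
        unfolding sum_distrib_left
      proof (rule sum.cong[OF refl])
        fix k
        have "q x * (2 * x) * (- v) ^ k = (- 1) ^ k * (q x * (v ^ k * (2 * x)))"
          by (subst power_minus) (simp only: mult_ac)
        then show "(- 1) ^ k * e ^ (2 * k) * (q x * (2 * x) ^ (2 * k + 1)) = q x * (2 * x) * (- v) ^ k"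
          unfolding vk by (simp only: mult_ac)
      qed
      then have "?h x - ?s x = q x * (2 * x) * (1 / (1 + v) - (\<Sum>k<N. (- v) ^ k))"
        by (simp add: v_def right_diff_distrib)
      then have "\<bar>?h x - ?s x\<bar> = \<bar>q x\<bar> * (2 * x) * \<bar>1 / (1 + v) - (\<Sum>k<N. (- v) ^ k)\<bar>"
        using False by (simp add: abs_mult)
      also have "\<dots> \<le> \<bar>q x\<bar> * (2 * x) * v ^ N"
        using False by (intro mult_left_mono inverse_1_plus_truncation) (auto simp: v_def)
      also have "\<dots> = \<bar>q x\<bar> * (v ^ N * (2 * x))" by (simp only: mult_ac)
      also have "\<dots> = e ^ (2 * N) * \<bar>q x * (2 * x) ^ (2 * N + 1)\<bar>"
        unfolding vk abs_mult using False by simp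
      finally show ?thesis .
    qed
    have si: "integrable lborel ?s"
      by (intro Bochner_Integration.integrable_sum integrable_mult_right q_int)
    have bi: "integrable lborel (\<lambda>x. e ^ (2 * N) * \<bar>q x * (2 * x) ^ (2 * N + 1)\<bar>)"
      by (intro integrable_mult_right integrable_abs q_int)
    have di: "integrable lborel (\<lambda>x. ?h x - ?s x)"
    proof (rule Bochner_Integration.integrable_bound[OF bi])
      show "AE x in lborel. norm (?h x - ?s x) \<le> norm (e ^ (2 * N) * \<bar>q x * (2 * x) ^ (2 * N + 1)\<bar>)"
        unfolding real_norm_def by (intro AE_I2 order_trans[OF d abs_ge_self])
    qed measurable
    have hi: "integrable lborel ?h" using Bochner_Integration.integrable_add[OF di si] by simp
    have "bessel_stieltjes m e = integral\<^sup>L lborel ?h"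
      by (simp add: bessel_stieltjes_def q_def mult.assoc)
    moreover have "integral\<^sup>L lborel ?s = (\<Sum>k<N. (- 1) ^ k * e ^ (2 * k) * bessel_moment m (2 * k + 1))"
      unfolding q_mom by (subst Bochner_Integration.integral_sum[OF integrable_mult_right[OF q_int]])
        (simp only: Bochner_Integration.integral_mult_right_zero)
    moreover have "(\<Sum>j<2 * N. fps_nth (bessel_stieltjes_fps m) j * of_real e ^ j)
      = of_real (\<Sum>k<N. (- 1) ^ k * e ^ (2 * k) * bessel_moment m (2 * k + 1))"
    proof (induction N)
      case (Suc N)
      have "(\<Sum>j<2 * Suc N. fps_nth (bessel_stieltjes_fps m) j * of_real e ^ j)
        = (\<Sum>j<2 * N. fps_nth (bessel_stieltjes_fps m) j * of_real e ^ j)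
          + fps_nth (bessel_stieltjes_fps m) (2 * N) * of_real e ^ (2 * N)"
        by (simp add: bessel_stieltjes_fps_def)
      then show ?case unfolding Suc by (simp add: bessel_stieltjes_fps_def)
    qed simp
    ultimately have "of_real (bessel_stieltjes m e) - (\<Sum>j<2 * N. fps_nth (bessel_stieltjes_fps m) j * of_real e ^ j)
      = complex_of_real (\<integral>x. ?h x - ?s x \<partial>lborel)"
      using hi si by (simp add: Bochner_Integration.integral_diff[OF hi si])
    then have "norm (of_real (bessel_stieltjes m e) - (\<Sum>j<2 * N. fps_nth (bessel_stieltjes_fps m) j * of_real e ^ j))
      = norm (\<integral>x. ?h x - ?s x \<partial>lborel)" by simp
    also have "\<dots> \<le> (\<integral>x. norm (?h x - ?s x) \<partial>lborel)" by (rule integral_norm_bound)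
    also have "\<dots> \<le> (\<integral>x. e ^ (2 * N) * \<bar>q x * (2 * x) ^ (2 * N + 1)\<bar> \<partial>lborel)"
      using d by (intro integral_mono integrable_norm di bi) auto
    also have "\<dots> = (\<integral>x. \<bar>q x * (2 * x) ^ (2 * N + 1)\<bar> \<partial>lborel) * e ^ (2 * N)"
      by (simp only: Bochner_Integration.integral_mult_right_zero mult.commute)
    finally show "norm (of_real (bessel_stieltjes m e) - (\<Sum>j<2 * N. fps_nth (bessel_stieltjes_fps m) j * of_real e ^ j))
      \<le> (\<integral>x. \<bar>q x * (2 * x) ^ (2 * N + 1)\<bar> \<partial>lborel) * e ^ (2 * N)" .
  qed
  then show ?thesis by (rule asym_fps_mono) simp
qed

text \<open>Both sides are \<open>bessel_hp\<close> at i/(2e), raised to the power 2m: once through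
  its Gaussian integrals, once through Cauchy's formula. The factor e^2 on the right comes from the
  rescaled Stieltjes kernel.\<close>

lemma bessel_phi_eq_stieltjes:
  assumes m: "m \<ge> 1" and e: "e > 0"
  shows "(- 1) ^ m * of_real e ^ (2 * m) * (bessel_phi (- 1) e * bessel_phi 1 e) ^ (2 * m)
    = of_real (4 / pi) * (of_real e ^ 2 * of_real (bessel_stieltjes m e))"
proof -
  let ?y = "1 / (2 * e)"
  have k: "x / (x\<^sup>2 + ?y\<^sup>2) = 2 * e\<^sup>2 * (2 * x / (1 + (2 * e * x)\<^sup>2))" for x
  proof -
    have "x\<^sup>2 + ?y\<^sup>2 = (1 + (2 * e * x)\<^sup>2) / (4 * e\<^sup>2)" using e by (simp add: field_simps power2_eq_square)
    then show ?thesis by (simp add: field_simps)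
  qed
  have "(- 1) ^ m * of_real e ^ (2 * m) * (bessel_phi (- 1) e * bessel_phi 1 e) ^ (2 * m)
      = ((- \<i>) ^ (2 * m)) * of_real e ^ (2 * m) * (bessel_phi (- 1) e * bessel_phi 1 e) ^ (2 * m)"
    by (simp add: power_mult)
  also have "\<dots> = bessel_hp (\<i> * of_real ?y) ^ (2 * m)"
    unfolding bessel_hp_imag[OF e] power_mult_distrib ..
  also have "\<dots> = of_real (2 / pi * (\<integral>x. indicator {0..} x * (Im (bessel_hp (of_real x) ^ (2 * m)) * (x / (x\<^sup>2 + ?y\<^sup>2))) \<partial>lborel))"
    using e by (intro bessel_hp_stieltjes m) simp
  also have "(\<integral>x. indicator {0..} x * (Im (bessel_hp (of_real x) ^ (2 * m)) * (x / (x\<^sup>2 + ?y\<^sup>2))) \<partial>lborel)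
      = (\<integral>x. 2 * e\<^sup>2 * (indicator {0..} x * (Im (bessel_hp (of_real x) ^ (2 * m)) * (2 * x / (1 + (2 * e * x)\<^sup>2)))) \<partial>lborel)"
    unfolding k by (simp only: mult_ac)
  also have "\<dots> = 2 * e\<^sup>2 * bessel_stieltjes m e"
    unfolding bessel_stieltjes_def by (rule Bochner_Integration.integral_mult_right_zero)
  finally show ?thesis by simp
qed

text \<open>Uniqueness of asymptotic expansions turns the two evaluations of the 2m-th power into an
  identity of series. The shifts by e^(2m) on one side and e^2 on the other produce the exponent 2(n
  + m) - 3.\<close>

lemma bessel_moment_eq_coeff:
  assumes m: "m \<ge> 1" and n: "n \<ge> 1"
  shows "fps_nth (bessel_prod_fps ^ (2 * m)) (2 * (n - 1)) = - (4 / pi ^ (2 * m + 1)) * bessel_moment m (2 * (n + m) - 3)"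
proof -
  obtain q where q: "m = Suc q" using m by (cases m) auto
  obtain p where p: "n = Suc p" using n by (cases n) auto
  define c where "c = fps_nth (bessel_prod_fps ^ (2 * m)) (2 * (n - 1))"
  define F where "F = fps_const ((- 1) ^ m) * (fps_X ^ (2 * m) * (fps_const (of_real (pi ^ (2 * m))) * fps_twist (bessel_prod_fps ^ (2 * m))))"
  define G where "G = fps_const (of_real (4 / pi)) * (fps_X ^ 2 * bessel_stieltjes_fps m)"
  have "F = G"
  proof (rule asym_fps_unique)
    let ?f = "\<lambda>e. (- 1) ^ m * (of_real e ^ (2 * m) * (bessel_phi (- 1) e * bessel_phi 1 e) ^ (2 * m))"
    let ?g = "\<lambda>e. of_real (4 / pi) * (of_real e ^ 2 * of_real (bessel_stieltjes m e))"
    fix N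
    show "asym_fps N ?f F"
      unfolding F_def by (intro asym_fps_cmult asym_fps_mult asym_fps_power asym_fps_of_real bessel_phi_prod_power_asym)
    have "asym_fps N ?g G"
      unfolding G_def by (intro asym_fps_cmult asym_fps_mult asym_fps_power asym_fps_of_real bessel_stieltjes_asym m)
    then show "asym_fps N ?f G"
      by (subst asym_fps_cong[of ?f ?g]) (simp_all only: bessel_phi_eq_stieltjes[OF m, symmetric] mult.assoc)
  qed
  \<comment> \<open>With n = p + 1 and m = q + 1 this order selects index 2p of the power of w and
    the moment of index 2(p + q) + 1. The signs are (-1)^(m + p) and (-1)^(p + q); their quotient is
    the minus sign in the claim.\<close>
  then have "fps_nth F (2 * m + 2 * p) = fps_nth G (2 * m + 2 * p)" by simp
  moreover have "fps_nth F (2 * m + 2 * p) = of_real ((- 1) ^ m * (- 1) ^ p * pi ^ (2 * m) * c)"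
  proof -
    have "(- \<i>) ^ (2 * p) = (- 1) ^ p" by (simp add: power_mult)
    then show ?thesis by (simp add: F_def fps_X_power_mult_nth fps_twist_def c_def p)
  qed
  moreover have "fps_nth G (2 * m + 2 * p) = of_real (4 / pi * ((- 1) ^ (p + q) * bessel_moment m (2 * (n + m) - 3)))"
  proof -
    have a: "2 * m + 2 * p = 2 + 2 * (p + q)" "2 * (n + m) - 3 = 2 * (p + q) + 1" by (simp_all add: q p)
    show ?thesis unfolding a by (simp add: G_def fps_X_power_mult_nth bessel_stieltjes_fps_def)
  qed
  ultimately have "(- 1) ^ m * (- 1) ^ p * pi ^ (2 * m) * c = 4 / pi * ((- 1) ^ (p + q) * bessel_moment m (2 * (n + m) - 3))"
    using of_real_eq_iff by metis
  then have "pi ^ (2 * m) * c = - (4 / pi) * bessel_moment m (2 * (n + m) - 3)"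
    by (cases "even p"; cases "even q") (simp_all add: q power_add)
  then show ?thesis unfolding c_def[symmetric] by (simp add: field_simps)
qed

text \<open>The integer exponent of \<open>pi * bessel_I0 t\<close> is negative only for l = m + 1,
  where it is -1; that summand vanishes because its binomial coefficient is
  \<open>2 * m choose (2 * m + 1)\<close>. For the other l it is an ordinary power.\<close>

lemma powi_sum_eq_bessel_moment:
  assumes m: "m \<ge> 1"
  shows "(\<Sum>l = 1..m + 1. (- 1) ^ (l - 1) * real ((2 * m) choose (2 * l - 1)) *
        (LBINT t:{0<..}.
           (pi * bessel_I0 t) powi (2 * (int m - int l) + 1) *
           bessel_K0 t ^ (2 * (m + l) - 1) * (2 * t) ^ M)) = - bessel_moment m M"
proof -
  have "(\<Sum>l = 1..m + 1. (- 1) ^ (l - 1) * real ((2 * m) choose (2 * l - 1)) *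
        (LBINT t:{0<..}.
           (pi * bessel_I0 t) powi (2 * (int m - int l) + 1) *
           bessel_K0 t ^ (2 * (m + l) - 1) * (2 * t) ^ M))
    = (\<Sum>l = 1..m. (- 1) ^ (l - 1) * real ((2 * m) choose (2 * l - 1)) *
        (LBINT t:{0<..}.
           (pi * bessel_I0 t) powi (2 * (int m - int l) + 1) *
           bessel_K0 t ^ (2 * (m + l) - 1) * (2 * t) ^ M))"
    by (simp add: binomial_eq_0)
  also have "\<dots> = (\<Sum>j=1..m. (- 1) ^ (j - 1) * real (2 * m choose (2 * j - 1)) *
      (LBINT t:{0<..}. (pi * bessel_I0 t) ^ (2 * m - (2 * j - 1)) * bessel_K0 t ^ (2 * m + (2 * j - 1)) * (2 * t) ^ M))"
  proof (rule sum.cong[OF refl])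
    fix l assume l: "l \<in> {1..m}"
    have "2 * (int m - int l) + 1 = int (2 * m - (2 * l - 1))" using l by (auto simp: of_nat_diff)
    moreover have "2 * (m + l) - 1 = 2 * m + (2 * l - 1)" using l by auto
    ultimately show "(- 1) ^ (l - 1) * real ((2 * m) choose (2 * l - 1)) *
        (LBINT t:{0<..}.
           (pi * bessel_I0 t) powi (2 * (int m - int l) + 1) *
           bessel_K0 t ^ (2 * (m + l) - 1) * (2 * t) ^ M)
      = (- 1) ^ (l - 1) * real (2 * m choose (2 * l - 1)) *
      (LBINT t:{0<..}. (pi * bessel_I0 t) ^ (2 * m - (2 * l - 1)) * bessel_K0 t ^ (2 * m + (2 * l - 1)) * (2 * t) ^ M)"
      by (simp only: power_int_of_nat)
  qed
  also have "\<dots> = - bessel_moment m M"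
    unfolding bessel_moment_integrable_eq(2)[OF m] by simp
  finally show ?thesis .
qed

theorem mainTheorem4:
  fixes m n :: nat
  assumes "m \<ge> 1" and "n \<ge> 1"
  shows "\<exists>k::nat. k > 0 \<and>
    4 / pi ^ (2 * m + 1) *
      (\<Sum>l = 1..m + 1. (- 1) ^ (l - 1) * real ((2 * m) choose (2 * l - 1)) *
        (LBINT t:{0<..}.
           (pi * bessel_I0 t) powi (2 * (int m - int l) + 1) *
           bessel_K0 t ^ (2 * (m + l) - 1) *
           (2 * t) ^ (2 * (n + m) - 3)))
    = real k"
proof -
  obtain c where c: "c > 0" "fps_nth (bessel_prod_fps ^ (2 * m)) (2 * (n - 1)) = real c"
    using bessel_prod_fps_power_nat[OF assms(1)] by blast
  then show ?thesis
    unfolding powi_sum_eq_bessel_moment[OF assms(1)]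
    using bessel_moment_eq_coeff[OF assms] by (intro exI[of _ c]) simp
qed

end
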